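(* Consider $y=X\beta+z$ with $z\sim N(0,I_n)$, $\beta$ as in the context, and $X$ independent of $(\beta,z)$ with i.i.d. rows drawn from $N(0,n^{-1}\Sigma)$, where $\Sigma=\mathrm{diag}(B,\dots,B,B_0)$ as in the context. Suppose $n=p^\omega$ with $\omega>1-\vartheta$. Define the minimax Hamming error $H^*(\vartheta,r,\rho)=\inf_{\hat\beta}\mathbb{E}[H(\hat\beta,\beta)]$, the infimum over all estimators and the expectation over $(X,\beta,z)$. Then there exists a number $h^{**}(\vartheta,r,\rho)$ such that $H^*(\vartheta,r,\rho)=L_pp^{1-h^{**}(\vartheta,r,\rho)}$. Moreover, if instead $X$ is deterministic with $X^\top X=\Sigma$ (and $H^*$ defined analogously with expectation over $(\beta,z)$), then also $H^*(\vartheta,r,\rho)=L_pp^{1-h^{**}(\vartheta,r,\rho)}$ with the same $h^{**}$.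
   Context: $p\to\infty$. $\Sigma=\mathrm{diag}(B,\dots,B,B_0)\in\mathbb{R}^{p\times p}$ with $B=\begin{pmatrix}1&\rho\\ \rho&1\end{pmatrix}$, $\rho\in(-1,1)$ fixed, $B_0=B$ if $p$ is even and $B_0=1$ if $p$ is odd. The $\beta_j$ are i.i.d. (independent of $z$), equal to $\tau_p=\sqrt{2r\log p}$ with probability $p^{-\vartheta}$ and $0$ otherwise, with fixed $\vartheta\in(0,1)$, $r>0$. Hamming error $H(\hat\beta,\beta)=\sum_j(1\{\hat\beta_j\ne0,\beta_j=0\}+1\{\hat\beta_j=0,\beta_j\ne0\})$. $L_p$ denotes a generic multi-$\log(p)$ term: $L_pp^{\epsilon}\to\infty$ and $L_pp^{-\epsilon}\to0$ for every $\epsilon>0$. *)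

theory Defs
  imports "HOL-Probability.Probability"
begin

definition N01 :: "real measure" where
  "N01 = density lborel std_normal_density"

text \<open>The covariance matrix Sigma = diag(B,...,B,B_0) of size p x p, indices 0..p-1.
  Blocks are {2k, 2k+1}; if p is odd the last index p-1 forms a 1x1 block (B_0 = 1).\<close>
definition Sigma_mat :: "real \<Rightarrow> nat \<Rightarrow> nat \<Rightarrow> nat \<Rightarrow> real" where
  "Sigma_mat \<rho> p j k =
     (if j < p \<and> k < p then
        (if j = k then 1 else if j div 2 = k div 2 then \<rho> else 0)
      else 0)"

definition tau :: "real \<Rightarrow> nat \<Rightarrow> real" where
  "tau r p = sqrt (2 * r * ln (real p))"

definition beta_prior :: "real \<Rightarrow> real \<Rightarrow> nat \<Rightarrow> real measure" where
  "beta_prior \<theta> r p =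
     distr (measure_pmf (bernoulli_pmf (real p powr (- \<theta>)))) borel
           (\<lambda>b. if b then tau r p else 0)"

definition hamming :: "nat \<Rightarrow> (nat \<Rightarrow> real) \<Rightarrow> (nat \<Rightarrow> real) \<Rightarrow> real" where
  "hamming p b' b =
     (\<Sum>j<p. (if b' j \<noteq> 0 \<and> b j = 0 then 1 else 0)
           + (if b' j = 0 \<and> b j \<noteq> 0 then 1 else 0))"

definition mat_space :: "nat \<Rightarrow> nat \<Rightarrow> ((nat \<times> nat) \<Rightarrow> real) measure" where
  "mat_space n p = PiM ({..<n} \<times> {..<p}) (\<lambda>_. borel)"

definition vec_space :: "nat \<Rightarrow> (nat \<Rightarrow> real) measure" where
  "vec_space d = PiM {..<d} (\<lambda>_. borel)"

text \<open>Random design: X = (1/sqrt n) W L^T where W has i.i.d. N(0,1) entries and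
  L L^T = Sigma, so that the rows of X are i.i.d. N(0, Sigma/n).\<close>
definition design :: "(nat \<Rightarrow> nat \<Rightarrow> real) \<Rightarrow> nat \<Rightarrow> nat \<Rightarrow> ((nat \<times> nat) \<Rightarrow> real)
                      \<Rightarrow> ((nat \<times> nat) \<Rightarrow> real)" where
  "design L n p W = (\<lambda>(i,k)\<in>{..<n} \<times> {..<p}. (1 / sqrt (real n)) * (\<Sum>m<p. L k m * W (i, m)))"

definition response :: "nat \<Rightarrow> nat \<Rightarrow> ((nat \<times> nat) \<Rightarrow> real) \<Rightarrow> (nat \<Rightarrow> real)
                        \<Rightarrow> (nat \<Rightarrow> real) \<Rightarrow> (nat \<Rightarrow> real)" where
  "response n p X b z = (\<lambda>i\<in>{..<n}. (\<Sum>k<p. X (i, k) * b k) + z i)"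

definition rand_model :: "real \<Rightarrow> real \<Rightarrow> nat \<Rightarrow> nat
     \<Rightarrow> (((nat \<times> nat) \<Rightarrow> real) \<times> ((nat \<Rightarrow> real) \<times> (nat \<Rightarrow> real))) measure" where
  "rand_model \<theta> r n p =
     PiM ({..<n} \<times> {..<p}) (\<lambda>_. N01)
       \<Otimes>\<^sub>M (PiM {..<p} (\<lambda>_. beta_prior \<theta> r p) \<Otimes>\<^sub>M PiM {..<n} (\<lambda>_. N01))"

definition Hstar_rand :: "real \<Rightarrow> real \<Rightarrow> (nat \<Rightarrow> nat \<Rightarrow> real) \<Rightarrow> nat \<Rightarrow> nat \<Rightarrow> real" where
  "Hstar_rand \<theta> r L n p =
     (INF f \<in> (mat_space n p \<Otimes>\<^sub>M vec_space n) \<rightarrow>\<^sub>M vec_space p.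
        integral\<^sup>L (rand_model \<theta> r n p)
          (\<lambda>(W, b, z). let X = design L n p W in
                        hamming p (f (X, response n p X b z)) b))"

definition det_model :: "real \<Rightarrow> real \<Rightarrow> nat \<Rightarrow> nat
     \<Rightarrow> ((nat \<Rightarrow> real) \<times> (nat \<Rightarrow> real)) measure" where
  "det_model \<theta> r n p =
     PiM {..<p} (\<lambda>_. beta_prior \<theta> r p) \<Otimes>\<^sub>M PiM {..<n} (\<lambda>_. N01)"

definition Hstar_det :: "real \<Rightarrow> real \<Rightarrow> (nat \<Rightarrow> nat \<Rightarrow> real) \<Rightarrow> nat \<Rightarrow> nat \<Rightarrow> real" where
  "Hstar_det \<theta> r X n p =
     (INF f \<in> vec_space n \<rightarrow>\<^sub>M vec_space p.
        integral\<^sup>L (det_model \<theta> r n p)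
          (\<lambda>(b, z). hamming p (f (response n p (\<lambda>(i,k). X i k) b z)) b))"

text \<open>A sequence a_p is of the form L_p p^c, i.e. a_p / p^c is a multi-log(p) term.\<close>
definition is_Lp :: "(nat \<Rightarrow> real) \<Rightarrow> bool" where
  "is_Lp Lp \<longleftrightarrow> (\<forall>\<epsilon>>0. filterlim (\<lambda>p. Lp p * real p powr \<epsilon>) at_top sequentially
                      \<and> (\<lambda>p. Lp p * real p powr (- \<epsilon>)) \<longlonglongrightarrow> 0)"

end

theory Submission
  imports Defs
begin

text \<open>Only the Gram matrix of the design matters inside a block. For two supports \<open>A, A'\<close> in one block of
  size at most two, the log-likelihood ratio test with prior weights \<open>p powr (- \<theta> |A|)\<close> and
  \<open>p powr (- \<theta> |A'|)\<close> and squared distance \<open>\<tau>\<^sup>2 Q\<close> has error exponent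
  \<open>max\<^sub>t ((1 - t) \<theta> |A| + t \<theta> |A'| + t (1 - t) r Q)\<close>, and \<open>h\<close> is the smallest such exponent.

  For the lower bound an oracle reveals all coordinates outside the block. The Cameron--Martin
  formula centres the noise between the two hypotheses at the optimal \<open>t\<close>. The bound decreases in the distance
  of the two mean vectors, so for random design Markov's inequality for the squared distance is enough.

  For the upper bound, blockwise maximum a posteriori selection is analysed by Chernoff's inequality. For random
  design the coordinates outside the block act as additional Gaussian noise independent of the columns
  in the block; its variance is of order \<open>p powr (1 - \<theta>) \<tau>\<^sup>2 / n\<close>, which vanishes polynomially because
  \<open>\<omega> > 1 - \<theta>\<close>. Independence of two orthogonal linear functionals of a Gaussian vector follows from planar
  rotation invariance.\<close>

section \<open>Standard Gaussian measures\<close>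

text \<open>A multi-log factor absorbs constants and \<open>exp (- 6 * tau r p)\<close>, so only the
  power of \<open>p\<close> has to be sharp. This permits crude tools: a union bound over at most
  four supports, an event of small fixed probability, and a factor \<open>exp 2\<close> for the
  randomness of the design. The two bounds are proved against separate predicates:
  \<open>exponent_bound\<close> makes \<open>h\<close> a lower bound for the Chernoff exponents of
  all pairs of supports, and \<open>exponent_attained\<close> says that for one pair both weighted
  error terms are at least of order \<open>p powr (- h)\<close>. They are compatible because the
  optimal Chernoff exponent is a saddle value. Both predicates mention only \<theta>, r, \<rho> and
  \<open>h\<close>, hence one \<open>h\<close> for both designs. The obstacle in the random case is
  that columns of different blocks are orthogonal only in expectation. The surviving cross term is
  handled by averaging the Chernoff bound itself over the design, at fixed coefficients, instead of
  restricting to good designs. This needs a bound on the number of signals, whose failure has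
  probability at most \<open>p powr (- h)\<close>. Integrals are taken in \<open>ennreal\<close>,
  where Fubini asks for measurability only.\<close>

lemma prob_space_N01: "prob_space N01"
  unfolding N01_def by (rule prob_space_normal_density) simp

lemma sets_N01 [simp, measurable_cong]: "sets N01 = sets borel"
  by (simp add: N01_def)

lemma space_N01 [simp]: "space N01 = UNIV"
  by (simp add: N01_def)

interpretation N01: prob_space N01
  by (rule prob_space_N01)

interpretation N01P: product_sigma_finite "\<lambda>i. N01"
  by (intro product_sigma_finite.intro N01.sigma_finite_measure_axioms)

lemma prob_space_PiM_N01: "prob_space (PiM I (\<lambda>_. N01))"
  by (intro prob_space_PiM prob_space_N01)

section \<open>One-dimensional Gaussian integrals\<close>

lemma nn_integral_N01:
  assumes [measurable]: "f \<in> borel_measurable borel"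
  shows "(\<integral>\<^sup>+x. f x \<partial>N01) = (\<integral>\<^sup>+x. ennreal (std_normal_density x) * f x \<partial>lborel)"
  unfolding N01_def by (subst nn_integral_density) auto

lemma nn_integral_normal_density:
  "0 < \<sigma> \<Longrightarrow> (\<integral>\<^sup>+x. ennreal (normal_density \<mu> \<sigma> x) \<partial>lborel) = 1"
  using prob_space.emeasure_space_1[OF prob_space_normal_density[of \<sigma> \<mu>]]
  by (simp add: emeasure_density)

lemma N01_mgf: "(\<integral>\<^sup>+x. ennreal (exp (s * x)) \<partial>N01) = ennreal (exp (s\<^sup>2 / 2))"
proof -
  have "(\<integral>\<^sup>+x. ennreal (exp (s * x)) \<partial>N01)
      = (\<integral>\<^sup>+x. ennreal (exp (s\<^sup>2 / 2)) * ennreal (normal_density s 1 x) \<partial>lborel)"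
    by (subst nn_integral_N01, simp)
      (intro nn_integral_cong, simp add: std_normal_density_def normal_density_def
        flip: ennreal_mult exp_add,
        simp add: field_simps power2_eq_square flip: exp_add exp_minus)
  then show ?thesis
    by (simp add: nn_integral_cmult nn_integral_normal_density)
qed

lemma N01_exp_square:
  assumes "-1 < c"
  shows "(\<integral>\<^sup>+x. ennreal (exp (- c * x\<^sup>2 / 2)) \<partial>N01) = ennreal (1 / sqrt (1 + c))"
proof -
  let ?s = "1 / sqrt (1 + c)"
  have s: "?s\<^sup>2 = 1 / (1 + c)"
    using assms by (simp add: power_divide)
  have "(\<integral>\<^sup>+x. ennreal (exp (- c * x\<^sup>2 / 2)) \<partial>N01)
      = (\<integral>\<^sup>+x. ennreal ?s * ennreal (normal_density 0 ?s x) \<partial>lborel)"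
  proof (subst nn_integral_N01, simp, intro nn_integral_cong)
    fix x :: real
    have "std_normal_density x * exp (- c * x\<^sup>2 / 2) = ?s * normal_density 0 ?s x"
      unfolding normal_density_def s using assms
      by (simp add: field_simps real_sqrt_divide real_sqrt_mult flip: exp_add)
    then show "ennreal (std_normal_density x) * ennreal (exp (- c * x\<^sup>2 / 2))
      = ennreal ?s * ennreal (normal_density 0 ?s x)"
      using assms by (simp flip: ennreal_mult)
  qed
  then show ?thesis
    using assms by (simp add: nn_integral_cmult nn_integral_normal_density)
qed

lemma N01_second_moment: "(\<integral>\<^sup>+x. ennreal (x\<^sup>2) \<partial>N01) = 1"
proof -
  have "(\<integral>\<^sup>+x. ennreal (x\<^sup>2) \<partial>N01) = (\<integral>\<^sup>+x. ennreal (std_normal_density x * x\<^sup>2) \<partial>lborel)"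
    by (subst nn_integral_N01) (auto simp: ennreal_mult)
  also have "\<dots> = ennreal (integral\<^sup>L lborel (\<lambda>x. std_normal_density x * x\<^sup>2))"
    by (intro nn_integral_eq_integral integrable_std_normal_moment) auto
  finally show ?thesis
    using integral_std_normal_moment_even[of 1] by simp
qed

text \<open>Translating the variable and comparing the two densities gives the exponential factor;
  this is the one-coordinate step of \<open>gaussian_cameron_martin\<close>.\<close>

lemma N01_shift:
  assumes [measurable]: "f \<in> borel_measurable borel"
  shows "(\<integral>\<^sup>+x. f x \<partial>N01) = (\<integral>\<^sup>+x. f (x + s) * ennreal (exp (- s * x - s\<^sup>2 / 2)) \<partial>N01)"
proof -
  have "(\<integral>\<^sup>+x. f x \<partial>N01) = (\<integral>\<^sup>+x. ennreal (std_normal_density (s + x)) * f (s + x) \<partial>lborel)"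
    by (subst nn_integral_N01, simp, subst nn_integral_real_affine[where c = 1 and t = s]) auto
  also have "\<dots> = (\<integral>\<^sup>+x. ennreal (std_normal_density x) * (f (x + s) * ennreal (exp (- s * x - s\<^sup>2 / 2))) \<partial>lborel)"
  proof (intro nn_integral_cong)
    fix x :: real
    have "std_normal_density (s + x) = std_normal_density x * exp (- s * x - s\<^sup>2 / 2)"
      unfolding std_normal_density_def
      by (simp add: field_simps power2_eq_square flip: exp_add)
    then show "ennreal (std_normal_density (s + x)) * f (s + x)
       = ennreal (std_normal_density x) * (f (x + s) * ennreal (exp (- s * x - s\<^sup>2 / 2)))"
      by (simp add: ennreal_mult ac_simps)
  qed
  finally show ?thesis
    by (subst nn_integral_N01) auto
qed

text \<open>The standard Gaussian measure on the plane is invariant under rotations: its density is, and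
  a rotation is a composition of two affine substitutions in one variable each.\<close>

lemma lborel_rotate:
  fixes a b :: real
  assumes [measurable]: "case_prod G \<in> borel_measurable (borel \<Otimes>\<^sub>M borel)" and ab: "a\<^sup>2 + b\<^sup>2 = 1"
  shows "(\<integral>\<^sup>+y. \<integral>\<^sup>+x. G (a * x - b * y) (b * x + a * y) \<partial>lborel \<partial>lborel)
       = (\<integral>\<^sup>+y. \<integral>\<^sup>+x. G x y \<partial>lborel \<partial>lborel)"
\<comment> \<open>The factorisation divides by \<open>a\<close>; for \<open>a = 0\<close> the
  rotation is a quarter turn, that is, a swap of the variables together with a reflection.\<close>
proof (cases "a = 0")
  case True
  with ab have b: "\<bar>b\<bar> = 1" "b \<noteq> 0" by (auto simp: power2_eq_1_iff)
  have "(\<integral>\<^sup>+y. \<integral>\<^sup>+x. G (a * x - b * y) (b * x + a * y) \<partial>lborel \<partial>lborel)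
     = (\<integral>\<^sup>+y. \<integral>\<^sup>+x. G (- b * y) (0 + b * x) \<partial>lborel \<partial>lborel)"
    by (simp add: True)
  also have "\<dots> = (\<integral>\<^sup>+y. \<integral>\<^sup>+x. G (- b * y) x \<partial>lborel \<partial>lborel)"
    using b by (subst nn_integral_real_affine[where c = b and t = 0]) auto
  also have "\<dots> = (\<integral>\<^sup>+y. \<integral>\<^sup>+x. G y x \<partial>lborel \<partial>lborel)"
    using b by (subst (2) nn_integral_real_affine[where c = "-b" and t = 0]) auto
  also have "\<dots> = (\<integral>\<^sup>+y. \<integral>\<^sup>+x. G x y \<partial>lborel \<partial>lborel)"
    by (rule lborel_pair.Fubini') auto
  finally show ?thesis .
next
  case False
  \<comment> \<open>Replacing \<open>x\<close> by \<open>(b * y + x) / a\<close> turns the first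
    argument into \<open>x\<close> alone, and \<open>a\<^sup>2 + b\<^sup>2 = 1\<close> collapses the
    second. The later substitution in \<open>y\<close> absorbs the factor
    \<open>1 / \<bar>a\<bar>\<close>.\<close>
  have eq: "b * (b * y / a + 1 / a * x) + a * y = (b / a) * x + (1 / a) * y" for x y
  proof -
    have "b * (b * y / a + 1 / a * x) + a * y = (b / a) * x + (a\<^sup>2 + b\<^sup>2) * y / a"
      using False by (simp add: field_simps power2_eq_square)
    then show ?thesis by (simp add: ab)
  qed
  have "(\<integral>\<^sup>+x. G (a * x - b * y) (b * x + a * y) \<partial>lborel)
     = ennreal (1 / \<bar>a\<bar>) * (\<integral>\<^sup>+x. G x ((b / a) * x + (1 / a) * y) \<partial>lborel)" for y
  proof -
    have "(\<integral>\<^sup>+x. G (a * x - b * y) (b * x + a * y) \<partial>lborel) = ennreal \<bar>1 / a\<bar> *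
        (\<integral>\<^sup>+x. G (a * (b * y / a + 1 / a * x) - b * y) (b * (b * y / a + 1 / a * x) + a * y) \<partial>lborel)"
      using False by (intro nn_integral_real_affine) auto
    also have "\<dots> = ennreal (1 / \<bar>a\<bar>) * (\<integral>\<^sup>+x. G x ((b / a) * x + (1 / a) * y) \<partial>lborel)"
      unfolding eq using False by (simp add: distrib_left)
    finally show ?thesis .
  qed
  then have "(\<integral>\<^sup>+y. \<integral>\<^sup>+x. G (a * x - b * y) (b * x + a * y) \<partial>lborel \<partial>lborel)
     = (\<integral>\<^sup>+y. ennreal (1 / \<bar>a\<bar>) * (\<integral>\<^sup>+x. G x ((b / a) * x + (1 / a) * y) \<partial>lborel) \<partial>lborel)"
    by simp
  also have "\<dots> = (\<integral>\<^sup>+y. (\<integral>\<^sup>+x. ennreal (1 / \<bar>a\<bar>) * G x ((b / a) * x + (1 / a) * y) \<partial>lborel) \<partial>lborel)"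
    by (simp add: nn_integral_cmult)
  also have "\<dots> = (\<integral>\<^sup>+x. (\<integral>\<^sup>+y. ennreal (1 / \<bar>a\<bar>) * G x ((b / a) * x + (1 / a) * y) \<partial>lborel) \<partial>lborel)"
    by (rule lborel_pair.Fubini') auto
  also have "\<dots> = (\<integral>\<^sup>+x. (\<integral>\<^sup>+y. G x y \<partial>lborel) \<partial>lborel)"
  proof (rule nn_integral_cong)
    fix x
    show "(\<integral>\<^sup>+y. ennreal (1 / \<bar>a\<bar>) * G x ((b / a) * x + (1 / a) * y) \<partial>lborel) = (\<integral>\<^sup>+y. G x y \<partial>lborel)"
      using False nn_integral_real_affine[of "G x" "1 / a" "(b / a) * x"]
      by (simp add: nn_integral_cmult)
  qed
  also have "\<dots> = (\<integral>\<^sup>+y. \<integral>\<^sup>+x. G x y \<partial>lborel \<partial>lborel)"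
    by (rule lborel_pair.Fubini') auto
  finally show ?thesis .
qed

lemma N01_rotate:
  fixes a b :: real
  assumes [measurable]: "case_prod F \<in> borel_measurable (borel \<Otimes>\<^sub>M borel)" and ab: "a\<^sup>2 + b\<^sup>2 = 1"
  shows "(\<integral>\<^sup>+y. \<integral>\<^sup>+x. F (a * x - b * y) (b * x + a * y) \<partial>N01 \<partial>N01)
       = (\<integral>\<^sup>+y. \<integral>\<^sup>+x. F x y \<partial>N01 \<partial>N01)"
proof -
  define G where "G = (\<lambda>x y. ennreal (exp (- (x\<^sup>2 + y\<^sup>2) / 2) / (2 * pi)) * F x y)"
  have [measurable]: "case_prod G \<in> borel_measurable (borel \<Otimes>\<^sub>M borel)"
    unfolding G_def by measurable
  have dens: "std_normal_density x * std_normal_density y = exp (- (x\<^sup>2 + y\<^sup>2) / 2) / (2 * pi)" for x y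
    by (simp add: std_normal_density_def add_divide_distrib flip: exp_add)
  have conv: "(\<integral>\<^sup>+y. \<integral>\<^sup>+x. H x y \<partial>N01 \<partial>N01)
     = (\<integral>\<^sup>+y. \<integral>\<^sup>+x. ennreal (exp (- (x\<^sup>2 + y\<^sup>2) / 2) / (2 * pi)) * H x y \<partial>lborel \<partial>lborel)"
    if [measurable]: "case_prod H \<in> borel_measurable (borel \<Otimes>\<^sub>M borel)" for H
  proof -
    have "ennreal (std_normal_density y) * (ennreal (std_normal_density x) * H x y)
      = ennreal (exp (- (x\<^sup>2 + y\<^sup>2) / 2) / (2 * pi)) * H x y" for x y
      unfolding dens[symmetric] by (simp add: ennreal_mult mult_ac)
    then show ?thesis
      by (simp add: nn_integral_N01 flip: nn_integral_cmult)
  qed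
  have rot: "(a * x - b * y)\<^sup>2 + (b * x + a * y)\<^sup>2 = x\<^sup>2 + y\<^sup>2" for x y
  proof -
    have "(a * x - b * y)\<^sup>2 + (b * x + a * y)\<^sup>2 = (a\<^sup>2 + b\<^sup>2) * (x\<^sup>2 + y\<^sup>2)"
      by (simp add: power2_eq_square algebra_simps)
    then show ?thesis by (simp add: ab)
  qed
  have "(\<integral>\<^sup>+y. \<integral>\<^sup>+x. F (a * x - b * y) (b * x + a * y) \<partial>N01 \<partial>N01)
     = (\<integral>\<^sup>+y. \<integral>\<^sup>+x. G (a * x - b * y) (b * x + a * y) \<partial>lborel \<partial>lborel)"
    unfolding G_def rot by (rule conv) measurable
  also have "\<dots> = (\<integral>\<^sup>+y. \<integral>\<^sup>+x. G x y \<partial>lborel \<partial>lborel)"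
    by (rule lborel_rotate) (auto simp: ab)
  also have "\<dots> = (\<integral>\<^sup>+y. \<integral>\<^sup>+x. F x y \<partial>N01 \<partial>N01)"
    unfolding G_def by (rule conv[symmetric]) measurable
  finally show ?thesis .
qed

lemma emeasure_N01_UNIV [simp]: "emeasure N01 UNIV = 1"
  using N01.emeasure_space_1 by simp

text \<open>The rotation with cosine \<open>e / d\<close> and sine \<open>- c / d\<close> carries
  \<open>d * x\<close> into \<open>e * x + c * y\<close>, and the other variable integrates out. For
  \<open>d = 0\<close> both coefficients vanish.\<close>

lemma N01_linear_combination:
  assumes [measurable]: "F \<in> borel_measurable borel" and d: "d\<^sup>2 = e\<^sup>2 + c\<^sup>2"
  shows "(\<integral>\<^sup>+y. \<integral>\<^sup>+x. F (e * x + c * y) \<partial>N01 \<partial>N01) = (\<integral>\<^sup>+x. F (d * x) \<partial>N01)"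
proof (cases "d = 0")
  case True
  then have "e = 0" "c = 0" using d by (auto simp: sum_power2_eq_zero_iff)
  then show ?thesis by (simp add: True N01.emeasure_space_1[simplified])
next
  case False
  have ab: "(e / d)\<^sup>2 + (- c / d)\<^sup>2 = 1"
    using False by (simp add: power_divide flip: add_divide_distrib d)
  have "(\<integral>\<^sup>+y. \<integral>\<^sup>+x. F (d * (e / d * x - (- c / d) * y)) \<partial>N01 \<partial>N01)
      = (\<integral>\<^sup>+y. \<integral>\<^sup>+x. F (d * x) \<partial>N01 \<partial>N01)"
    by (rule N01_rotate[OF _ ab, of "\<lambda>x y. F (d * x)"]) measurable
  moreover have "d * (e / d * x - (- c / d) * y) = e * x + c * y" for x y
    using False by (simp add: field_simps)
  ultimately show ?thesis
    by (simp)
qed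

interpretation N01_pair: pair_sigma_finite N01 N01
  by (intro pair_sigma_finite.intro N01.sigma_finite_measure_axioms)

text \<open>The numbers \<open>a, b, c\<close> form a Cholesky factor of the Gram matrix of \<open>u\<close> and \<open>v\<close>.\<close>

lemma gaussian_pair_law:
  fixes u v :: "'i \<Rightarrow> real"
  assumes "finite I"
  shows "\<exists>a b c. a\<^sup>2 = (\<Sum>i\<in>I. (u i)\<^sup>2) \<and> a * b = (\<Sum>i\<in>I. u i * v i) \<and> b\<^sup>2 + c\<^sup>2 = (\<Sum>i\<in>I. (v i)\<^sup>2)
    \<and> (a = 0 \<longrightarrow> b = 0)
    \<and> (\<forall>F. case_prod F \<in> borel_measurable (borel \<Otimes>\<^sub>M borel) \<longrightarrow>
        (\<integral>\<^sup>+w. F (\<Sum>i\<in>I. u i * w i) (\<Sum>i\<in>I. v i * w i) \<partial>PiM I (\<lambda>_. N01))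
        = (\<integral>\<^sup>+y. \<integral>\<^sup>+x. (F (a * x) (b * x + c * y) :: ennreal) \<partial>N01 \<partial>N01))"
  using assms
proof (induction I)
  case empty
  interpret E: prob_space "PiM {} (\<lambda>_::'i. N01)" by (rule prob_space_PiM_N01)
  show ?case
    by (intro exI[of _ 0]) (simp add: E.emeasure_space_1)
next
  case (insert i I)
  then obtain a b c where abc: "a\<^sup>2 = (\<Sum>i\<in>I. (u i)\<^sup>2)" "a * b = (\<Sum>i\<in>I. u i * v i)"
    "b\<^sup>2 + c\<^sup>2 = (\<Sum>i\<in>I. (v i)\<^sup>2)" "a = 0 \<longrightarrow> b = 0"
    and IH: "\<And>F. case_prod F \<in> borel_measurable (borel \<Otimes>\<^sub>M borel) \<Longrightarrow>
        (\<integral>\<^sup>+w. F (\<Sum>i\<in>I. u i * w i) (\<Sum>i\<in>I. v i * w i) \<partial>PiM I (\<lambda>_. N01))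
        = (\<integral>\<^sup>+y. \<integral>\<^sup>+x. (F (a * x) (b * x + c * y) :: ennreal) \<partial>N01 \<partial>N01)"
    by blast
  define a' where "a' = sqrt (a\<^sup>2 + (u i)\<^sup>2)"
  have a': "a'\<^sup>2 = a\<^sup>2 + (u i)\<^sup>2" by (simp add: a'_def)
  have step: "(\<integral>\<^sup>+w. F (\<Sum>j\<in>insert i I. u j * w j) (\<Sum>j\<in>insert i I. v j * w j) \<partial>PiM (insert i I) (\<lambda>_. N01))
     = (\<integral>\<^sup>+y. \<integral>\<^sup>+z. \<integral>\<^sup>+x. F (a * x + u i * z) (b * x + c * y + v i * z) \<partial>N01 \<partial>N01 \<partial>N01)"
    if [measurable]: "case_prod F \<in> borel_measurable (borel \<Otimes>\<^sub>M borel)" for F :: "real \<Rightarrow> real \<Rightarrow> ennreal"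
  proof -
    have upd: "(\<Sum>j\<in>insert i I. g j * (w(i := z)) j) = (\<Sum>j\<in>I. g j * w j) + g i * z"
      for g w and z :: real
    proof -
      have "(\<Sum>j\<in>I. g j * (w(i := z)) j) = (\<Sum>j\<in>I. g j * w j)"
        using insert(2) by (intro sum.cong) auto
      then show ?thesis using insert(1,2) by simp
    qed
    have "(\<integral>\<^sup>+w. F (\<Sum>j\<in>insert i I. u j * w j) (\<Sum>j\<in>insert i I. v j * w j) \<partial>PiM (insert i I) (\<lambda>_. N01))
      = (\<integral>\<^sup>+z. \<integral>\<^sup>+w. F ((\<Sum>j\<in>I. u j * w j) + u i * z) ((\<Sum>j\<in>I. v j * w j) + v i * z) \<partial>PiM I (\<lambda>_. N01) \<partial>N01)"
      using insert(1,2) unfolding upd[symmetric]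
      by (intro N01P.product_nn_integral_insert_rev) measurable
    also have "\<dots> = (\<integral>\<^sup>+z. \<integral>\<^sup>+y. \<integral>\<^sup>+x. F (a * x + u i * z) (b * x + c * y + v i * z) \<partial>N01 \<partial>N01 \<partial>N01)"
    proof (rule nn_integral_cong)
      fix z
      show "(\<integral>\<^sup>+w. F ((\<Sum>j\<in>I. u j * w j) + u i * z) ((\<Sum>j\<in>I. v j * w j) + v i * z) \<partial>PiM I (\<lambda>_. N01))
        = (\<integral>\<^sup>+y. \<integral>\<^sup>+x. F (a * x + u i * z) (b * x + c * y + v i * z) \<partial>N01 \<partial>N01)"
        by (rule IH[of "\<lambda>x y. F (x + u i * z) (y + v i * z)"]) measurable
    qed
    also have "\<dots> = (\<integral>\<^sup>+y. \<integral>\<^sup>+z. \<integral>\<^sup>+x. F (a * x + u i * z) (b * x + c * y + v i * z) \<partial>N01 \<partial>N01 \<partial>N01)"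
      by (rule N01_pair.Fubini') measurable
    finally show ?thesis .
  qed
  show ?case
  proof (cases "a' = 0")
    case True
    then have 0: "a = 0" "u i = 0" "b = 0"
      using a' abc(4) by (auto simp: sum_power2_eq_zero_iff)
    \<comment> \<open>Here \<open>u\<close> vanishes on the whole index set, so a single coordinate
      carries the second functional.\<close>
    let ?c = "sqrt ((v i)\<^sup>2 + c\<^sup>2)"
    have "(\<integral>\<^sup>+y. \<integral>\<^sup>+z. \<integral>\<^sup>+x. F (a * x + u i * z) (b * x + c * y + v i * z) \<partial>N01 \<partial>N01 \<partial>N01)
        = (\<integral>\<^sup>+y. \<integral>\<^sup>+x. F (0 * x) (0 * x + ?c * y) \<partial>N01 \<partial>N01)"
      if [measurable]: "case_prod F \<in> borel_measurable (borel \<Otimes>\<^sub>M borel)" for F :: "real \<Rightarrow> real \<Rightarrow> ennreal"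
      using N01_linear_combination[of "F 0" ?c "v i" c]
      by (simp add: 0 add.commute)
    with step show ?thesis
      using insert(1,2) 0 abc
      by (rule_tac exI[of _ 0], rule_tac exI[of _ 0], rule_tac exI[of _ ?c]) (simp add: sum_nonneg)
  next
    case False
    \<comment> \<open>Rotating \<open>(x, z)\<close> so that \<open>a * x + u i * z\<close> becomes
      \<open>a' * x\<close> turns \<open>b * x + v i * z\<close> into \<open>B * x + e * z\<close>.
      The leftover \<open>e * z + c * y\<close> does not involve \<open>x\<close> and merges into
      \<open>c' * y\<close>.\<close>
    define B where "B = (a * b + u i * v i) / a'"
    define e where "e = (a * v i - b * u i) / a'"
    define c' where "c' = sqrt (e\<^sup>2 + c\<^sup>2)"
    have c': "c'\<^sup>2 = e\<^sup>2 + c\<^sup>2" by (simp add: c'_def)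
    have "(a * b + u i * v i)\<^sup>2 + (a * v i - b * u i)\<^sup>2 = (a\<^sup>2 + (u i)\<^sup>2) * (b\<^sup>2 + (v i)\<^sup>2)"
      by (simp add: power2_eq_square algebra_simps)
    then have "B\<^sup>2 + e\<^sup>2 = a'\<^sup>2 * (b\<^sup>2 + (v i)\<^sup>2) / a'\<^sup>2"
      unfolding B_def e_def power_divide add_divide_distrib[symmetric] a' by simp
    also have "\<dots> = b\<^sup>2 + (v i)\<^sup>2"
      using False by simp
    finally have Be: "B\<^sup>2 + e\<^sup>2 = b\<^sup>2 + (v i)\<^sup>2" .
    have ab1: "(a / a')\<^sup>2 + (- u i / a')\<^sup>2 = 1"
      unfolding power_divide power2_minus add_divide_distrib[symmetric] a'[symmetric] using False by simp
    have x1: "a' * (a / a' * x - (- u i / a') * z) = a * x + u i * z" for x z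
      using False by (simp add: field_simps)
    have y1: "B * (a / a' * x - (- u i / a') * z) + e * (- u i / a' * x + a / a' * z) = b * x + v i * z" for x z
    proof -
      have "B * (a / a' * x - (- u i / a') * z) = (a * b + u i * v i) * (a * x + u i * z) / a'\<^sup>2"
        "e * (- u i / a' * x + a / a' * z) = (a * v i - b * u i) * (- u i * x + a * z) / a'\<^sup>2"
        using False by (auto simp: B_def e_def power2_eq_square divide_simps)
      moreover have "(a * b + u i * v i) * (a * x + u i * z) + (a * v i - b * u i) * (- u i * x + a * z)
        = a'\<^sup>2 * (b * x + v i * z)"
        unfolding a' by (simp add: power2_eq_square algebra_simps)
      ultimately show ?thesis using False
        by (simp only: add_divide_distrib[symmetric]) simp
    qed
    have "(\<integral>\<^sup>+y. \<integral>\<^sup>+z. \<integral>\<^sup>+x. F (a * x + u i * z) (b * x + c * y + v i * z) \<partial>N01 \<partial>N01 \<partial>N01)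
        = (\<integral>\<^sup>+y. \<integral>\<^sup>+x. F (a' * x) (B * x + c' * y) \<partial>N01 \<partial>N01)"
      if [measurable]: "case_prod F \<in> borel_measurable (borel \<Otimes>\<^sub>M borel)" for F :: "real \<Rightarrow> real \<Rightarrow> ennreal"
    proof -
      have "(\<integral>\<^sup>+z. \<integral>\<^sup>+x. F (a * x + u i * z) (b * x + c * y + v i * z) \<partial>N01 \<partial>N01)
        = (\<integral>\<^sup>+z. \<integral>\<^sup>+x. F (a' * x) (B * x + e * z + c * y) \<partial>N01 \<partial>N01)" for y
      proof -
        have "(\<integral>\<^sup>+z. \<integral>\<^sup>+x. F (a' * (a / a' * x - (- u i / a') * z))
            (B * (a / a' * x - (- u i / a') * z) + e * (- u i / a' * x + a / a' * z) + c * y) \<partial>N01 \<partial>N01)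
          = (\<integral>\<^sup>+z. \<integral>\<^sup>+x. F (a' * x) (B * x + e * z + c * y) \<partial>N01 \<partial>N01)"
          by (rule N01_rotate[OF _ ab1, of "\<lambda>x z. F (a' * x) (B * x + e * z + c * y)"]) measurable
        then show ?thesis
          unfolding x1 y1 by (simp add: ac_simps)
      qed
      then have "(\<integral>\<^sup>+y. \<integral>\<^sup>+z. \<integral>\<^sup>+x. F (a * x + u i * z) (b * x + c * y + v i * z) \<partial>N01 \<partial>N01 \<partial>N01)
        = (\<integral>\<^sup>+y. \<integral>\<^sup>+z. \<integral>\<^sup>+x. F (a' * x) (B * x + e * z + c * y) \<partial>N01 \<partial>N01 \<partial>N01)"
        by simp
      also have "\<dots> = (\<integral>\<^sup>+y. \<integral>\<^sup>+x. \<integral>\<^sup>+z. F (a' * x) (B * x + e * z + c * y) \<partial>N01 \<partial>N01 \<partial>N01)"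
        by (intro nn_integral_cong N01_pair.Fubini') measurable
      also have "\<dots> = (\<integral>\<^sup>+x. \<integral>\<^sup>+y. \<integral>\<^sup>+z. F (a' * x) (B * x + e * z + c * y) \<partial>N01 \<partial>N01 \<partial>N01)"
        by (rule N01_pair.Fubini') measurable
      also have "\<dots> = (\<integral>\<^sup>+x. \<integral>\<^sup>+y. F (a' * x) (B * x + c' * y) \<partial>N01 \<partial>N01)"
      proof (rule nn_integral_cong)
        fix x
        show "(\<integral>\<^sup>+y. \<integral>\<^sup>+z. F (a' * x) (B * x + e * z + c * y) \<partial>N01 \<partial>N01)
          = (\<integral>\<^sup>+y. F (a' * x) (B * x + c' * y) \<partial>N01)"
          using N01_linear_combination[of "\<lambda>s. F (a' * x) (B * x + s)" c' e c] c'
          by (simp add: ac_simps)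
      qed
      also have "\<dots> = (\<integral>\<^sup>+y. \<integral>\<^sup>+x. F (a' * x) (B * x + c' * y) \<partial>N01 \<partial>N01)"
        by (rule N01_pair.Fubini') measurable
      finally show ?thesis .
    qed
    with step show ?thesis
      using insert(1,2) abc a' c' Be False
      by (rule_tac exI[of _ a'], rule_tac exI[of _ B], rule_tac exI[of _ c']) (simp add: B_def)
  qed
qed

section \<open>Moments and exponential moments of linear functionals\<close>

lemma gaussian_second_moment:
  assumes "finite I"
  shows "(\<integral>\<^sup>+w. ennreal ((\<Sum>i\<in>I. v i * w i)\<^sup>2) \<partial>PiM I (\<lambda>_. N01)) = ennreal (\<Sum>i\<in>I. (v i)\<^sup>2)"
proof -
  obtain a b c where abc: "a\<^sup>2 = (\<Sum>i\<in>I. (0::real)\<^sup>2)" "b\<^sup>2 + c\<^sup>2 = (\<Sum>i\<in>I. (v i)\<^sup>2)" "a = 0 \<longrightarrow> b = 0"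
    and F: "\<And>F. case_prod F \<in> borel_measurable (borel \<Otimes>\<^sub>M borel) \<Longrightarrow>
        (\<integral>\<^sup>+w. F (\<Sum>i\<in>I. 0 * w i) (\<Sum>i\<in>I. v i * w i) \<partial>PiM I (\<lambda>_. N01))
        = (\<integral>\<^sup>+y. \<integral>\<^sup>+x. (F (a * x) (b * x + c * y) :: ennreal) \<partial>N01 \<partial>N01)"
    using gaussian_pair_law[OF assms, of "\<lambda>_. 0" v] by blast
  \<comment> \<open>With the zero functional in first place \<open>a = 0\<close>, and the
    implication in the pair law forces \<open>b = 0\<close>; the second functional then has the law
    of \<open>c * y\<close>.\<close>
  have 0: "a = 0" "b = 0" using abc by auto
  have "(\<integral>\<^sup>+w. ennreal ((\<Sum>i\<in>I. v i * w i)\<^sup>2) \<partial>PiM I (\<lambda>_. N01))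
      = (\<integral>\<^sup>+y. ennreal (c\<^sup>2) * ennreal (y\<^sup>2) \<partial>N01)"
    using F[of "\<lambda>x y. ennreal (y\<^sup>2)"] by (simp add: 0 power_mult_distrib ennreal_mult)
  also have "\<dots> = ennreal (c\<^sup>2)"
    by (simp add: nn_integral_cmult N01_second_moment)
  finally show ?thesis using abc 0 by simp
qed

text \<open>Orthogonal functionals are independent. Integrating out the first adds
  \<open>t\<^sup>2 * U / 2\<close> times the square of the second to the exponent, so a pure square
  remains. In the application \<open>u\<close> is the interference and \<open>v\<close> the contrast
  of two supports; \<open>pos\<close> ensures that the integral is finite.\<close>

lemma gaussian_quadratic_mgf:
  assumes "finite I" and orth: "(\<Sum>i\<in>I. u i * v i) = 0"
    and U: "U = (\<Sum>i\<in>I. (u i)\<^sup>2)" and V: "V = (\<Sum>i\<in>I. (v i)\<^sup>2)" and pos: "0 < 1 + V * (2 * k - t\<^sup>2 * U)"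
  shows "(\<integral>\<^sup>+w. ennreal (exp (t * (\<Sum>i\<in>I. u i * w i) * (\<Sum>i\<in>I. v i * w i) - k * (\<Sum>i\<in>I. v i * w i)\<^sup>2)) \<partial>PiM I (\<lambda>_. N01))
    = ennreal (1 / sqrt (1 + V * (2 * k - t\<^sup>2 * U)))"
proof -
  obtain a b c where abc: "a\<^sup>2 = U" "a * b = 0" "b\<^sup>2 + c\<^sup>2 = V" "a = 0 \<longrightarrow> b = 0"
    and F: "\<And>F. case_prod F \<in> borel_measurable (borel \<Otimes>\<^sub>M borel) \<Longrightarrow>
        (\<integral>\<^sup>+w. F (\<Sum>i\<in>I. u i * w i) (\<Sum>i\<in>I. v i * w i) \<partial>PiM I (\<lambda>_. N01))
        = (\<integral>\<^sup>+y. \<integral>\<^sup>+x. (F (a * x) (b * x + c * y) :: ennreal) \<partial>N01 \<partial>N01)"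
    using gaussian_pair_law[OF assms(1), of u v]
    unfolding orth U[symmetric] V[symmetric] by blast
  \<comment> \<open>The equation \<open>a * b = 0\<close> alone would leave \<open>b\<close> free
    when \<open>a = 0\<close>; this is what the implication in the pair law is for.\<close>
  have b: "b = 0" and cV: "c\<^sup>2 = V" using abc by auto
  have "(\<integral>\<^sup>+w. ennreal (exp (t * (\<Sum>i\<in>I. u i * w i) * (\<Sum>i\<in>I. v i * w i) - k * (\<Sum>i\<in>I. v i * w i)\<^sup>2)) \<partial>PiM I (\<lambda>_. N01))
     = (\<integral>\<^sup>+y. \<integral>\<^sup>+x. ennreal (exp (t * (a * x) * (c * y) - k * (c * y)\<^sup>2)) \<partial>N01 \<partial>N01)"
    using F[of "\<lambda>x y. ennreal (exp (t * x * y - k * y\<^sup>2))"] by (simp add: b)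
  also have "\<dots> = (\<integral>\<^sup>+y. ennreal (exp (- k * (c * y)\<^sup>2)) * (\<integral>\<^sup>+x. ennreal (exp ((t * a * c * y) * x)) \<partial>N01) \<partial>N01)"
  proof (rule nn_integral_cong)
    fix y
    have "exp (t * (a * x) * (c * y) - k * (c * y)\<^sup>2) = exp (- k * (c * y)\<^sup>2) * exp ((t * a * c * y) * x)" for x
      by (simp add: mult_ac flip: exp_add)
    then show "(\<integral>\<^sup>+x. ennreal (exp (t * (a * x) * (c * y) - k * (c * y)\<^sup>2)) \<partial>N01)
      = ennreal (exp (- k * (c * y)\<^sup>2)) * (\<integral>\<^sup>+x. ennreal (exp ((t * a * c * y) * x)) \<partial>N01)"
      by (subst nn_integral_cmult[symmetric]) (auto simp: ennreal_mult)
  qed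
  also have "\<dots> = (\<integral>\<^sup>+y. ennreal (exp (- (V * (2 * k - t\<^sup>2 * U)) * y\<^sup>2 / 2)) \<partial>N01)"
  proof (rule nn_integral_cong)
    fix y
    have "- k * (c * y)\<^sup>2 + (t * a * c * y)\<^sup>2 / 2 = - (V * (2 * k - t\<^sup>2 * U)) * y\<^sup>2 / 2"
      unfolding power_mult_distrib abc(1) cV by (simp add: field_simps)
    then show "ennreal (exp (- k * (c * y)\<^sup>2)) * (\<integral>\<^sup>+x. ennreal (exp ((t * a * c * y) * x)) \<partial>N01)
      = ennreal (exp (- (V * (2 * k - t\<^sup>2 * U)) * y\<^sup>2 / 2))"
      unfolding N01_mgf by (simp flip: ennreal_mult exp_add)
  qed
  also have "\<dots> = ennreal (1 / sqrt (1 + V * (2 * k - t\<^sup>2 * U)))"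
    using pos by (intro N01_exp_square) simp
  finally show ?thesis .
qed

lemma measurable_component_N01:
  "i \<in> I \<Longrightarrow> (\<lambda>w. w i) \<in> borel_measurable (PiM I (\<lambda>_. N01))"
  using measurable_component_singleton[of i I "\<lambda>_. N01"]
  unfolding measurable_cong_sets[OF refl sets_N01] .

lemma gaussian_mgf:
  assumes "finite I"
  shows "(\<integral>\<^sup>+z. ennreal (exp (\<Sum>i\<in>I. s i * z i)) \<partial>PiM I (\<lambda>_. N01)) = ennreal (exp ((\<Sum>i\<in>I. (s i)\<^sup>2) / 2))"
proof -
  have "(\<integral>\<^sup>+z. ennreal (exp (\<Sum>i\<in>I. s i * z i)) \<partial>PiM I (\<lambda>_. N01))
      = (\<integral>\<^sup>+z. (\<Prod>i\<in>I. ennreal (exp (s i * z i))) \<partial>PiM I (\<lambda>_. N01))"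
    using assms by (simp add: exp_sum prod_ennreal)
  also have "\<dots> = (\<Prod>i\<in>I. ennreal (exp ((s i)\<^sup>2 / 2)))"
    using assms by (subst N01P.product_nn_integral_prod) (auto simp: N01_mgf)
  also have "\<dots> = ennreal (exp ((\<Sum>i\<in>I. (s i)\<^sup>2) / 2))"
    using assms by (simp add: prod_ennreal sum_divide_distrib exp_sum)
  finally show ?thesis .
qed

section \<open>Translation of the Gaussian measure and testing of two means\<close>

lemma gaussian_cameron_martin:
  fixes f :: "('i \<Rightarrow> real) \<Rightarrow> ennreal"
  assumes "finite I" "f \<in> borel_measurable (PiM I (\<lambda>_. borel))"
  shows "(\<integral>\<^sup>+z. f z \<partial>PiM I (\<lambda>_. N01)) =
    (\<integral>\<^sup>+z. f (\<lambda>i\<in>I. z i + s i) * ennreal (exp (- (\<Sum>i\<in>I. s i * z i) - (\<Sum>i\<in>I. (s i)\<^sup>2) / 2)) \<partial>PiM I (\<lambda>_. N01))"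
  using assms
proof (induction I arbitrary: f)
  case empty
  interpret E: prob_space "PiM {} (\<lambda>_::'i. N01)" by (rule prob_space_PiM_N01)
  show ?case
    by (intro nn_integral_cong) (simp add: space_PiM)
next
  case (insert i I)
  note [measurable] = insert.prems
  interpret PI: prob_space "PiM I (\<lambda>_. N01)" by (rule prob_space_PiM_N01)
  interpret pair: pair_sigma_finite N01 "PiM I (\<lambda>_. N01)"
    by (intro pair_sigma_finite.intro N01.sigma_finite_measure_axioms PI.sigma_finite_measure_axioms)
  define e where "e = (\<lambda>z. ennreal (exp (- (\<Sum>i\<in>I. s i * z i) - (\<Sum>i\<in>I. (s i)\<^sup>2) / 2)))"
  have [measurable]: "e \<in> borel_measurable (PiM I (\<lambda>_. borel))"
    unfolding e_def by measurable
  have upd: "(\<lambda>j\<in>insert i I. (z(i := y)) j + s j) = (\<lambda>j\<in>I. z j + s j)(i := y + s i)" for z y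
    by (auto simp: fun_eq_iff)
  have sum_upd: "(\<Sum>j\<in>insert i I. s j * (z(i := y)) j) = s i * y + (\<Sum>j\<in>I. s j * z j)" for z and y :: real
  proof -
    have "(\<Sum>j\<in>I. s j * (z(i := y)) j) = (\<Sum>j\<in>I. s j * z j)"
      using insert.hyps by (intro sum.cong) auto
    then show ?thesis using insert.hyps by simp
  qed
  have "(\<integral>\<^sup>+z. f z \<partial>PiM (insert i I) (\<lambda>_. N01)) = (\<integral>\<^sup>+y. \<integral>\<^sup>+z. f (z(i := y)) \<partial>PiM I (\<lambda>_. N01) \<partial>N01)"
    using insert.hyps by (intro N01P.product_nn_integral_insert_rev) measurable
  also have "\<dots> = (\<integral>\<^sup>+y. \<integral>\<^sup>+z. f ((\<lambda>j\<in>I. z j + s j)(i := y)) * e z \<partial>PiM I (\<lambda>_. N01) \<partial>N01)"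
  proof (rule nn_integral_cong)
    fix y
    show "(\<integral>\<^sup>+z. f (z(i := y)) \<partial>PiM I (\<lambda>_. N01)) = (\<integral>\<^sup>+z. f ((\<lambda>j\<in>I. z j + s j)(i := y)) * e z \<partial>PiM I (\<lambda>_. N01))"
      unfolding e_def by (rule insert.IH[of "\<lambda>z. f (z(i := y))"]) measurable
  qed
  \<comment> \<open>The induction hypothesis has translated the coordinates in \<open>I\<close> with
    the last one frozen; exchanging the integrals makes the last one the inner variable for
    \<open>N01_shift\<close>.\<close>
  also have "\<dots> = (\<integral>\<^sup>+z. \<integral>\<^sup>+y. f ((\<lambda>j\<in>I. z j + s j)(i := y)) * e z \<partial>N01 \<partial>PiM I (\<lambda>_. N01))"
    by (rule pair.Fubini'[symmetric]) measurable
  also have "\<dots> = (\<integral>\<^sup>+z. \<integral>\<^sup>+y. f ((\<lambda>j\<in>I. z j + s j)(i := y + s i)) * e z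
      * ennreal (exp (- s i * y - (s i)\<^sup>2 / 2)) \<partial>N01 \<partial>PiM I (\<lambda>_. N01))"
  proof (rule nn_integral_cong)
    fix z assume [measurable]: "z \<in> space (PiM I (\<lambda>_. N01))"
    have [measurable]: "(\<lambda>j\<in>I. z j + s j) \<in> space (PiM I (\<lambda>_. borel))"
      by (simp add: space_PiM)
    have [measurable]: "(\<lambda>y. (\<lambda>j\<in>I. z j + s j)(i := y)) \<in> borel \<rightarrow>\<^sub>M PiM (insert i I) (\<lambda>_. borel)"
      using insert.hyps by (intro measurable_component_update) measurable
    show "(\<integral>\<^sup>+y. f ((\<lambda>j\<in>I. z j + s j)(i := y)) * e z \<partial>N01)
      = (\<integral>\<^sup>+y. f ((\<lambda>j\<in>I. z j + s j)(i := y + s i)) * e z * ennreal (exp (- s i * y - (s i)\<^sup>2 / 2)) \<partial>N01)"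
      by (rule N01_shift[of "\<lambda>y. f ((\<lambda>j\<in>I. z j + s j)(i := y)) * e z"]) measurable
  qed
  also have "\<dots> = (\<integral>\<^sup>+z. \<integral>\<^sup>+y. f (\<lambda>j\<in>insert i I. (z(i := y)) j + s j) *
       ennreal (exp (- (\<Sum>j\<in>insert i I. s j * (z(i := y)) j) - (\<Sum>j\<in>insert i I. (s j)\<^sup>2) / 2)) \<partial>N01 \<partial>PiM I (\<lambda>_. N01))"
  proof (intro nn_integral_cong)
    fix z y
    have "exp (- (\<Sum>j\<in>insert i I. s j * (z(i := y)) j) - (\<Sum>j\<in>insert i I. (s j)\<^sup>2) / 2)
      = exp (- (\<Sum>i\<in>I. s i * z i) - (\<Sum>i\<in>I. (s i)\<^sup>2) / 2) * exp (- s i * y - (s i)\<^sup>2 / 2)"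
      unfolding sum_upd using insert.hyps by (simp add: add_divide_distrib flip: exp_add)
    then show "f ((\<lambda>j\<in>I. z j + s j)(i := y + s i)) * e z * ennreal (exp (- s i * y - (s i)\<^sup>2 / 2))
      = f (\<lambda>j\<in>insert i I. (z(i := y)) j + s j) *
       ennreal (exp (- (\<Sum>j\<in>insert i I. s j * (z(i := y)) j) - (\<Sum>j\<in>insert i I. (s j)\<^sup>2) / 2))"
      unfolding upd e_def by (simp add: ennreal_mult mult.assoc)
  qed
  also have "\<dots> = (\<integral>\<^sup>+z. f (\<lambda>j\<in>insert i I. z j + s j) *
       ennreal (exp (- (\<Sum>j\<in>insert i I. s j * z j) - (\<Sum>j\<in>insert i I. (s j)\<^sup>2) / 2)) \<partial>PiM (insert i I) (\<lambda>_. N01))"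
    using insert.hyps
    by (intro N01P.product_nn_integral_insert[symmetric]) measurable
  finally show ?case .
qed

text \<open>Chebyshev's inequality: the functional has variance \<open>D\<close>, so it exceeds two
  standard deviations with probability at most 1/4. The case \<open>D = 0\<close> is separate
  because of the division by \<open>D\<close>.\<close>

lemma gaussian_functional_bounded:
  assumes "finite I" and D: "D = (\<Sum>i\<in>I. (d i)\<^sup>2)"
  shows "ennreal (3/4) \<le> (\<integral>\<^sup>+z. (if \<bar>\<Sum>i\<in>I. d i * z i\<bar> \<le> 2 * sqrt D then 1 else 0) \<partial>PiM I (\<lambda>_. N01))"
    (is "_ \<le> ?P")
proof -
  interpret P: prob_space "PiM I (\<lambda>_. N01)" by (rule prob_space_PiM_N01)
  have D0: "0 \<le> D" by (simp add: D sum_nonneg)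
  show ?thesis
  proof (cases "D = 0")
    case True
    then have "\<And>i. i \<in> I \<Longrightarrow> d i = 0"
      using assms by (simp add: sum_nonneg_eq_0_iff)
    then have "?P = 1" by (simp add: P.emeasure_space_1 True)
    then show ?thesis by simp
  next
    case False
    with D0 have D_pos: "0 < D" by simp
    have "1 = (\<integral>\<^sup>+z. 1 \<partial>PiM I (\<lambda>_. N01))"
      by (simp add: P.emeasure_space_1)
    also have "\<dots> \<le> (\<integral>\<^sup>+z. (if \<bar>\<Sum>i\<in>I. d i * z i\<bar> \<le> 2 * sqrt D then 1 else 0) +
        ennreal (1 / (4 * D)) * ennreal ((\<Sum>i\<in>I. d i * z i)\<^sup>2) \<partial>PiM I (\<lambda>_. N01))"
    proof (rule nn_integral_mono)
      fix z
      show "1 \<le> (if \<bar>\<Sum>i\<in>I. d i * z i\<bar> \<le> 2 * sqrt D then 1 else 0) +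
        ennreal (1 / (4 * D)) * ennreal ((\<Sum>i\<in>I. d i * z i)\<^sup>2)"
      proof (cases "\<bar>\<Sum>i\<in>I. d i * z i\<bar> \<le> 2 * sqrt D")
        case False
        then have "(2 * sqrt D)\<^sup>2 \<le> \<bar>\<Sum>i\<in>I. d i * z i\<bar>\<^sup>2"
          using D_pos by (intro power_mono) auto
        then have "1 \<le> 1 / (4 * D) * (\<Sum>i\<in>I. d i * z i)\<^sup>2"
          using D_pos by (simp add: power_mult_distrib field_simps)
        then show ?thesis using False D_pos by (simp flip: ennreal_mult)
      qed simp
    qed
    also have "\<dots> = ?P + ennreal (1 / (4 * D)) * ennreal D"
      using gaussian_second_moment[OF assms(1), of d]
      by (subst nn_integral_add) (auto simp: nn_integral_cmult D)
    also have "ennreal (1 / (4 * D)) * ennreal D = ennreal (1/4)"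
      using D_pos by (simp flip: ennreal_mult)
    finally have "1 \<le> ?P + ennreal (1/4)" .
    moreover have "?P \<noteq> \<top>"
    proof -
      have "?P \<le> (\<integral>\<^sup>+z. 1 \<partial>PiM I (\<lambda>_. N01))" by (intro nn_integral_mono) auto
      then show ?thesis by (auto simp: P.emeasure_space_1 top_unique)
    qed
    ultimately show ?thesis
      by (cases ?P) (auto simp flip: ennreal_plus ennreal_1 simp del: ennreal_1)
  qed
qed

text \<open>Both error integrals are rewritten relative to the Gaussian centred at
  \<open>\<mu> + t (\<mu>' - \<mu>)\<close>; there exactly one of the two error events occurs at each point.\<close>

lemma two_point_testing:
  fixes \<mu> \<mu>' :: "'i \<Rightarrow> real"
  assumes fin: "finite I" and [measurable]: "Measurable.pred (PiM I (\<lambda>_. borel)) g"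
    and D: "D = (\<Sum>i\<in>I. (\<mu>' i - \<mu> i)\<^sup>2)" and t: "0 \<le> t" "t \<le> 1" and a: "0 \<le> a" "0 \<le> a'"
    and m: "0 \<le> m" "m \<le> a * exp (- 2 * sqrt D - t\<^sup>2 * D / 2)" "m \<le> a' * exp (- 2 * sqrt D - (1 - t)\<^sup>2 * D / 2)"
  shows "ennreal (3/4 * m) \<le>
     ennreal a * (\<integral>\<^sup>+z. (if g (\<lambda>i\<in>I. \<mu> i + z i) then 1 else 0) \<partial>PiM I (\<lambda>_. N01))
   + ennreal a' * (\<integral>\<^sup>+z. (if g (\<lambda>i\<in>I. \<mu>' i + z i) then 0 else 1) \<partial>PiM I (\<lambda>_. N01))"
proof -
  define d where "d = (\<lambda>i. \<mu>' i - \<mu> i)"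
  define c where "c = (\<lambda>i. \<mu> i + t * d i)"
  define q where "q = (\<lambda>z. \<Sum>i\<in>I. d i * z i)"
  have [measurable]: "q \<in> borel_measurable (PiM I (\<lambda>_. borel))"
    unfolding q_def by measurable
  have D': "D = (\<Sum>i\<in>I. (d i)\<^sup>2)" by (simp add: D d_def)
  have D0: "0 \<le> D" by (simp add: D sum_nonneg)
  have e1: "- (\<Sum>i\<in>I. t * d i * z i) - (\<Sum>i\<in>I. (t * d i)\<^sup>2) / 2 = - t * q z - t\<^sup>2 * D / 2" for z
    by (simp add: q_def D' sum_distrib_left power_mult_distrib mult.assoc sum_negf)
  have e2: "- (\<Sum>i\<in>I. - (1 - t) * d i * z i) - (\<Sum>i\<in>I. (- (1 - t) * d i)\<^sup>2) / 2
     = (1 - t) * q z - (1 - t)\<^sup>2 * D / 2" for z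
    unfolding q_def D' power_mult_distrib power2_minus sum_distrib_left[symmetric] mult.assoc
    by (simp flip: sum_distrib_left add: algebra_simps)
  have c1: "(\<lambda>i\<in>I. \<mu> i + (\<lambda>i\<in>I. z i + t * d i) i) = (\<lambda>i\<in>I. c i + z i)" for z
    by (auto simp: fun_eq_iff c_def)
  have c2: "(\<lambda>i\<in>I. \<mu>' i + (\<lambda>i\<in>I. z i + - (1 - t) * d i) i) = (\<lambda>i\<in>I. c i + z i)" for z
    by (auto simp: fun_eq_iff c_def d_def algebra_simps)
  have i1: "(\<integral>\<^sup>+z. (if g (\<lambda>i\<in>I. \<mu> i + z i) then 1 else 0) \<partial>PiM I (\<lambda>_. N01))
    = (\<integral>\<^sup>+z. (if g (\<lambda>i\<in>I. c i + z i) then 1 else 0) * ennreal (exp (- t * q z - t\<^sup>2 * D / 2)) \<partial>PiM I (\<lambda>_. N01))"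
    by (subst gaussian_cameron_martin[OF fin, where s = "\<lambda>i. t * d i"], measurable) (simp only: e1 c1)
  have i2: "(\<integral>\<^sup>+z. (if g (\<lambda>i\<in>I. \<mu>' i + z i) then 0 else 1) \<partial>PiM I (\<lambda>_. N01))
    = (\<integral>\<^sup>+z. (if g (\<lambda>i\<in>I. c i + z i) then 0 else 1) * ennreal (exp ((1 - t) * q z - (1 - t)\<^sup>2 * D / 2)) \<partial>PiM I (\<lambda>_. N01))"
    by (subst gaussian_cameron_martin[OF fin, where s = "\<lambda>i. - (1 - t) * d i"], measurable) (simp only: e2 c2)
  have "ennreal (3/4 * m) = ennreal m * ennreal (3/4)"
    using m by (simp add: mult.commute flip: ennreal_mult)
  \<comment> \<open>Only an event of probability at least 3/4 is kept. On it both weighted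
    exponentials are at least \<open>m\<close>, so whichever error event occurs contributes at least
    \<open>m\<close>.\<close>
  also have "\<dots> \<le> ennreal m * (\<integral>\<^sup>+z. (if \<bar>q z\<bar> \<le> 2 * sqrt D then 1 else 0) \<partial>PiM I (\<lambda>_. N01))"
    unfolding q_def by (intro mult_left_mono gaussian_functional_bounded fin D') simp
  also have "\<dots> = (\<integral>\<^sup>+z. ennreal m * (if \<bar>q z\<bar> \<le> 2 * sqrt D then 1 else 0) \<partial>PiM I (\<lambda>_. N01))"
    by (rule nn_integral_cmult[symmetric]) measurable
  also have "\<dots> \<le> (\<integral>\<^sup>+z. ennreal a * ((if g (\<lambda>i\<in>I. c i + z i) then 1 else 0) * ennreal (exp (- t * q z - t\<^sup>2 * D / 2)))
      + ennreal a' * ((if g (\<lambda>i\<in>I. c i + z i) then 0 else 1) * ennreal (exp ((1 - t) * q z - (1 - t)\<^sup>2 * D / 2))) \<partial>PiM I (\<lambda>_. N01))"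
  proof (rule nn_integral_mono)
    fix z
    have "m \<le> a * exp (- t * q z - t\<^sup>2 * D / 2)" "m \<le> a' * exp ((1 - t) * q z - (1 - t)\<^sup>2 * D / 2)"
      if q: "\<bar>q z\<bar> \<le> 2 * sqrt D"
    proof -
      have b: "\<bar>s * q z\<bar> \<le> 2 * sqrt D" if "0 \<le> s" "s \<le> 1" for s
        using mult_mono[OF that(2) q] that q by (simp add: abs_mult)
      have "a * exp (- 2 * sqrt D - t\<^sup>2 * D / 2) \<le> a * exp (- t * q z - t\<^sup>2 * D / 2)"
        using b[of t] t a by (intro mult_left_mono) auto
      with m show "m \<le> a * exp (- t * q z - t\<^sup>2 * D / 2)" by linarith
      have "a' * exp (- 2 * sqrt D - (1 - t)\<^sup>2 * D / 2) \<le> a' * exp ((1 - t) * q z - (1 - t)\<^sup>2 * D / 2)"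
        using b[of "1 - t"] t a by (intro mult_left_mono) auto
      with m show "m \<le> a' * exp ((1 - t) * q z - (1 - t)\<^sup>2 * D / 2)" by linarith
    qed
    then show "ennreal m * (if \<bar>q z\<bar> \<le> 2 * sqrt D then 1 else 0) \<le>
      ennreal a * ((if g (\<lambda>i\<in>I. c i + z i) then 1 else 0) * ennreal (exp (- t * q z - t\<^sup>2 * D / 2)))
      + ennreal a' * ((if g (\<lambda>i\<in>I. c i + z i) then 0 else 1) * ennreal (exp ((1 - t) * q z - (1 - t)\<^sup>2 * D / 2)))"
      using a by (auto simp: ennreal_mult[symmetric] intro!: ennreal_leI)
  qed
  also have "\<dots> = ennreal a * (\<integral>\<^sup>+z. (if g (\<lambda>i\<in>I. \<mu> i + z i) then 1 else 0) \<partial>PiM I (\<lambda>_. N01))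
     + ennreal a' * (\<integral>\<^sup>+z. (if g (\<lambda>i\<in>I. \<mu>' i + z i) then 0 else 1) \<partial>PiM I (\<lambda>_. N01))"
    unfolding i1 i2 by (subst nn_integral_add, measurable) (simp add: nn_integral_cmult)
  finally show ?thesis .
qed

text \<open>The rows are independent with a common law, so the integral is a power of the one for a
  single row; the induction splits off the last row.\<close>

lemma gaussian_rows_mgf:
  fixes u v :: "nat \<Rightarrow> real"
  assumes orth: "(\<Sum>m<p. u m * v m) = 0"
    and U: "U = (\<Sum>m<p. (u m)\<^sup>2)" and V: "V = (\<Sum>m<p. (v m)\<^sup>2)" and pos: "0 < 1 + V * (2 * k - t\<^sup>2 * U)"
  shows "(\<integral>\<^sup>+w. ennreal (exp (\<Sum>i<n. t * (\<Sum>m<p. u m * w (i, m)) * (\<Sum>m<p. v m * w (i, m))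
        - k * (\<Sum>m<p. v m * w (i, m))\<^sup>2)) \<partial>PiM ({..<n} \<times> {..<p}) (\<lambda>_. N01))
    = ennreal ((1 / sqrt (1 + V * (2 * k - t\<^sup>2 * U))) ^ n)"
proof (induction n)
  case 0
  interpret P: prob_space "PiM ({..<0::nat} \<times> {..<p}) (\<lambda>_. N01)" by (rule prob_space_PiM_N01)
  show ?case using P.emeasure_space_1 by simp
next
  case (Suc n)
  let ?I = "{..<n} \<times> {..<p}" and ?J = "{n} \<times> {..<p}"
  let ?r = "\<lambda>i w. t * (\<Sum>m<p. u m * w (i, m)) * (\<Sum>m<p. v m * w (i, m)) - k * (\<Sum>m<p. v m * w (i, m))\<^sup>2"
  have IJ: "{..<Suc n} \<times> {..<p} = ?I \<union> ?J" by auto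
  have J: "?J = Pair n ` {..<p}" by auto
  have row: "(\<Sum>q\<in>?J. x (snd q) * w q) = (\<Sum>m<p. x m * w (n, m))" for x :: "nat \<Rightarrow> real" and w
    by (simp add: J sum.reindex inj_on_def)
  have row2: "(\<Sum>q\<in>?J. f (snd q)) = (\<Sum>m<p. f m)" for f :: "nat \<Rightarrow> real"
    by (simp add: J sum.reindex inj_on_def)
  have merge: "merge ?I ?J (x, y) (i, m) = (if i = n then y (i, m) else x (i, m))"
    if "i \<le> n" "m < p" for x y i m
    using that by (auto simp: merge_def)
  have "(\<integral>\<^sup>+w. ennreal (exp (\<Sum>i<Suc n. ?r i w)) \<partial>PiM ({..<Suc n} \<times> {..<p}) (\<lambda>_. N01))
     = (\<integral>\<^sup>+x. \<integral>\<^sup>+y. ennreal (exp (\<Sum>i<Suc n. ?r i (merge ?I ?J (x, y)))) \<partial>PiM ?J (\<lambda>_. N01) \<partial>PiM ?I (\<lambda>_. N01))"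
    unfolding IJ
  proof (rule N01P.product_nn_integral_fold)
    have [measurable]: "(\<lambda>w. w (i, m)) \<in> borel_measurable (PiM (?I \<union> ?J) (\<lambda>_. N01))" if "i < Suc n" "m < p" for i m
    proof -
      have "(i, m) \<in> ?I \<union> ?J" using that by auto
      then show ?thesis by (rule measurable_component_N01)
    qed
    show "(\<lambda>w. ennreal (exp (\<Sum>i<Suc n. ?r i w))) \<in> borel_measurable (PiM (?I \<union> ?J) (\<lambda>_. N01))"
      by (intro measurable_compose[OF _ measurable_ennreal] borel_measurable_exp borel_measurable_sum
          borel_measurable_diff borel_measurable_times borel_measurable_power borel_measurable_const measurable_compose[OF _ borel_measurable_exp]) auto
  qed auto
  also have "\<dots> = (\<integral>\<^sup>+x. \<integral>\<^sup>+y. ennreal (exp (\<Sum>i<n. ?r i x)) * ennreal (exp (?r n y)) \<partial>PiM ?J (\<lambda>_. N01) \<partial>PiM ?I (\<lambda>_. N01))"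
  proof (intro nn_integral_cong)
    fix x y
    have "?r i (merge ?I ?J (x, y)) = ?r i x" if "i < n" for i
      using that by (simp add: merge)
    moreover have "?r n (merge ?I ?J (x, y)) = ?r n y"
      by (simp add: merge)
    ultimately show "ennreal (exp (\<Sum>i<Suc n. ?r i (merge ?I ?J (x, y))))
      = ennreal (exp (\<Sum>i<n. ?r i x)) * ennreal (exp (?r n y))"
      by (simp add: exp_add ennreal_mult)
  qed
  also have "\<dots> = (\<integral>\<^sup>+x. ennreal (exp (\<Sum>i<n. ?r i x)) * ennreal (1 / sqrt (1 + V * (2 * k - t\<^sup>2 * U))) \<partial>PiM ?I (\<lambda>_. N01))"
  proof (rule nn_integral_cong)
    fix x
    have [measurable]: "(\<lambda>y. ennreal (exp (?r n y))) \<in> borel_measurable (PiM ?J (\<lambda>_. N01))"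
      unfolding row[symmetric] by measurable
    have "(\<integral>\<^sup>+y. ennreal (exp (?r n y)) \<partial>PiM ?J (\<lambda>_. N01)) = ennreal (1 / sqrt (1 + V * (2 * k - t\<^sup>2 * U)))"
      unfolding row[symmetric]
      by (rule gaussian_quadratic_mgf) (use orth U V pos row2[of "\<lambda>m. u m * v m"] row2[of "\<lambda>m. (u m)\<^sup>2"] row2[of "\<lambda>m. (v m)\<^sup>2"] in auto)
    then show "(\<integral>\<^sup>+y. ennreal (exp (\<Sum>i<n. ?r i x)) * ennreal (exp (?r n y)) \<partial>PiM ?J (\<lambda>_. N01))
      = ennreal (exp (\<Sum>i<n. ?r i x)) * ennreal (1 / sqrt (1 + V * (2 * k - t\<^sup>2 * U)))"
      by (subst nn_integral_cmult) auto
  qed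
  also have "\<dots> = (\<integral>\<^sup>+x. ennreal (exp (\<Sum>i<n. ?r i x)) \<partial>PiM ?I (\<lambda>_. N01)) * ennreal (1 / sqrt (1 + V * (2 * k - t\<^sup>2 * U)))"
    by (rule nn_integral_multc) measurable
  finally show ?case
    unfolding Suc using pos by (simp add: mult.commute flip: ennreal_mult)
qed

section \<open>The prior and the Hamming risk\<close>

lemma powr_minus_in_unit:
  assumes "0 \<le> \<theta>"
  shows "0 \<le> real p powr (- \<theta>)" "real p powr (- \<theta>) \<le> 1"
proof -
  have "real p powr (- \<theta>) \<le> 1" if "p \<noteq> 0"
    using that assms by (simp add: powr_minus field_simps ge_one_powr_ge_zero)
  \<comment> \<open>For \<open>p = 0\<close> the convention \<open>0 powr x = 0\<close> gives the
    bound.\<close>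
  then show "real p powr (- \<theta>) \<le> 1" by (cases "p = 0") auto
qed simp

lemma sets_beta_prior [simp, measurable_cong]: "sets (beta_prior \<theta> r p) = sets borel"
  by (simp add: beta_prior_def)

lemma prob_space_beta_prior: "prob_space (beta_prior \<theta> r p)"
  unfolding beta_prior_def by (intro prob_space.prob_space_distr) (auto simp: measure_pmf.prob_space_axioms)

interpretation beta: prob_space "beta_prior \<theta> r p" for \<theta> r p
  by (rule prob_space_beta_prior)

interpretation betaP: product_sigma_finite "\<lambda>i. beta_prior \<theta> r p" for \<theta> r p
  by (intro product_sigma_finite.intro beta.sigma_finite_measure_axioms)

lemma prob_space_PiM_beta: "prob_space (PiM I (\<lambda>_. beta_prior \<theta> r p))"
  by (intro prob_space_PiM prob_space_beta_prior)

lemma nn_integral_beta_prior: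
  assumes "f \<in> borel_measurable borel" "0 \<le> \<theta>"
  shows "(\<integral>\<^sup>+x. f x \<partial>beta_prior \<theta> r p)
    = ennreal (real p powr (- \<theta>)) * f (tau r p) + ennreal (1 - real p powr (- \<theta>)) * f 0"
  unfolding beta_prior_def using assms powr_minus_in_unit[of \<theta> p]
  by (subst nn_integral_distr) (auto simp: mult.commute)

lemma AE_beta_prior: "AE b in PiM {..<p} (\<lambda>_. beta_prior \<theta> r p). \<forall>k<p. b k = 0 \<or> b k = tau r p"
proof -
  interpret P: product_prob_space "\<lambda>_. beta_prior \<theta> r p" "{..<p}"
    by (intro product_prob_spaceI prob_space_beta_prior)
  have "AE x in beta_prior \<theta> r p. x = 0 \<or> x = tau r p"
    unfolding beta_prior_def by (subst AE_distr_iff) auto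
  then have "AE b in PiM {..<p} (\<lambda>_. beta_prior \<theta> r p). b k = 0 \<or> b k = tau r p" if "k < p" for k
    using that by (intro AE_PiM_component prob_space_beta_prior) auto
  then have "AE b in PiM {..<p} (\<lambda>_. beta_prior \<theta> r p). \<forall>k\<in>{..<p}. b k = 0 \<or> b k = tau r p"
    by (intro AE_finite_allI) auto
  then show ?thesis by (simp only: Ball_def lessThan_iff)
qed

text \<open>Only the noise is averaged, at fixed design and coefficients. One quantity thus serves
  both models, with the realised random design already inserted into \<open>f\<close>, and the order
  of the remaining integrations stays open.\<close>

definition err_prob :: "nat \<Rightarrow> nat \<Rightarrow> (nat \<times> nat \<Rightarrow> real) \<Rightarrow> ((nat \<Rightarrow> real) \<Rightarrow> nat \<Rightarrow> real)
    \<Rightarrow> nat \<Rightarrow> (nat \<Rightarrow> real) \<Rightarrow> ennreal" where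
  "err_prob n p X f j b =
     (\<integral>\<^sup>+z. (if (f (response n p X b z) j \<noteq> 0) \<noteq> (b j \<noteq> 0) then 1 else 0) \<partial>PiM {..<n} (\<lambda>_. N01))"

lemma err_prob_le_1: "err_prob n p X f j b \<le> 1"
proof -
  interpret P: prob_space "PiM {..<n} (\<lambda>_. N01)" by (rule prob_space_PiM_N01)
  have "err_prob n p X f j b \<le> (\<integral>\<^sup>+z. 1 \<partial>PiM {..<n} (\<lambda>_. N01))"
    unfolding err_prob_def by (intro nn_integral_mono) auto
  then show ?thesis by (simp add: P.emeasure_space_1)
qed

lemma measurable_design [measurable]:
  "design L n p \<in> PiM ({..<n} \<times> {..<p}) (\<lambda>_. borel) \<rightarrow>\<^sub>M mat_space n p"
  unfolding design_def mat_space_def case_prod_beta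
  by (intro measurable_restrict borel_measurable_times borel_measurable_const borel_measurable_sum
      measurable_component_singleton) auto

lemma measurable_response [measurable (raw)]:
  assumes X: "X \<in> M \<rightarrow>\<^sub>M mat_space n p" and b: "b \<in> M \<rightarrow>\<^sub>M PiM {..<p} (\<lambda>_. borel)"
    and z: "z \<in> M \<rightarrow>\<^sub>M PiM {..<n} (\<lambda>_. borel)"
  shows "(\<lambda>x. response n p (X x) (b x) (z x)) \<in> M \<rightarrow>\<^sub>M vec_space n"
proof -
  have [measurable]: "(\<lambda>x. X x (i, k)) \<in> borel_measurable M" if "i < n" "k < p" for i k
    using that by (intro measurable_compose[OF X[unfolded mat_space_def] measurable_component_singleton]) auto
  have [measurable]: "(\<lambda>x. b x k) \<in> borel_measurable M" if "k < p" for k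
    using that by (intro measurable_compose[OF b measurable_component_singleton]) auto
  have [measurable]: "(\<lambda>x. z x i) \<in> borel_measurable M" if "i < n" for i
    using that by (intro measurable_compose[OF z measurable_component_singleton]) auto
  show ?thesis
    unfolding response_def vec_space_def
    by (intro measurable_restrict borel_measurable_add borel_measurable_sum borel_measurable_times) auto
qed

text \<open>A deterministic design is an arbitrary function on pairs, whereas points of
  \<open>mat_space\<close> are extensional. Truncation bridges the gap, so that
  \<open>measurable_response\<close> applies to a fixed design as well.\<close>

lemma response_restrict:
  "response n p (restrict X ({..<n} \<times> {..<p})) b z = response n p X b z"
  unfolding response_def by (intro ext) (auto simp: restrict_def intro!: sum.cong)

lemma measurable_response_fixed:
  assumes "b \<in> M \<rightarrow>\<^sub>M PiM {..<p} (\<lambda>_. borel)" "z \<in> M \<rightarrow>\<^sub>M PiM {..<n} (\<lambda>_. borel)"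
  shows "(\<lambda>x. response n p X (b x) (z x)) \<in> M \<rightarrow>\<^sub>M vec_space n"
proof -
  have "restrict X ({..<n} \<times> {..<p}) \<in> space (mat_space n p)"
    by (simp add: mat_space_def space_PiM)
  then have "(\<lambda>x. response n p (restrict X ({..<n} \<times> {..<p})) (b x) (z x)) \<in> M \<rightarrow>\<^sub>M vec_space n"
    using assms by (intro measurable_response measurable_const)
  then show ?thesis by (simp add: response_restrict)
qed

lemma pred_nonzero:
  fixes f :: "'a \<Rightarrow> real"
  assumes "f \<in> borel_measurable M"
  shows "Measurable.pred M (\<lambda>x. f x \<noteq> 0)"
proof -
  have "f -` (- {0}) \<inter> space M \<in> sets M"
    using assms by (rule measurable_sets) (intro borel_comp borel_singleton sets.empty_sets)
  then show ?thesis
    by (simp add: pred_def vimage_def Int_def conj_commute)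
qed

lemma pred_component_nonzero:
  fixes f :: "'a \<Rightarrow> 'i \<Rightarrow> real"
  assumes "f \<in> M \<rightarrow>\<^sub>M PiM I (\<lambda>_. borel)" "j \<in> I"
  shows "Measurable.pred M (\<lambda>x. f x j \<noteq> 0)"
  using assms by (intro pred_nonzero measurable_compose[OF assms(1) measurable_component_singleton])

lemma borel_measurable_if_pred:
  "Measurable.pred M P \<Longrightarrow> (\<lambda>x. if P x then 1 else 0 :: ennreal) \<in> borel_measurable M"
  by (rule measurable_If) (auto simp: pred_def)

lemma hamming_eq: "hamming p b' b = (\<Sum>j<p. if (b' j \<noteq> 0) \<noteq> (b j \<noteq> 0) then 1 else 0)"
  unfolding hamming_def by (intro sum.cong) auto

lemma hamming_nonneg: "0 \<le> hamming p b' b"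
  unfolding hamming_eq by (intro sum_nonneg) auto

lemma hamming_le: "hamming p b' b \<le> real p"
  using sum_mono[of "{..<p}" "\<lambda>j. if (b' j \<noteq> 0) \<noteq> (b j \<noteq> 0) then 1 else 0" "\<lambda>_. 1::real"]
  unfolding hamming_eq by simp

lemma ennreal_hamming:
  "ennreal (hamming p b' b) = (\<Sum>j<p. if (b' j \<noteq> 0) \<noteq> (b j \<noteq> 0) then 1 else 0)"
proof -
  have "(\<Sum>j<p. ennreal (if (b' j \<noteq> 0) \<noteq> (b j \<noteq> 0) then 1 else 0)) = ennreal (hamming p b' b)"
    unfolding hamming_eq by (rule sum_ennreal) auto
  then show ?thesis by (simp add: if_distrib[of ennreal] cong: if_cong)
qed

text \<open>The loss lies between 0 and \<open>p\<close>, hence is integrable under a probability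
  measure, and the Bochner risk becomes a nonnegative integral that splits over the
  coordinates.\<close>

lemma det_risk_eq:
  fixes X :: "nat \<times> nat \<Rightarrow> real"
  assumes f[measurable]: "f \<in> vec_space n \<rightarrow>\<^sub>M vec_space p"
  shows "ennreal (integral\<^sup>L (det_model \<theta> r n p) (\<lambda>(b, z). hamming p (f (response n p X b z)) b))
    = (\<Sum>j<p. \<integral>\<^sup>+b. err_prob n p X f j b \<partial>PiM {..<p} (\<lambda>_. beta_prior \<theta> r p))"
proof -
  let ?B = "PiM {..<p} (\<lambda>_. beta_prior \<theta> r p)" and ?Z = "PiM {..<n} (\<lambda>_. N01)"
  interpret B: prob_space ?B by (rule prob_space_PiM_beta)
  interpret Z: prob_space ?Z by (rule prob_space_PiM_N01)
  interpret BZ: pair_prob_space ?B ?Z ..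
  have e[measurable]: "Measurable.pred (?B \<Otimes>\<^sub>M ?Z) (\<lambda>x. (f (response n p X (fst x) (snd x)) j \<noteq> 0) \<noteq> (fst x j \<noteq> 0))"
    if "j < p" for j
  proof -
    have "(\<lambda>x. response n p X (fst x) (snd x)) \<in> ?B \<Otimes>\<^sub>M ?Z \<rightarrow>\<^sub>M vec_space n"
      by (intro measurable_response_fixed) measurable
    from measurable_compose[OF this f]
    have 1: "Measurable.pred (?B \<Otimes>\<^sub>M ?Z) (\<lambda>x. f (response n p X (fst x) (snd x)) j \<noteq> 0)"
      using that by (intro pred_component_nonzero[where I = "{..<p}"], fold vec_space_def) auto
    have 2: "Measurable.pred (?B \<Otimes>\<^sub>M ?Z) (\<lambda>x. fst x j \<noteq> 0)"
      using that by (intro pred_nonzero) measurable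
    from 1 2 show ?thesis by measurable
  qed
  have meas: "(\<lambda>x. hamming p (f (response n p X (fst x) (snd x))) (fst x)) \<in> borel_measurable (?B \<Otimes>\<^sub>M ?Z)"
    unfolding hamming_eq by measurable
  have "ennreal (integral\<^sup>L (det_model \<theta> r n p) (\<lambda>(b, z). hamming p (f (response n p X b z)) b))
     = (\<integral>\<^sup>+x. ennreal (hamming p (f (response n p X (fst x) (snd x))) (fst x)) \<partial>(?B \<Otimes>\<^sub>M ?Z))"
    unfolding det_model_def case_prod_beta
    by (intro nn_integral_eq_integral[symmetric] BZ.integrable_const_bound[where B = "real p"] meas)
      (auto simp: hamming_nonneg hamming_le)
  also have "\<dots> = (\<integral>\<^sup>+x. (\<Sum>j<p. if (f (response n p X (fst x) (snd x)) j \<noteq> 0) \<noteq> (fst x j \<noteq> 0) then 1 else 0) \<partial>(?B \<Otimes>\<^sub>M ?Z))"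
    unfolding ennreal_hamming ..
  also have "\<dots> = (\<Sum>j<p. \<integral>\<^sup>+x. (if (f (response n p X (fst x) (snd x)) j \<noteq> 0) \<noteq> (fst x j \<noteq> 0) then 1 else 0) \<partial>(?B \<Otimes>\<^sub>M ?Z))"
    by (intro nn_integral_sum) measurable
  also have "\<dots> = (\<Sum>j<p. \<integral>\<^sup>+b. err_prob n p X f j b \<partial>?B)"
    unfolding err_prob_def
  proof (intro sum.cong refl)
    fix j assume "j \<in> {..<p}"
    then have m: "Measurable.pred (?B \<Otimes>\<^sub>M ?Z) (\<lambda>x. (f (response n p X (fst x) (snd x)) j \<noteq> 0) \<noteq> (fst x j \<noteq> 0))"
      by (intro e) simp
    show "(\<integral>\<^sup>+x. (if (f (response n p X (fst x) (snd x)) j \<noteq> 0) \<noteq> (fst x j \<noteq> 0) then 1 else 0) \<partial>(?B \<Otimes>\<^sub>M ?Z))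
      = (\<integral>\<^sup>+b. \<integral>\<^sup>+z. (if (f (response n p X b z) j \<noteq> 0) \<noteq> (b j \<noteq> 0) then 1 else 0) \<partial>?Z \<partial>?B)"
      unfolding Z.nn_integral_fst[OF borel_measurable_if_pred[OF m], symmetric] by simp
  qed
  finally show ?thesis .
qed

text \<open>Integrating over \<open>W\<close> last suits the lower bound, which fixes the design.
  The upper bound fixes the coefficients instead, and the second conclusion supplies the
  measurability for that exchange.\<close>

lemma rand_risk_eq:
  assumes f[measurable]: "f \<in> mat_space n p \<Otimes>\<^sub>M vec_space n \<rightarrow>\<^sub>M vec_space p"
  shows "ennreal (integral\<^sup>L (rand_model \<theta> r n p)
          (\<lambda>(W, b, z). let X = design L n p W in hamming p (f (X, response n p X b z)) b))
    = (\<Sum>j<p. \<integral>\<^sup>+W. \<integral>\<^sup>+b. err_prob n p (design L n p W) (\<lambda>y. f (design L n p W, y)) j b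
        \<partial>PiM {..<p} (\<lambda>_. beta_prior \<theta> r p) \<partial>PiM ({..<n} \<times> {..<p}) (\<lambda>_. N01))" (is "_ = ?rhs")
    and "j < p \<Longrightarrow> (\<lambda>(W, b). err_prob n p (design L n p W) (\<lambda>y. f (design L n p W, y)) j b) \<in>
        borel_measurable (PiM ({..<n} \<times> {..<p}) (\<lambda>_. N01) \<Otimes>\<^sub>M PiM {..<p} (\<lambda>_. beta_prior \<theta> r p))"
proof -
  let ?W = "PiM ({..<n} \<times> {..<p}) (\<lambda>_. N01)"
  let ?B = "PiM {..<p} (\<lambda>_. beta_prior \<theta> r p)" and ?Z = "PiM {..<n} (\<lambda>_. N01)"
  let ?M = "?W \<Otimes>\<^sub>M (?B \<Otimes>\<^sub>M ?Z)"
  interpret W: prob_space ?W by (rule prob_space_PiM_N01)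
  interpret B: prob_space ?B by (rule prob_space_PiM_beta)
  interpret Z: prob_space ?Z by (rule prob_space_PiM_N01)
  interpret BZ: pair_prob_space ?B ?Z ..
  interpret WBZ: pair_prob_space ?W "?B \<Otimes>\<^sub>M ?Z" ..
  have g: "(\<lambda>x. f (design L n p (W x), response n p (design L n p (W x)) (b x) (z x))) \<in> M \<rightarrow>\<^sub>M vec_space p"
    if [measurable]: "W \<in> M \<rightarrow>\<^sub>M PiM ({..<n} \<times> {..<p}) (\<lambda>_. borel)" "b \<in> M \<rightarrow>\<^sub>M PiM {..<p} (\<lambda>_. borel)"
      "z \<in> M \<rightarrow>\<^sub>M PiM {..<n} (\<lambda>_. borel)" for M :: "'c measure" and W b z
    by measurable
  have e: "Measurable.pred M (\<lambda>x. (f (design L n p (W x), response n p (design L n p (W x)) (b x) (z x)) j \<noteq> 0) \<noteq> (b x j \<noteq> 0))"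
    if [measurable]: "W \<in> M \<rightarrow>\<^sub>M PiM ({..<n} \<times> {..<p}) (\<lambda>_. borel)" "b \<in> M \<rightarrow>\<^sub>M PiM {..<p} (\<lambda>_. borel)"
      "z \<in> M \<rightarrow>\<^sub>M PiM {..<n} (\<lambda>_. borel)" and j: "j < p" for M :: "'c measure" and W b z j
  proof -
    have 1: "Measurable.pred M (\<lambda>x. f (design L n p (W x), response n p (design L n p (W x)) (b x) (z x)) j \<noteq> 0)"
      using j by (intro pred_component_nonzero[OF g[unfolded vec_space_def]] that) auto
    have 2: "Measurable.pred M (\<lambda>x. b x j \<noteq> 0)"
      using j by (intro pred_component_nonzero[OF that(2)]) auto
    from 1 2 show ?thesis by measurable
  qed
  let ?e = "\<lambda>j W b z. (f (design L n p W, response n p (design L n p W) b z) j \<noteq> 0) \<noteq> (b j \<noteq> 0)"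
  have e3[measurable]: "Measurable.pred ?M (\<lambda>x. ?e j (fst x) (fst (snd x)) (snd (snd x)))" if "j < p" for j
    by (rule e[OF _ _ _ that]) measurable
  have meas: "(\<lambda>x. hamming p (f (design L n p (fst x), response n p (design L n p (fst x)) (fst (snd x)) (snd (snd x)))) (fst (snd x)))
      \<in> borel_measurable ?M"
    unfolding hamming_eq by measurable
  have "ennreal (integral\<^sup>L (rand_model \<theta> r n p)
          (\<lambda>(W, b, z). let X = design L n p W in hamming p (f (X, response n p X b z)) b))
     = (\<integral>\<^sup>+x. ennreal (hamming p (f (design L n p (fst x), response n p (design L n p (fst x)) (fst (snd x)) (snd (snd x)))) (fst (snd x))) \<partial>?M)"
    unfolding rand_model_def case_prod_beta Let_def
    by (intro nn_integral_eq_integral[symmetric] WBZ.integrable_const_bound[where B = "real p"] meas)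
      (auto simp: hamming_nonneg hamming_le)
  also have "\<dots> = (\<integral>\<^sup>+x. (\<Sum>j<p. if ?e j (fst x) (fst (snd x)) (snd (snd x)) then 1 else 0) \<partial>?M)"
    unfolding ennreal_hamming ..
  also have "\<dots> = (\<Sum>j<p. \<integral>\<^sup>+x. (if ?e j (fst x) (fst (snd x)) (snd (snd x)) then 1 else 0) \<partial>?M)"
    by (intro nn_integral_sum) measurable
  also have "\<dots> = ?rhs"
  proof (intro sum.cong refl)
    fix j assume "j \<in> {..<p}"
    then have j: "j < p" by simp
    have m: "(\<lambda>x. if ?e j (fst x) (fst (snd x)) (snd (snd x)) then 1 else 0 :: ennreal) \<in> borel_measurable ?M"
      by (rule borel_measurable_if_pred[OF e3[OF j]])
    have "(\<integral>\<^sup>+x. (if ?e j (fst x) (fst (snd x)) (snd (snd x)) then 1 else 0) \<partial>?M)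
      = (\<integral>\<^sup>+W. \<integral>\<^sup>+x. (if ?e j W (fst x) (snd x) then 1 else 0) \<partial>(?B \<Otimes>\<^sub>M ?Z) \<partial>?W)"
      unfolding BZ.nn_integral_fst[OF m, symmetric] by simp
    also have "\<dots> = (\<integral>\<^sup>+W. \<integral>\<^sup>+b. err_prob n p (design L n p W) (\<lambda>y. f (design L n p W, y)) j b \<partial>?B \<partial>?W)"
    proof (rule nn_integral_cong)
      fix W assume W: "W \<in> space ?W"
      then have m: "Measurable.pred (?B \<Otimes>\<^sub>M ?Z) (\<lambda>x. ?e j W (fst x) (snd x))"
        by (intro e[of "\<lambda>_. W"] j) (auto simp: space_PiM)
      show "(\<integral>\<^sup>+x. (if ?e j W (fst x) (snd x) then 1 else 0) \<partial>(?B \<Otimes>\<^sub>M ?Z))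
        = (\<integral>\<^sup>+b. err_prob n p (design L n p W) (\<lambda>y. f (design L n p W, y)) j b \<partial>?B)"
        unfolding err_prob_def Z.nn_integral_fst[OF borel_measurable_if_pred[OF m], symmetric] by simp
    qed
    finally show "(\<integral>\<^sup>+x. (if ?e j (fst x) (fst (snd x)) (snd (snd x)) then 1 else 0) \<partial>?M)
      = (\<integral>\<^sup>+W. \<integral>\<^sup>+b. err_prob n p (design L n p W) (\<lambda>y. f (design L n p W, y)) j b \<partial>?B \<partial>?W)" .
  qed
  finally show "ennreal (integral\<^sup>L (rand_model \<theta> r n p)
          (\<lambda>(W, b, z). let X = design L n p W in hamming p (f (X, response n p X b z)) b)) = ?rhs" .
  assume j: "j < p"
  have m: "Measurable.pred ((?W \<Otimes>\<^sub>M ?B) \<Otimes>\<^sub>M ?Z) (\<lambda>x. ?e j (fst (fst x)) (snd (fst x)) (snd x))"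
    by (rule e[OF _ _ _ j]) measurable
  have "(\<lambda>x. \<integral>\<^sup>+z. (if ?e j (fst x) (snd x) z then 1 else 0) \<partial>?Z) \<in> borel_measurable (?W \<Otimes>\<^sub>M ?B)"
    using borel_measurable_if_pred[OF m]
    by (intro Z.borel_measurable_nn_integral) (simp only: case_prod_beta')
  then show "(\<lambda>(W, b). err_prob n p (design L n p W) (\<lambda>y. f (design L n p W, y)) j b) \<in>
        borel_measurable (?W \<Otimes>\<^sub>M ?B)"
    unfolding err_prob_def case_prod_beta .
qed

section \<open>Two-point lower bound for the error probability\<close>

lemma measurable_err_prob:
  assumes f: "f \<in> vec_space n \<rightarrow>\<^sub>M vec_space p" and j: "j < p"
  shows "err_prob n p X f j \<in> borel_measurable (PiM {..<p} (\<lambda>_. beta_prior \<theta> r p))"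
proof -
  let ?B = "PiM {..<p} (\<lambda>_. beta_prior \<theta> r p)" and ?Z = "PiM {..<n} (\<lambda>_. N01)"
  interpret Z: prob_space ?Z by (rule prob_space_PiM_N01)
  have "(\<lambda>x. response n p X (fst x) (snd x)) \<in> ?B \<Otimes>\<^sub>M ?Z \<rightarrow>\<^sub>M vec_space n"
    by (intro measurable_response_fixed) measurable
  from measurable_compose[OF this f]
  have 1: "Measurable.pred (?B \<Otimes>\<^sub>M ?Z) (\<lambda>x. f (response n p X (fst x) (snd x)) j \<noteq> 0)"
    using j by (intro pred_component_nonzero[where I = "{..<p}"], fold vec_space_def) auto
  have 2: "Measurable.pred (?B \<Otimes>\<^sub>M ?Z) (\<lambda>x. fst x j \<noteq> 0)"
    using j by (intro pred_nonzero) measurable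
  from 1 2 have m: "Measurable.pred (?B \<Otimes>\<^sub>M ?Z) (\<lambda>x. (f (response n p X (fst x) (snd x)) j \<noteq> 0) \<noteq> (fst x j \<noteq> 0))"
    by measurable
  show ?thesis
    unfolding err_prob_def[abs_def] using borel_measurable_if_pred[OF m]
    by (intro Z.borel_measurable_nn_integral) (simp only: case_prod_beta')
qed

text \<open>An oracle reveals all coordinates outside \<open>{j, j + 1}\<close>. In the two hypotheses compared, coordinate
  \<open>j\<close> is null respectively a signal, and coordinate \<open>j + 1\<close> is described by \<open>s\<close> respectively \<open>s'\<close>.\<close>

lemma err_prob_lower:
  fixes X :: "nat \<times> nat \<Rightarrow> real" and s s' :: bool
  assumes f: "f \<in> vec_space n \<rightarrow>\<^sub>M vec_space p" and j: "Suc j < p" and \<theta>: "0 \<le> \<theta>" and \<tau>: "tau r p \<noteq> 0"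
    and t: "0 \<le> t" "t \<le> 1"
    and \<epsilon>: "\<epsilon> = real p powr (- \<theta>)"
    and D: "D = (\<Sum>i<n. (tau r p * (X (i, j) + (of_bool s' - of_bool s) * X (i, Suc j)))\<^sup>2)"
    and m: "0 \<le> m"
      "m \<le> (if s then \<epsilon> else 1 - \<epsilon>) * (1 - \<epsilon>) * exp (- 2 * sqrt D - t\<^sup>2 * D / 2)"
      "m \<le> (if s' then \<epsilon> else 1 - \<epsilon>) * \<epsilon> * exp (- 2 * sqrt D - (1 - t)\<^sup>2 * D / 2)"
  shows "ennreal (3/4 * m) \<le> (\<integral>\<^sup>+b. err_prob n p X f j b \<partial>PiM {..<p} (\<lambda>_. beta_prior \<theta> r p))"
proof -
  define J where "J = {..<p} - {j, Suc j}"
  define \<tau> where "\<tau> = tau r p"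
  define v where "v = (\<lambda>s. if s then \<tau> else 0)"
  define w where "w = (\<lambda>s. if s then \<epsilon> else 1 - \<epsilon>)"
  let ?M = "\<lambda>_::nat. beta_prior \<theta> r p"
  let ?e = "err_prob n p X f j"
  have fin: "finite J" and notin: "Suc j \<notin> J" "j \<notin> insert (Suc j) J"
    and P: "{..<p} = insert j (insert (Suc j) J)"
    using j by (auto simp: J_def)
  have \<epsilon>01: "0 \<le> \<epsilon>" "\<epsilon> \<le> 1"
    using powr_minus_in_unit[OF \<theta>, of p] by (auto simp: \<epsilon>)
  interpret PJ: prob_space "PiM J ?M" by (rule prob_space_PiM_beta)
  have me[measurable]: "?e \<in> borel_measurable (PiM (insert j (insert (Suc j) J)) ?M)"
    using measurable_err_prob[OF f, of j X \<theta> r] j by (simp flip: P)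
  define g where "g = (\<lambda>x y' y. ?e (x(Suc j := y', j := y)))"
  have "(\<integral>\<^sup>+b. ?e b \<partial>PiM {..<p} ?M) = (\<integral>\<^sup>+x. \<integral>\<^sup>+y. ?e (x(j := y)) \<partial>beta_prior \<theta> r p \<partial>PiM (insert (Suc j) J) ?M)"
    unfolding P using notin fin by (intro betaP.product_nn_integral_insert) measurable
  also have "\<dots> = (\<integral>\<^sup>+x. \<integral>\<^sup>+y'. \<integral>\<^sup>+y. g x y' y \<partial>beta_prior \<theta> r p \<partial>beta_prior \<theta> r p \<partial>PiM J ?M)"
    unfolding g_def using notin fin by (intro betaP.product_nn_integral_insert) measurable
  also have "\<dots> \<ge> (\<integral>\<^sup>+x. ennreal (3/4 * m) \<partial>PiM J ?M)"
  proof (rule nn_integral_mono)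
    fix x assume x: "x \<in> space (PiM J ?M)"
    have [measurable]: "(\<lambda>(y', y). x(Suc j := y', j := y)) \<in> borel \<Otimes>\<^sub>M borel \<rightarrow>\<^sub>M PiM (insert j (insert (Suc j) J)) ?M"
    proof -
      have "(\<lambda>z. x(Suc j := fst z)) \<in> borel \<Otimes>\<^sub>M borel \<rightarrow>\<^sub>M PiM (insert (Suc j) J) ?M"
        using x notin by (intro measurable_fun_upd[where I = "insert (Suc j) J" and J = J]) auto
      then show ?thesis
        unfolding case_prod_beta' using notin
        by (intro measurable_fun_upd[where I = "insert j (insert (Suc j) J)" and J = "insert (Suc j) J"]) auto
    qed
    have [measurable]: "case_prod (g x) \<in> borel_measurable (borel \<Otimes>\<^sub>M borel)"
      unfolding g_def by measurable
    define gA where "gA = g x (v s) 0"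
    define gA' where "gA' = g x (v s') \<tau>"
    have "(\<integral>\<^sup>+y'. \<integral>\<^sup>+y. g x y' y \<partial>beta_prior \<theta> r p \<partial>beta_prior \<theta> r p)
       = (\<integral>\<^sup>+y'. ennreal \<epsilon> * g x y' \<tau> + ennreal (1 - \<epsilon>) * g x y' 0 \<partial>beta_prior \<theta> r p)"
      using \<theta> by (intro nn_integral_cong) (simp add: nn_integral_beta_prior \<epsilon> \<tau>_def)
    also have "\<dots> = ennreal \<epsilon> * (ennreal \<epsilon> * g x \<tau> \<tau> + ennreal (1 - \<epsilon>) * g x \<tau> 0)
       + ennreal (1 - \<epsilon>) * (ennreal \<epsilon> * g x 0 \<tau> + ennreal (1 - \<epsilon>) * g x 0 0)"
      using \<theta> by (simp add: nn_integral_beta_prior \<epsilon> \<tau>_def)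
    finally have eq: "(\<integral>\<^sup>+y'. \<integral>\<^sup>+y. g x y' y \<partial>beta_prior \<theta> r p \<partial>beta_prior \<theta> r p)
      = ennreal \<epsilon> * (ennreal \<epsilon> * g x \<tau> \<tau> + ennreal (1 - \<epsilon>) * g x \<tau> 0)
       + ennreal (1 - \<epsilon>) * (ennreal \<epsilon> * g x 0 \<tau> + ennreal (1 - \<epsilon>) * g x 0 0)" .
    \<comment> \<open>Two of the four configurations of the coordinates \<open>j\<close> and
      \<open>j + 1\<close> are kept. They differ at \<open>j\<close>, so they are distinct terms,
      and the nonnegative rest is dropped.\<close>
    have le: "ennreal (w s * (1 - \<epsilon>)) * gA + ennreal (w s' * \<epsilon>) * gA'
      \<le> ennreal \<epsilon> * (ennreal \<epsilon> * g x \<tau> \<tau> + ennreal (1 - \<epsilon>) * g x \<tau> 0)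
       + ennreal (1 - \<epsilon>) * (ennreal \<epsilon> * g x 0 \<tau> + ennreal (1 - \<epsilon>) * g x 0 0)"
      using \<epsilon>01 unfolding gA_def gA'_def v_def w_def
      by (cases s; cases s') (auto simp: ennreal_mult distrib_left mult.assoc add_ac intro!: add_increasing2 add_mono)
    have "ennreal (3/4 * m) \<le> ennreal (w s * (1 - \<epsilon>)) * gA + ennreal (w s' * \<epsilon>) * gA'"
    proof -
      define b where "b = x(Suc j := v s, j := 0)"
      define b' where "b' = x(Suc j := v s', j := \<tau>)"
      have diff: "(\<Sum>k<p. X (i, k) * b' k) - (\<Sum>k<p. X (i, k) * b k)
        = tau r p * (X (i, j) + (of_bool s' - of_bool s) * X (i, Suc j))" for i
      proof -
        have "(\<Sum>k<p. X (i, k) * b' k) - (\<Sum>k<p. X (i, k) * b k) = (\<Sum>k<p. X (i, k) * (b' k - b k))"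
          by (simp add: sum_subtractf algebra_simps)
        also have "\<dots> = (\<Sum>k\<in>{j, Suc j}. X (i, k) * (b' k - b k))"
          using j by (intro sum.mono_neutral_right) (auto simp: b_def b'_def)
        also have "\<dots> = tau r p * (X (i, j) + (of_bool s' - of_bool s) * X (i, Suc j))"
          by (auto simp: b_def b'_def v_def \<tau>_def algebra_simps)
        finally show ?thesis .
      qed
      have pred: "Measurable.pred (PiM {..<n} (\<lambda>_. borel)) (\<lambda>y. f y j \<noteq> 0)"
        using f j by (intro pred_component_nonzero[where I = "{..<p}"]) (auto simp: vec_space_def)
      have "ennreal (3/4 * m) \<le>
         ennreal (w s * (1 - \<epsilon>)) * (\<integral>\<^sup>+z. (if f (\<lambda>i\<in>{..<n}. (\<Sum>k<p. X (i, k) * b k) + z i) j \<noteq> 0 then 1 else 0) \<partial>PiM {..<n} (\<lambda>_. N01))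
       + ennreal (w s' * \<epsilon>) * (\<integral>\<^sup>+z. (if f (\<lambda>i\<in>{..<n}. (\<Sum>k<p. X (i, k) * b' k) + z i) j \<noteq> 0 then 0 else 1) \<partial>PiM {..<n} (\<lambda>_. N01))"
        using t \<epsilon>01 m
        by (intro two_point_testing[where t = t and D = D] pred) (auto simp: diff D w_def)
      moreover have "gA = (\<integral>\<^sup>+z. (if f (\<lambda>i\<in>{..<n}. (\<Sum>k<p. X (i, k) * b k) + z i) j \<noteq> 0 then 1 else 0) \<partial>PiM {..<n} (\<lambda>_. N01))"
        unfolding gA_def g_def err_prob_def response_def b_def[symmetric]
        by (simp add: b_def cong: if_cong)
      moreover have "gA' = (\<integral>\<^sup>+z. (if f (\<lambda>i\<in>{..<n}. (\<Sum>k<p. X (i, k) * b' k) + z i) j \<noteq> 0 then 0 else 1) \<partial>PiM {..<n} (\<lambda>_. N01))"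
      proof -
        have "b' j \<noteq> 0" using \<tau> by (simp add: b'_def \<tau>_def)
        then show ?thesis
          unfolding gA'_def g_def err_prob_def response_def b'_def[symmetric]
          by (intro nn_integral_cong) auto
      qed
      ultimately show ?thesis by simp
    qed
    from order_trans[OF this le]
    show "ennreal (3/4 * m) \<le> (\<integral>\<^sup>+y'. \<integral>\<^sup>+y. g x y' y \<partial>beta_prior \<theta> r p \<partial>beta_prior \<theta> r p)"
      unfolding eq .
  qed
  finally show ?thesis
    by (simp add: PJ.emeasure_space_1)
qed

section \<open>Error probability of blockwise selection\<close>

definition block :: "nat \<Rightarrow> nat \<Rightarrow> nat set" where
  "block p j = {k. k < p \<and> k div 2 = j div 2}"

lemma block_subset: "block p j \<subseteq> {2 * (j div 2), Suc (2 * (j div 2))}"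
  by (auto simp: block_def)

lemma finite_block [simp]: "finite (block p j)"
  using block_subset by (rule finite_subset) simp

lemma card_block_le: "card (block p j) \<le> 2"
proof -
  have "card (block p j) \<le> card {2 * (j div 2), Suc (2 * (j div 2))}"
    by (intro card_mono block_subset) simp
  then show ?thesis by simp
qed

text \<open>Kept bilinear because values at two different vectors matter too: that they vanish
  across blocks separates a block from the remaining signals.\<close>

definition quad :: "real \<Rightarrow> nat \<Rightarrow> (nat \<Rightarrow> real) \<Rightarrow> (nat \<Rightarrow> real) \<Rightarrow> real" where
  "quad \<rho> p x y = (\<Sum>k<p. \<Sum>l<p. x k * y l * Sigma_mat \<rho> p k l)"

text \<open>The index set \<open>I\<close> is left open because it stands for the rows of a
  deterministic design and also for the columns of the factor \<open>L\<close> of the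
  covariance.\<close>

lemma gram_quad:
  assumes "\<And>j k. j < p \<Longrightarrow> k < p \<Longrightarrow> (\<Sum>i\<in>I. X i j * X i k) = Sigma_mat \<rho> p j k"
  shows "(\<Sum>i\<in>I. (\<Sum>k<p. x k * X i k) * (\<Sum>l<p. y l * X i l)) = quad \<rho> p x y"
proof -
  have "(\<Sum>i\<in>I. (\<Sum>k<p. x k * X i k) * (\<Sum>l<p. y l * X i l))
     = (\<Sum>i\<in>I. \<Sum>k<p. \<Sum>l<p. x k * y l * (X i k * X i l))"
    by (simp add: sum_product mult_ac)
  also have "\<dots> = (\<Sum>k<p. \<Sum>i\<in>I. \<Sum>l<p. x k * y l * (X i k * X i l))"
    by (rule sum.swap)
  also have "\<dots> = (\<Sum>k<p. \<Sum>l<p. \<Sum>i\<in>I. x k * y l * (X i k * X i l))"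
    by (intro sum.cong refl sum.swap)
  also have "\<dots> = quad \<rho> p x y"
    unfolding quad_def by (intro sum.cong refl) (simp add: assms flip: sum_distrib_left)
  finally show ?thesis .
qed

lemma quad_disjoint_blocks:
  assumes "\<And>k. k < p \<Longrightarrow> k div 2 = c \<Longrightarrow> x k = 0" "\<And>k. k < p \<Longrightarrow> k div 2 \<noteq> c \<Longrightarrow> y k = 0"
  shows "quad \<rho> p x y = 0"
  unfolding quad_def using assms by (intro sum.neutral ballI) (auto simp: Sigma_mat_def)

text \<open>Each row of absolute values sums to at most 2, and
  \<open>2 * \<bar>x k * x l\<bar>\<close> is at most the sum of the two squares; together these
  bound the largest eigenvalue by 2.\<close>

lemma quad_le:
  assumes "\<bar>\<rho>\<bar> \<le> 1"
  shows "quad \<rho> p x x \<le> 2 * (\<Sum>k<p. (x k)\<^sup>2)"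
proof -
  have row: "(\<Sum>l<p. \<bar>Sigma_mat \<rho> p k l\<bar>) \<le> 2" if "k < p" for k
  proof -
    have "(\<Sum>l<p. \<bar>Sigma_mat \<rho> p k l\<bar>) \<le> (\<Sum>l<p. of_bool (l \<in> block p k))"
      using assms by (intro sum_mono) (auto simp: Sigma_mat_def block_def)
    also have "\<dots> = real (card ({..<p} \<inter> block p k))"
      by (simp add: of_bool_def sum.If_cases)
    also have "\<dots> \<le> 2"
      using card_mono[of "block p k" "{..<p} \<inter> block p k"] card_block_le[of p k] by simp
    finally show ?thesis .
  qed
  have sym: "Sigma_mat \<rho> p k l = Sigma_mat \<rho> p l k" for k l
    by (auto simp: Sigma_mat_def)
  have "quad \<rho> p x x \<le> (\<Sum>k<p. \<Sum>l<p. ((x k)\<^sup>2 / 2 + (x l)\<^sup>2 / 2) * \<bar>Sigma_mat \<rho> p k l\<bar>)"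
    unfolding quad_def
  proof (intro sum_mono)
    fix k l
    have "\<bar>x k * x l\<bar> \<le> (x k)\<^sup>2 / 2 + (x l)\<^sup>2 / 2"
      using sum_squares_bound[of "\<bar>x k\<bar>" "\<bar>x l\<bar>"] by (simp add: abs_mult)
    then have "\<bar>x k * x l\<bar> * \<bar>Sigma_mat \<rho> p k l\<bar> \<le> ((x k)\<^sup>2 / 2 + (x l)\<^sup>2 / 2) * \<bar>Sigma_mat \<rho> p k l\<bar>"
      by (intro mult_right_mono) auto
    then show "x k * x l * Sigma_mat \<rho> p k l \<le> ((x k)\<^sup>2 / 2 + (x l)\<^sup>2 / 2) * \<bar>Sigma_mat \<rho> p k l\<bar>"
      using abs_ge_self[of "x k * x l * Sigma_mat \<rho> p k l"] unfolding abs_mult by linarith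
  qed
  also have "\<dots> = (\<Sum>k<p. \<Sum>l<p. (x k)\<^sup>2 / 2 * \<bar>Sigma_mat \<rho> p k l\<bar>) + (\<Sum>k<p. \<Sum>l<p. (x l)\<^sup>2 / 2 * \<bar>Sigma_mat \<rho> p k l\<bar>)"
    by (simp add: distrib_right sum.distrib)
  also have "(\<Sum>k<p. \<Sum>l<p. (x l)\<^sup>2 / 2 * \<bar>Sigma_mat \<rho> p k l\<bar>) = (\<Sum>k<p. \<Sum>l<p. (x k)\<^sup>2 / 2 * \<bar>Sigma_mat \<rho> p k l\<bar>)"
    by (subst sum.swap) (intro sum.cong refl, subst sym, rule refl)
  also have "(\<Sum>k<p. \<Sum>l<p. (x k)\<^sup>2 / 2 * \<bar>Sigma_mat \<rho> p k l\<bar>) + (\<Sum>k<p. \<Sum>l<p. (x k)\<^sup>2 / 2 * \<bar>Sigma_mat \<rho> p k l\<bar>)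
     = (\<Sum>k<p. (x k)\<^sup>2 * (\<Sum>l<p. \<bar>Sigma_mat \<rho> p k l\<bar>))"
    unfolding sum.distrib[symmetric] sum_distrib_left by (intro sum.cong refl) simp
  also have "\<dots> \<le> (\<Sum>k<p. (x k)\<^sup>2 * 2)"
    by (intro sum_mono mult_left_mono row) auto
  finally show ?thesis by (simp add: sum_distrib_left mult.commute)
qed

text \<open>A truncated block, as at the end for odd \<open>p\<close>, obeys the same formula
  because \<open>x\<close> vanishes at the missing coordinates.\<close>

lemma quad_block:
  assumes "\<And>k. k \<notin> block p (2 * c) \<Longrightarrow> x k = 0"
  shows "quad \<rho> p x x = (x (2 * c))\<^sup>2 + 2 * \<rho> * x (2 * c) * x (Suc (2 * c)) + (x (Suc (2 * c)))\<^sup>2"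
proof -
  have "quad \<rho> p x x = (\<Sum>k\<in>block p (2 * c). \<Sum>l\<in>block p (2 * c). x k * x l * Sigma_mat \<rho> p k l)"
  proof -
    have sub: "block p (2 * c) \<subseteq> {..<p}" by (auto simp: block_def)
    have "quad \<rho> p x x = (\<Sum>k<p. \<Sum>l\<in>block p (2 * c). x k * x l * Sigma_mat \<rho> p k l)"
      unfolding quad_def using assms sub by (intro sum.cong refl sum.mono_neutral_right) auto
    also have "\<dots> = (\<Sum>k\<in>block p (2 * c). \<Sum>l\<in>block p (2 * c). x k * x l * Sigma_mat \<rho> p k l)"
      using assms sub by (intro sum.mono_neutral_right) auto
    finally show ?thesis .
  qed
  moreover consider "Suc (2 * c) < p" | "p = Suc (2 * c)" | "p \<le> 2 * c" by linarith
  then have "(\<Sum>k\<in>block p (2 * c). \<Sum>l\<in>block p (2 * c). x k * x l * Sigma_mat \<rho> p k l)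
    = (x (2 * c))\<^sup>2 + 2 * \<rho> * x (2 * c) * x (Suc (2 * c)) + (x (Suc (2 * c)))\<^sup>2"
  proof cases
    case 1
    then have "block p (2 * c) = {2 * c, Suc (2 * c)}" by (auto simp: block_def)
    with 1 show ?thesis by (simp add: Sigma_mat_def power2_eq_square algebra_simps)
  next
    case 2
    then have "block p (2 * c) = {2 * c}" by (auto simp: block_def)
    with assms[of "Suc (2 * c)"] 2 show ?thesis by (simp add: Sigma_mat_def power2_eq_square)
  next
    case 3
    then have "block p (2 * c) = {}" by (auto simp: block_def)
    with assms show ?thesis by simp
  qed
  ultimately show ?thesis by simp
qed

text \<open>Up to an additive constant, the logarithm of \<open>p powr (- \<theta> * card A)\<close>
  times the Gaussian likelihood when \<open>A\<close> is the whole support. The prior factors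
  \<open>1 - p powr (- \<theta>)\<close> of null coordinates are omitted.\<close>

definition score :: "real \<Rightarrow> real \<Rightarrow> nat \<Rightarrow> nat \<Rightarrow> (nat \<times> nat \<Rightarrow> real) \<Rightarrow> (nat \<Rightarrow> real) \<Rightarrow> nat set \<Rightarrow> real" where
  "score \<theta> r n p X y A = - \<theta> * real (card A) * ln (real p) - (\<Sum>i<n. (y i - tau r p * (\<Sum>k\<in>A. X (i, k)))\<^sup>2) / 2"

text \<open>Blockwise maximum a posteriori selection, ignoring the interference between blocks.\<close>

definition block_map :: "real \<Rightarrow> real \<Rightarrow> nat \<Rightarrow> nat \<Rightarrow> (nat \<times> nat \<Rightarrow> real) \<Rightarrow> (nat \<Rightarrow> real) \<Rightarrow> nat \<Rightarrow> real" where
  "block_map \<theta> r n p X y = (\<lambda>j\<in>{..<p}. if \<exists>A\<in>Pow (block p j). j \<in> A \<and>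
      (\<forall>A'\<in>Pow (block p j). j \<notin> A' \<longrightarrow> score \<theta> r n p X y A' < score \<theta> r n p X y A) then 1 else 0)"

lemma measurable_score:
  assumes X: "X \<in> M \<rightarrow>\<^sub>M mat_space n p" and y: "y \<in> M \<rightarrow>\<^sub>M vec_space n" and A: "A \<subseteq> {..<p}"
  shows "(\<lambda>x. score \<theta> r n p (X x) (y x) A) \<in> borel_measurable M"
proof -
  have X': "(\<lambda>x. X x (i, k)) \<in> borel_measurable M" if "i < n" "k \<in> A" for i k
    using that A by (intro measurable_compose[OF X[unfolded mat_space_def] measurable_component_singleton]) auto
  have y': "(\<lambda>x. y x i) \<in> borel_measurable M" if "i < n" for i
    using that by (intro measurable_compose[OF y[unfolded vec_space_def] measurable_component_singleton]) auto
  show ?thesis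
    unfolding score_def
    by (intro borel_measurable_diff borel_measurable_times borel_measurable_divide borel_measurable_const
        borel_measurable_sum borel_measurable_power X' y') auto
qed

lemma measurable_block_map:
  assumes X: "X \<in> M \<rightarrow>\<^sub>M mat_space n p" and y: "y \<in> M \<rightarrow>\<^sub>M vec_space n"
  shows "(\<lambda>x. block_map \<theta> r n p (X x) (y x)) \<in> M \<rightarrow>\<^sub>M vec_space p"
proof -
  have [measurable]: "(\<lambda>x. score \<theta> r n p (X x) (y x) A) \<in> borel_measurable M" if "A \<in> Pow (block p j)" for A j
    using that by (intro measurable_score[OF X y]) (auto simp: block_def)
  have "(\<lambda>x. if \<exists>A\<in>Pow (block p j). j \<in> A \<and>
      (\<forall>A'\<in>Pow (block p j). j \<notin> A' \<longrightarrow> score \<theta> r n p (X x) (y x) A' < score \<theta> r n p (X x) (y x) A) then 1 else 0 :: real)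
    \<in> borel_measurable M" for j
    by measurable
  then show ?thesis
    unfolding block_map_def vec_space_def by (intro measurable_restrict) auto
qed

text \<open>Selecting \<open>j\<close> requires a support with \<open>j\<close> that strictly beats
  all those without it. A wrong decision in either direction therefore leaves a competitor scoring
  at least as high as \<open>A\<close>, ties included.\<close>

lemma block_map_error:
  assumes "j < p" "A \<subseteq> block p j" and err: "(block_map \<theta> r n p X y j \<noteq> 0) \<noteq> (j \<in> A)"
  shows "\<exists>A'\<in>Pow (block p j) - {A}. score \<theta> r n p X y A \<le> score \<theta> r n p X y A'"
proof (cases "j \<in> A")
  case True
  have "\<not> (\<exists>A\<in>Pow (block p j). j \<in> A \<and>
      (\<forall>A'\<in>Pow (block p j). j \<notin> A' \<longrightarrow> score \<theta> r n p X y A' < score \<theta> r n p X y A))" (is "\<not> ?P")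
  proof
    assume ?P
    then have "block_map \<theta> r n p X y j = 1" using assms(1) by (simp only: block_map_def restrict_apply lessThan_iff if_True)
    with err True show False by simp
  qed
  with True assms(2) obtain A' where "A' \<in> Pow (block p j)" "j \<notin> A'" "\<not> score \<theta> r n p X y A' < score \<theta> r n p X y A"
    by blast
  with True show ?thesis by (intro bexI[of _ A']) auto
next
  case False
  with err assms(1) obtain A' where "A' \<in> Pow (block p j)" "j \<in> A'"
    "\<forall>A\<in>Pow (block p j). j \<notin> A \<longrightarrow> score \<theta> r n p X y A < score \<theta> r n p X y A'"
    by (auto simp: block_map_def split: if_splits)
  with False assms(2) show ?thesis by (intro bexI[of _ A']) (auto intro: less_imp_le)
qed

section \<open>Comparison of two supports within a block\<close>

definition contrast :: "nat set \<Rightarrow> nat set \<Rightarrow> nat \<Rightarrow> real" where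
  "contrast A A' k = of_bool (k \<in> A') - of_bool (k \<in> A)"

text \<open>The coefficients that the scores of this block ignore and that act as
  interference.\<close>

definition off_block :: "nat \<Rightarrow> nat \<Rightarrow> (nat \<Rightarrow> real) \<Rightarrow> nat \<Rightarrow> real" where
  "off_block p j b k = (if k \<in> block p j then 0 else b k)"

text \<open>Chernoff's bound for the log-likelihood ratio against each competitor \<open>A'\<close>, with exponent \<open>t A'\<close>.\<close>

lemma err_prob_block_map:
  fixes X :: "nat \<times> nat \<Rightarrow> real" and t :: "nat set \<Rightarrow> real"
  assumes j: "j < p" and b: "\<And>k. k < p \<Longrightarrow> b k = 0 \<or> b k = tau r p"
    and A: "A = {k \<in> block p j. b k \<noteq> 0}" and t: "\<And>A'. 0 \<le> t A'"
  shows "err_prob n p X (block_map \<theta> r n p X) j b \<le>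
    (\<Sum>A'\<in>Pow (block p j) - {A}. ennreal (exp (- t A' * \<theta> * (real (card A') - real (card A)) * ln (real p)
      + (\<Sum>i<n. t A' * (\<Sum>k<p. off_block p j b k * X (i, k)) * (tau r p * (\<Sum>k<p. contrast A A' k * X (i, k)))
         - (t A' - (t A')\<^sup>2) / 2 * (tau r p * (\<Sum>k<p. contrast A A' k * X (i, k)))\<^sup>2))))"
proof -
  let ?Z = "PiM {..<n} (\<lambda>_. N01)" and ?\<tau> = "tau r p"
  define w where "w = (\<lambda>i. \<Sum>k<p. off_block p j b k * X (i, k))"
  define d where "d = (\<lambda>A' i. ?\<tau> * (\<Sum>k<p. contrast A A' k * X (i, k)))"
  define \<Delta> where "\<Delta> = (\<lambda>A'::nat set. - \<theta> * (real (card A') - real (card A)) * ln (real p))"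
  have sub: "block p j \<subseteq> {..<p}" by (auto simp: block_def)
  have set_sum: "(\<Sum>k\<in>S. X (i, k)) = (\<Sum>k<p. of_bool (k \<in> S) * X (i, k))" if "S \<subseteq> block p j" for S i
    using that sub by (intro sum.mono_neutral_cong_left) auto
  have As: "A \<subseteq> block p j" by (auto simp: A)
  have resA: "(\<Sum>k<p. X (i, k) * b k) + z - ?\<tau> * (\<Sum>k\<in>A. X (i, k)) = w i + z" for i z
  proof -
    have "(\<Sum>k<p. X (i, k) * b k) - ?\<tau> * (\<Sum>k\<in>A. X (i, k)) = (\<Sum>k<p. X (i, k) * b k - ?\<tau> * (of_bool (k \<in> A) * X (i, k)))"
      by (simp only: set_sum[OF As] sum_subtractf sum_distrib_left)
    also have "\<dots> = w i"
      unfolding w_def off_block_def using b by (intro sum.cong) (auto simp: A)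
    finally show ?thesis by simp
  qed
  have resA': "?\<tau> * (\<Sum>k\<in>A'. X (i, k)) = ?\<tau> * (\<Sum>k\<in>A. X (i, k)) + d A' i" if "A' \<subseteq> block p j" for A' i
    unfolding d_def using that
    by (subst (1 2) set_sum) (auto simp: A contrast_def algebra_simps sum_subtractf)
  have diff: "score \<theta> r n p X (response n p X b z) A' - score \<theta> r n p X (response n p X b z) A
     = \<Delta> A' + (\<Sum>i<n. (w i + z i) * d A' i) - (\<Sum>i<n. (d A' i)\<^sup>2) / 2" if "A' \<subseteq> block p j" for A' z
  proof -
    have 1: "(\<Sum>i<n. (response n p X b z i - ?\<tau> * (\<Sum>k\<in>A. X (i, k)))\<^sup>2) = (\<Sum>i<n. (w i + z i)\<^sup>2)"
      by (intro sum.cong) (auto simp: response_def resA)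
    have "(\<Sum>i<n. (response n p X b z i - ?\<tau> * (\<Sum>k\<in>A'. X (i, k)))\<^sup>2) = (\<Sum>i<n. (w i + z i - d A' i)\<^sup>2)"
      using that by (intro sum.cong) (auto simp: response_def resA' diff_diff_eq simp flip: resA)
    also have "\<dots> = (\<Sum>i<n. (w i + z i)\<^sup>2) - 2 * (\<Sum>i<n. (w i + z i) * d A' i) + (\<Sum>i<n. (d A' i)\<^sup>2)"
      unfolding sum_distrib_left sum_subtractf[symmetric] sum.distrib[symmetric] power2_diff
      by (intro sum.cong refl) (simp add: algebra_simps)
    finally show ?thesis
      unfolding score_def 1 by (simp add: \<Delta>_def algebra_simps)
  qed
  have "err_prob n p X (block_map \<theta> r n p X) j b
     \<le> (\<integral>\<^sup>+z. (\<Sum>A'\<in>Pow (block p j) - {A}. ennreal (exp (t A' * (\<Delta> A' + (\<Sum>i<n. (w i + z i) * d A' i) - (\<Sum>i<n. (d A' i)\<^sup>2) / 2)))) \<partial>?Z)"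
    unfolding err_prob_def
  proof (rule nn_integral_mono)
    fix z
    let ?y = "response n p X b z"
    show "(if (block_map \<theta> r n p X ?y j \<noteq> 0) \<noteq> (b j \<noteq> 0) then 1 else 0)
      \<le> (\<Sum>A'\<in>Pow (block p j) - {A}. ennreal (exp (t A' * (\<Delta> A' + (\<Sum>i<n. (w i + z i) * d A' i) - (\<Sum>i<n. (d A' i)\<^sup>2) / 2))))"
    proof (cases "(block_map \<theta> r n p X ?y j \<noteq> 0) \<noteq> (b j \<noteq> 0)")
      case True
      moreover have "(b j \<noteq> 0) = (j \<in> A)" using j by (simp add: A block_def)
      ultimately have "(block_map \<theta> r n p X ?y j \<noteq> 0) \<noteq> (j \<in> A)" by metis
      from block_map_error[OF j As this]
      obtain A' where A': "A' \<in> Pow (block p j) - {A}" "score \<theta> r n p X ?y A \<le> score \<theta> r n p X ?y A'"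
        by blast
      have "0 \<le> \<Delta> A' + (\<Sum>i<n. (w i + z i) * d A' i) - (\<Sum>i<n. (d A' i)\<^sup>2) / 2"
        using A' diff[of A' z] by simp
      then have "1 \<le> exp (t A' * (\<Delta> A' + (\<Sum>i<n. (w i + z i) * d A' i) - (\<Sum>i<n. (d A' i)\<^sup>2) / 2))"
        using t[of A'] by (simp only: one_le_exp_iff mult_nonneg_nonneg)
      then have "1 \<le> ennreal (exp (t A' * (\<Delta> A' + (\<Sum>i<n. (w i + z i) * d A' i) - (\<Sum>i<n. (d A' i)\<^sup>2) / 2)))"
        using ennreal_leI by fastforce
      also have "\<dots> \<le> (\<Sum>A'\<in>Pow (block p j) - {A}. ennreal (exp (t A' * (\<Delta> A' + (\<Sum>i<n. (w i + z i) * d A' i) - (\<Sum>i<n. (d A' i)\<^sup>2) / 2))))"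
        using A' by (intro member_le_sum) auto
      finally show ?thesis by simp
    qed simp
  qed
  also have "\<dots> = (\<Sum>A'\<in>Pow (block p j) - {A}. \<integral>\<^sup>+z. ennreal (exp (t A' * (\<Delta> A' + (\<Sum>i<n. (w i + z i) * d A' i) - (\<Sum>i<n. (d A' i)\<^sup>2) / 2))) \<partial>?Z)"
    by (rule nn_integral_sum) measurable
  also have "\<dots> = (\<Sum>A'\<in>Pow (block p j) - {A}. ennreal (exp (- t A' * \<theta> * (real (card A') - real (card A)) * ln (real p)
      + (\<Sum>i<n. t A' * w i * d A' i - (t A' - (t A')\<^sup>2) / 2 * (d A' i)\<^sup>2))))"
  proof (rule sum.cong)
    fix A'
    define c where "c = t A' * \<Delta> A' + t A' * (\<Sum>i<n. w i * d A' i) - t A' * (\<Sum>i<n. (d A' i)\<^sup>2) / 2"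
    have "(\<integral>\<^sup>+z. ennreal (exp (t A' * (\<Delta> A' + (\<Sum>i<n. (w i + z i) * d A' i) - (\<Sum>i<n. (d A' i)\<^sup>2) / 2))) \<partial>?Z)
      = (\<integral>\<^sup>+z. ennreal (exp c) * ennreal (exp (\<Sum>i<n. (t A' * d A' i) * z i)) \<partial>?Z)"
    proof (rule nn_integral_cong)
      fix z
      have "t A' * (\<Delta> A' + (\<Sum>i<n. (w i + z i) * d A' i) - (\<Sum>i<n. (d A' i)\<^sup>2) / 2)
        = c + (\<Sum>i<n. (t A' * d A' i) * z i)"
        by (simp add: c_def distrib_left distrib_right sum.distrib right_diff_distrib sum_distrib_left mult_ac)
      then show "ennreal (exp (t A' * (\<Delta> A' + (\<Sum>i<n. (w i + z i) * d A' i) - (\<Sum>i<n. (d A' i)\<^sup>2) / 2)))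
        = ennreal (exp c) * ennreal (exp (\<Sum>i<n. (t A' * d A' i) * z i))"
        by (simp add: exp_add ennreal_mult)
    qed
    also have "\<dots> = ennreal (exp c) * ennreal (exp ((\<Sum>i<n. (t A' * d A' i)\<^sup>2) / 2))"
      by (subst nn_integral_cmult) (auto simp: gaussian_mgf)
    also have "\<dots> = ennreal (exp (c + (\<Sum>i<n. (t A' * d A' i)\<^sup>2) / 2))"
      by (simp add: exp_add ennreal_mult)
    \<comment> \<open>The exponential moment of the noise adds \<open>t\<^sup>2 / 2\<close> times
      the squared distance, which turns its coefficient \<open>- t / 2\<close> into
      \<open>- (t - t\<^sup>2) / 2\<close>.\<close>
    also have "c + (\<Sum>i<n. (t A' * d A' i)\<^sup>2) / 2 = - t A' * \<theta> * (real (card A') - real (card A)) * ln (real p)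
      + (\<Sum>i<n. t A' * w i * d A' i - (t A' - (t A')\<^sup>2) / 2 * (d A' i)\<^sup>2)"
      by (simp add: c_def \<Delta>_def power_mult_distrib sum_subtractf left_diff_distrib diff_divide_distrib
          sum_distrib_left[symmetric] sum_divide_distrib[symmetric] mult.assoc)
    finally show "(\<integral>\<^sup>+z. ennreal (exp (t A' * (\<Delta> A' + (\<Sum>i<n. (w i + z i) * d A' i) - (\<Sum>i<n. (d A' i)\<^sup>2) / 2))) \<partial>?Z)
      = ennreal (exp (- t A' * \<theta> * (real (card A') - real (card A)) * ln (real p)
      + (\<Sum>i<n. t A' * w i * d A' i - (t A' - (t A')\<^sup>2) / 2 * (d A' i)\<^sup>2)))" .
  qed simp
  finally show ?thesis unfolding w_def d_def .
qed

text \<open>The Chernoff exponent equals the exponent of the two-point lower bound at the optimal tilt.\<close>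

lemma chernoff_saddle_point:
  fixes a a' D :: real
  assumes "a \<le> a'" "0 < D"
  shows "\<exists>t. 0 \<le> t \<and> t \<le> 1 \<and> a + t\<^sup>2 * D \<le> (1 - t) * a + t * a' + t * (1 - t) * D
    \<and> a' + (1 - t)\<^sup>2 * D \<le> (1 - t) * a + t * a' + t * (1 - t) * D"
proof (cases "a' - a \<le> D")
  case True
  \<comment> \<open>The right side is the convex combination, with weights \<open>1 - t\<close> and
    \<open>t\<close>, of \<open>a + t\<^sup>2 * D\<close> and
    \<open>a' + (1 - t)\<^sup>2 * D\<close>. This \<open>t\<close> makes the two equal, hence all
    three agree; it also maximises the right side.\<close>
  define t where "t = (a' - a + D) / (2 * D)"
  have t: "0 \<le> t" "t \<le> 1"
    using assms True by (auto simp: t_def field_simps)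
  have a': "a' = a + 2 * D * t - D"
    using assms by (simp add: t_def)
  show ?thesis
    using t by (intro exI[of _ t]) (simp add: a' power2_eq_square algebra_simps)
next
  case False
  then show ?thesis by (intro exI[of _ 1]) simp
qed

text \<open>The conditions belong to the pairs of supports \<open>{}, {1}\<close>, then \<open>{}, {1, 2}\<close>, then \<open>{1}, {2}\<close> within a block;
  the remaining pairs are dominated by the first.\<close>

definition exponent_bound :: "real \<Rightarrow> real \<Rightarrow> real \<Rightarrow> real \<Rightarrow> bool" where
  "exponent_bound \<theta> r \<rho> h \<longleftrightarrow>
     (\<exists>t. 0 \<le> t \<and> t \<le> 1 \<and> h \<le> t * \<theta> + t * (1 - t) * r)
   \<and> (\<exists>t. 0 \<le> t \<and> t \<le> 1 \<and> h \<le> t * (2 * \<theta>) + t * (1 - t) * (r * (2 + 2 * \<rho>)))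
   \<and> (\<exists>t. 0 \<le> t \<and> t \<le> 1 \<and> h \<le> \<theta> + t * (1 - t) * (r * (2 - 2 * \<rho>)))"

text \<open>Only the cardinalities and the quadratic form of the contrast enter, which leaves seven
  cases. Reversing a pair replaces \<open>t\<close> by \<open>1 - t\<close>, and a signal common to
  both supports only adds \<open>\<theta>\<close> to the exponent.\<close>

lemma contrast_exponent:
  assumes h: "exponent_bound \<theta> r \<rho> h" and \<theta>: "0 \<le> \<theta>"
    and A: "A \<subseteq> block p j" "A' \<subseteq> block p j" "A \<noteq> A'"
  shows "\<exists>t. 0 \<le> t \<and> t \<le> 1 \<and> h \<le> (1 - t) * \<theta> * real (card A) + t * \<theta> * real (card A')
    + t * (1 - t) * r * quad \<rho> p (contrast A A') (contrast A A')"
proof -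
  define u where "u = 2 * (j div 2)"
  have sub: "block p j \<subseteq> {u, Suc u}"
    using block_subset[of p j] by (simp add: u_def)
  have "block p (2 * (j div 2)) = block p j" by (simp add: block_def)
  then have q: "quad \<rho> p (contrast A A') (contrast A A')
    = (contrast A A' u)\<^sup>2 + 2 * \<rho> * contrast A A' u * contrast A A' (Suc u) + (contrast A A' (Suc u))\<^sup>2"
    unfolding u_def using A by (intro quad_block) (auto simp: contrast_def)
  have card: "real (card B) = of_bool (u \<in> B) + of_bool (Suc u \<in> B)" if "B \<subseteq> block p j" for B
  proof -
    have "B = (if u \<in> B then {u} else {}) \<union> (if Suc u \<in> B then {Suc u} else {})"
      using that sub by auto
    then have "card B = card ((if u \<in> B then {u} else {}) \<union> (if Suc u \<in> B then {Suc u} else {}))"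
      by simp
    then show ?thesis by simp
  qed
  have ne: "(u \<in> A) \<noteq> (u \<in> A') \<or> (Suc u \<in> A) \<noteq> (Suc u \<in> A')"
    using A sub by blast
  obtain t1 where t1: "0 \<le> t1" "t1 \<le> 1" "h \<le> t1 * \<theta> + t1 * (1 - t1) * r"
    using h by (auto simp: exponent_bound_def)
  obtain t2 where t2: "0 \<le> t2" "t2 \<le> 1" "h \<le> t2 * (2 * \<theta>) + t2 * (1 - t2) * (r * (2 + 2 * \<rho>))"
    using h by (auto simp: exponent_bound_def)
  obtain t3 where t3: "0 \<le> t3" "t3 \<le> 1" "h \<le> \<theta> + t3 * (1 - t3) * (r * (2 - 2 * \<rho>))"
    using h by (auto simp: exponent_bound_def)
  define E where "E = (\<lambda>a a' q. \<exists>t. 0 \<le> t \<and> t \<le> 1 \<and> h \<le> (1 - t) * \<theta> * a + t * \<theta> * a' + t * (1 - t) * r * q)"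
  have E01: "E 0 1 1" unfolding E_def using t1 by (intro exI[of _ t1]) simp
  have E10: "E 1 0 1" unfolding E_def using t1 by (intro exI[of _ "1 - t1"]) (simp add: algebra_simps)
  have E12: "E 1 2 1" unfolding E_def using t1 \<theta> by (intro exI[of _ t1]) (simp add: algebra_simps)
  have E21: "E 2 1 1" unfolding E_def using t1 \<theta> by (intro exI[of _ "1 - t1"]) (simp add: algebra_simps)
  have E02: "E 0 2 (2 + 2 * \<rho>)" unfolding E_def using t2 by (intro exI[of _ t2]) (simp add: algebra_simps)
  have E20: "E 2 0 (2 + 2 * \<rho>)" unfolding E_def using t2 by (intro exI[of _ "1 - t2"]) (simp add: algebra_simps)
  have E11: "E 1 1 (2 - 2 * \<rho>)" unfolding E_def using t3 by (intro exI[of _ t3]) (simp add: algebra_simps)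
  have "E (of_bool (u \<in> A) + of_bool (Suc u \<in> A)) (of_bool (u \<in> A') + of_bool (Suc u \<in> A'))
     ((contrast A A' u)\<^sup>2 + 2 * \<rho> * contrast A A' u * contrast A A' (Suc u) + (contrast A A' (Suc u))\<^sup>2)"
    using ne E01 E10 E12 E21 E02 E20 E11
    by (cases "u \<in> A"; cases "Suc u \<in> A"; cases "u \<in> A'"; cases "Suc u \<in> A'")
      (simp_all add: contrast_def algebra_simps)
  then show ?thesis
    unfolding E_def card[OF A(1)] card[OF A(2)] q .
qed

lemma tau_squared:
  assumes "0 \<le> r" "1 \<le> p"
  shows "(tau r p)\<^sup>2 = 2 * r * ln (real p)"
  using assms by (simp add: tau_def)

text \<open>Half of \<open>\<tau>\<^sup>2\<close> is \<open>r * ln p\<close>, so the exponents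
  become multiples of \<open>ln p\<close>. The resulting bound does not depend on the competitor;
  its term \<open>\<theta> * card A\<close> is later offset by the prior probability of
  \<open>A\<close>.\<close>

lemma exponent_choice:
  assumes h: "exponent_bound \<theta> r \<rho> h" and \<theta>: "0 \<le> \<theta>" and r: "0 \<le> r" and p: "1 \<le> p" and A: "A \<subseteq> block p j"
  shows "\<exists>t. (\<forall>A'. 0 \<le> t A' \<and> t A' \<le> 1) \<and> (\<forall>A'\<in>Pow (block p j) - {A}.
    - t A' * \<theta> * (real (card A') - real (card A)) * ln (real p)
      - (t A' - (t A')\<^sup>2) / 2 * ((tau r p)\<^sup>2 * quad \<rho> p (contrast A A') (contrast A A'))
    \<le> (\<theta> * real (card A) - h) * ln (real p))"
proof -
  have "\<exists>t. 0 \<le> t \<and> t \<le> 1 \<and> (A' \<in> Pow (block p j) - {A} \<longrightarrow>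
    - t * \<theta> * (real (card A') - real (card A)) * ln (real p)
      - (t - t\<^sup>2) / 2 * ((tau r p)\<^sup>2 * quad \<rho> p (contrast A A') (contrast A A'))
    \<le> (\<theta> * real (card A) - h) * ln (real p))" for A'
  proof (cases "A' \<in> Pow (block p j) - {A}")
    case True
    let ?Q = "quad \<rho> p (contrast A A') (contrast A A')"
    obtain t where t: "0 \<le> t" "t \<le> 1"
      and le: "h \<le> (1 - t) * \<theta> * real (card A) + t * \<theta> * real (card A') + t * (1 - t) * r * ?Q"
      using contrast_exponent[OF h \<theta> A, of A'] True by blast
    have ln: "0 \<le> ln (real p)" using p by simp
    have "h * ln (real p) \<le> ((1 - t) * \<theta> * real (card A) + t * \<theta> * real (card A') + t * (1 - t) * r * ?Q) * ln (real p)"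
      using le ln by (rule mult_right_mono)
    then have "- t * \<theta> * (real (card A') - real (card A)) * ln (real p) - (t - t\<^sup>2) / 2 * ((tau r p)\<^sup>2 * ?Q)
       \<le> (\<theta> * real (card A) - h) * ln (real p)"
      unfolding tau_squared[OF r p] by (simp add: power2_eq_square algebra_simps diff_divide_distrib)
    with t show ?thesis by blast
  next
    case False
    \<comment> \<open>A default outside the set of competitors, so that the range condition holds
      for all arguments of \<open>t\<close>.\<close>
    then show ?thesis by (intro exI[of _ 0]) auto
  qed
  then obtain t where "\<And>A'. 0 \<le> t A' \<and> t A' \<le> 1 \<and> (A' \<in> Pow (block p j) - {A} \<longrightarrow>
    - t A' * \<theta> * (real (card A') - real (card A)) * ln (real p)
      - (t A' - (t A')\<^sup>2) / 2 * ((tau r p)\<^sup>2 * quad \<rho> p (contrast A A') (contrast A A'))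
    \<le> (\<theta> * real (card A) - h) * ln (real p))"
    by metis
  then show ?thesis by (intro exI[of _ t]) blast
qed

lemma card_competitors_le: "card (Pow (block p j) - {A}) \<le> 4"
proof -
  have "card (Pow (block p j) - {A}) \<le> card (Pow (block p j))"
    by (intro card_mono) auto
  also have "\<dots> = 2 ^ card (block p j)" by (rule card_Pow) simp
  also have "\<dots> \<le> 2 ^ 2" by (intro power_increasing card_block_le) simp
  finally show ?thesis by simp
qed

text \<open>For deterministic design this removes the cross term between interference and contrast;
  for random design it makes the two independent.\<close>

lemma quad_off_block_contrast:
  assumes "A \<subseteq> block p j" "A' \<subseteq> block p j"
  shows "quad \<rho> p (off_block p j b) (contrast A A') = 0"
  using assms by (intro quad_disjoint_blocks[where c = "j div 2"])
    (auto simp: off_block_def contrast_def block_def)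

section \<open>Conditional error under a deterministic design\<close>

lemma det_err_prob_upper:
  fixes X :: "nat \<Rightarrow> nat \<Rightarrow> real"
  assumes h: "exponent_bound \<theta> r \<rho> h" and \<theta>: "0 \<le> \<theta>" and r: "0 \<le> r" and p: "1 \<le> p"
    and gram: "\<And>j k. j < p \<Longrightarrow> k < p \<Longrightarrow> (\<Sum>i<n. X i j * X i k) = Sigma_mat \<rho> p j k"
    and j: "j < p" and b: "\<And>k. k < p \<Longrightarrow> b k = 0 \<or> b k = tau r p"
  shows "err_prob n p (\<lambda>(i, k). X i k) (block_map \<theta> r n p (\<lambda>(i, k). X i k)) j b
    \<le> ennreal (4 * exp ((\<theta> * real (card {k \<in> block p j. b k \<noteq> 0}) - h) * ln (real p)))"
proof -
  define A where "A = {k \<in> block p j. b k \<noteq> 0}"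
  have A: "A \<subseteq> block p j" by (auto simp: A_def)
  let ?\<tau> = "tau r p"
  let ?E = "(\<theta> * real (card A) - h) * ln (real p)"
  obtain t where t: "\<And>A'. 0 \<le> t A' \<and> t A' \<le> 1"
    and le: "\<And>A'. A' \<in> Pow (block p j) - {A} \<Longrightarrow>
    - t A' * \<theta> * (real (card A') - real (card A)) * ln (real p)
      - (t A' - (t A')\<^sup>2) / 2 * (?\<tau>\<^sup>2 * quad \<rho> p (contrast A A') (contrast A A')) \<le> ?E"
    using exponent_choice[OF h \<theta> r p A] by blast
  have eq: "(\<Sum>i<n. t A' * (\<Sum>k<p. off_block p j b k * X i k) * (?\<tau> * (\<Sum>k<p. contrast A A' k * X i k))
         - (t A' - (t A')\<^sup>2) / 2 * (?\<tau> * (\<Sum>k<p. contrast A A' k * X i k))\<^sup>2)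
     = - ((t A' - (t A')\<^sup>2) / 2 * (?\<tau>\<^sup>2 * quad \<rho> p (contrast A A') (contrast A A')))"
    if "A' \<in> Pow (block p j) - {A}" for A'
  proof -
    have alg: "c * 0 - k / 2 * s * q = - (k / 2 * (s * q))" for c k s q :: real by simp
    have "(\<Sum>i<n. t A' * (\<Sum>k<p. off_block p j b k * X i k) * (?\<tau> * (\<Sum>k<p. contrast A A' k * X i k))
         - (t A' - (t A')\<^sup>2) / 2 * (?\<tau> * (\<Sum>k<p. contrast A A' k * X i k))\<^sup>2)
      = t A' * ?\<tau> * (\<Sum>i<n. (\<Sum>k<p. off_block p j b k * X i k) * (\<Sum>k<p. contrast A A' k * X i k))
        - (t A' - (t A')\<^sup>2) / 2 * ?\<tau>\<^sup>2 * (\<Sum>i<n. (\<Sum>k<p. contrast A A' k * X i k) * (\<Sum>k<p. contrast A A' k * X i k))"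
      unfolding sum_distrib_left[of "t A' * ?\<tau>"] sum_distrib_left[of "(t A' - (t A')\<^sup>2) / 2 * ?\<tau>\<^sup>2"] sum_subtractf[symmetric]
      by (intro sum.cong refl) (simp add: power_mult_distrib power2_eq_square mult_ac)
    also have "\<dots> = t A' * ?\<tau> * quad \<rho> p (off_block p j b) (contrast A A')
        - (t A' - (t A')\<^sup>2) / 2 * ?\<tau>\<^sup>2 * quad \<rho> p (contrast A A') (contrast A A')"
      by (simp only: gram_quad[OF gram])
    also have "quad \<rho> p (off_block p j b) (contrast A A') = 0"
      using that by (intro quad_off_block_contrast A) auto
    finally show ?thesis unfolding alg .
  qed
  have "err_prob n p (\<lambda>(i, k). X i k) (block_map \<theta> r n p (\<lambda>(i, k). X i k)) j b
     \<le> (\<Sum>A'\<in>Pow (block p j) - {A}. ennreal (exp (- t A' * \<theta> * (real (card A') - real (card A)) * ln (real p)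
      + (\<Sum>i<n. t A' * (\<Sum>k<p. off_block p j b k * X i k) * (?\<tau> * (\<Sum>k<p. contrast A A' k * X i k))
         - (t A' - (t A')\<^sup>2) / 2 * (?\<tau> * (\<Sum>k<p. contrast A A' k * X i k))\<^sup>2))))"
    using err_prob_block_map[OF j b A_def, of t n "\<lambda>(i, k). X i k" \<theta>] t unfolding case_prod_conv by blast
  also have "\<dots> \<le> (\<Sum>A'\<in>Pow (block p j) - {A}. ennreal (exp ?E))"
  proof (intro sum_mono ennreal_leI)
    fix A' assume A': "A' \<in> Pow (block p j) - {A}"
    show "exp (- t A' * \<theta> * (real (card A') - real (card A)) * ln (real p)
      + (\<Sum>i<n. t A' * (\<Sum>k<p. off_block p j b k * X i k) * (?\<tau> * (\<Sum>k<p. contrast A A' k * X i k))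
         - (t A' - (t A')\<^sup>2) / 2 * (?\<tau> * (\<Sum>k<p. contrast A A' k * X i k))\<^sup>2)) \<le> exp ?E"
      unfolding eq[OF A'] exp_le_cancel_iff using le[OF A'] by simp
  qed
  also have "\<dots> \<le> ennreal (4 * exp ?E)"
    using card_competitors_le[of p j A]
    by (simp add: ennreal_of_nat_eq_real_of_nat mult_right_mono flip: ennreal_mult)
  finally show ?thesis unfolding A_def .
qed

section \<open>Conditional error averaged over a random design\<close>

lemma design_linear:
  assumes "i < n"
  shows "(\<Sum>k<p. x k * design L n p W (i, k)) = (\<Sum>m<p. (1 / sqrt (real n) * (\<Sum>k<p. x k * L k m)) * W (i, m))"
proof -
  have "(\<Sum>k<p. x k * design L n p W (i, k)) = (\<Sum>k<p. \<Sum>m<p. 1 / sqrt (real n) * (x k * L k m) * W (i, m))"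
    using assms by (intro sum.cong refl) (simp add: design_def sum_distrib_left mult_ac)
  also have "\<dots> = (\<Sum>m<p. \<Sum>k<p. 1 / sqrt (real n) * (x k * L k m) * W (i, m))"
    by (rule sum.swap)
  also have "\<dots> = (\<Sum>m<p. (1 / sqrt (real n) * (\<Sum>k<p. x k * L k m)) * W (i, m))"
    by (intro sum.cong refl) (simp only: sum_distrib_left sum_distrib_right)
  finally show ?thesis .
qed

text \<open>The power is \<open>(1 + x) powr (- n / 2)\<close> with \<open>x\<close> close to
  \<open>(t - t\<^sup>2) * V\<close>. The second-order error of the logarithm costs at most
  \<open>n * x\<^sup>2\<close>, and the interference at most
  \<open>n * V * t\<^sup>2 * U / 2\<close>; each is at most 1, whence the summand 2.\<close>

lemma mgf_power_bound:
  fixes U V t :: real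
  assumes n: "0 < n" and V: "0 \<le> V" and U: "0 \<le> U" "U \<le> 1" and t: "0 \<le> t" "t \<le> 1"
    and VU: "real n * V * U \<le> 2" and V2: "(real n * V)\<^sup>2 \<le> real n" "V \<le> 1/2"
  shows "0 < 1 + V * (2 * ((t - t\<^sup>2) / 2) - t\<^sup>2 * U)"
    and "(1 / sqrt (1 + V * (2 * ((t - t\<^sup>2) / 2) - t\<^sup>2 * U))) ^ n \<le> exp (2 - (t - t\<^sup>2) / 2 * (real n * V))"
proof -
  define x where "x = V * (2 * ((t - t\<^sup>2) / 2) - t\<^sup>2 * U)"
  have t2: "0 \<le> t\<^sup>2" "t\<^sup>2 \<le> t" using t by (auto simp: power2_eq_square mult_left_le)
  have tU: "0 \<le> t\<^sup>2 * U" "t\<^sup>2 * U \<le> 1" "t\<^sup>2 * U \<le> U"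
    using t2 t U mult_mono[of "t\<^sup>2" 1 U 1] mult_right_mono[of "t\<^sup>2" 1 U] by auto
  have "\<bar>2 * ((t - t\<^sup>2) / 2) - t\<^sup>2 * U\<bar> \<le> 1"
  proof -
    have "2 * ((t - t\<^sup>2) / 2) - t\<^sup>2 * U = t - t\<^sup>2 - t\<^sup>2 * U" by simp
    moreover have "\<bar>t - t\<^sup>2 - t\<^sup>2 * U\<bar> \<le> 1"
      using t2 t tU by (intro abs_leI) (smt (verit))+
    ultimately show ?thesis by (simp only:)
  qed
  then have xV: "\<bar>x\<bar> \<le> V"
    using V mult_left_mono[of "\<bar>2 * ((t - t\<^sup>2) / 2) - t\<^sup>2 * U\<bar>" 1 V] by (simp add: x_def abs_mult)
  then have x: "\<bar>x\<bar> \<le> 1/2" using V2 by simp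
  then show pos: "0 < 1 + V * (2 * ((t - t\<^sup>2) / 2) - t\<^sup>2 * U)"
    unfolding x_def[symmetric] by auto
  have ln: "x - 2 * x\<^sup>2 \<le> ln (1 + x)"
    using abs_ln_one_plus_x_minus_x_bound[OF x] by (auto simp: abs_le_iff)
  have "x\<^sup>2 \<le> V\<^sup>2" using xV by (metis abs_ge_zero power2_abs power_mono)
  then have "real n * x\<^sup>2 \<le> real n * V\<^sup>2" by (intro mult_left_mono) auto
  also have "\<dots> \<le> 1" using V2(1) n by (simp add: power2_eq_square mult_ac)
  finally have nx: "real n * x\<^sup>2 \<le> 1" .
  have VtU: "real n * V * (t\<^sup>2 * U) \<le> 2"
  proof -
    have "real n * V * (t\<^sup>2 * U) \<le> real n * V * U" using tU V by (intro mult_left_mono) auto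
    with VU show ?thesis by simp
  qed
  have "(1 / sqrt (1 + x)) ^ n = exp (- (real n / 2) * ln (1 + x))"
  proof -
    have "1 / sqrt (1 + x) = exp (- (1/2) * ln (1 + x))"
      using pos unfolding x_def[symmetric] by (simp add: exp_minus ln_sqrt[symmetric] field_simps)
    then show ?thesis by (simp flip: exp_of_nat_mult)
  qed
  also have "\<dots> \<le> exp (2 - (t - t\<^sup>2) / 2 * (real n * V))"
  proof -
    have "- (real n / 2) * ln (1 + x) \<le> - (real n / 2) * (x - 2 * x\<^sup>2)"
      using ln by (intro mult_left_mono_neg) auto
    also have "\<dots> = real n * x\<^sup>2 - (t - t\<^sup>2) / 2 * (real n * V) + real n * V * (t\<^sup>2 * U) / 2"
      by (simp add: x_def field_simps)
    also have "\<dots> \<le> 2 - (t - t\<^sup>2) / 2 * (real n * V)" using nx VtU by simp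
    finally show ?thesis by simp
  qed
  finally show "(1 / sqrt (1 + V * (2 * ((t - t\<^sup>2) / 2) - t\<^sup>2 * U))) ^ n \<le> exp (2 - (t - t\<^sup>2) / 2 * (real n * V))"
    unfolding x_def .
qed

lemma linear_gram:
  assumes "\<And>j k. j < p \<Longrightarrow> k < p \<Longrightarrow> (\<Sum>m<p. L j m * L k m) = Sigma_mat \<rho> p j k"
  shows "(\<Sum>m<p. (a * (\<Sum>k<p. x k * L k m)) * (c * (\<Sum>k<p. y k * L k m))) = a * c * quad \<rho> p x y"
proof -
  have "(\<Sum>m<p. (a * (\<Sum>k<p. x k * L k m)) * (c * (\<Sum>k<p. y k * L k m)))
    = a * c * (\<Sum>m<p. (\<Sum>k<p. x k * L k m) * (\<Sum>k<p. y k * L k m))"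
    unfolding sum_distrib_left[of "a * c"] by (intro sum.cong refl) (simp add: mult_ac)
  also have "(\<Sum>m<p. (\<Sum>k<p. x k * L k m) * (\<Sum>k<p. y k * L k m)) = quad \<rho> p x y"
    using gram_quad[where I = "{..<p}" and X = "\<lambda>m k. L k m" and x = x and y = y] assms by simp
  finally show ?thesis .
qed

lemma quad_contrast_le:
  assumes "\<bar>\<rho>\<bar> \<le> 1" "A \<subseteq> block p j" "A' \<subseteq> block p j"
  shows "quad \<rho> p (contrast A A') (contrast A A') \<le> 4"
proof -
  have "(\<Sum>k<p. (contrast A A' k)\<^sup>2) \<le> (\<Sum>k<p. of_bool (k \<in> block p j))"
    using assms by (intro sum_mono) (auto simp: contrast_def)
  also have "\<dots> = real (card ({..<p} \<inter> block p j))"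
    by (simp add: of_bool_def sum.If_cases)
  also have "\<dots> \<le> 2"
    using card_mono[of "block p j" "{..<p} \<inter> block p j"] card_block_le[of p j] by simp
  finally show ?thesis
    using quad_le[OF assms(1), of p "contrast A A'"] by simp
qed

text \<open>Here \<open>S\<close> bounds the number of signals. With \<open>U\<close> and
  \<open>V\<close> the row variances of interference and scaled contrast,
  \<open>n * U \<le> 2 * \<tau>\<^sup>2 * S\<close> and
  \<open>n * V \<le> 4 * \<tau>\<^sup>2\<close>; then \<open>c1\<close> to \<open>c4\<close> yield
  in turn \<open>U \<le> 1\<close>, \<open>n * V * U \<le> 2\<close>,
  \<open>(n * V)\<^sup>2 \<le> n\<close> and \<open>V \<le> 1/2\<close>, as
  \<open>mgf_power_bound\<close> requires.\<close>

lemma rand_err_prob_upper: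
  fixes L :: "nat \<Rightarrow> nat \<Rightarrow> real"
  assumes h: "exponent_bound \<theta> r \<rho> h" and \<theta>: "0 \<le> \<theta>" and r: "0 \<le> r" and p: "1 \<le> p" and \<rho>: "\<bar>\<rho>\<bar> \<le> 1"
    and gram: "\<And>j k. j < p \<Longrightarrow> k < p \<Longrightarrow> (\<Sum>m<p. L j m * L k m) = Sigma_mat \<rho> p j k"
    and j: "j < p" and b: "\<And>k. k < p \<Longrightarrow> b k = 0 \<or> b k = tau r p"
    and n: "0 < n" and S: "(\<Sum>k<p. b k) \<le> tau r p * S"
    and c1: "2 * (tau r p)\<^sup>2 * S \<le> real n" and c2: "4 * (tau r p)\<^sup>2 * (2 * (tau r p)\<^sup>2 * S) \<le> 2 * real n"
    and c3: "(4 * (tau r p)\<^sup>2)\<^sup>2 \<le> real n" and c4: "8 * (tau r p)\<^sup>2 \<le> real n"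
  shows "(\<integral>\<^sup>+W. err_prob n p (design L n p W) (block_map \<theta> r n p (design L n p W)) j b \<partial>PiM ({..<n} \<times> {..<p}) (\<lambda>_. N01))
    \<le> ennreal (4 * exp 2 * exp ((\<theta> * real (card {k \<in> block p j. b k \<noteq> 0}) - h) * ln (real p)))"
proof -
  define A where "A = {k \<in> block p j. b k \<noteq> 0}"
  have A: "A \<subseteq> block p j" by (auto simp: A_def)
  let ?\<tau> = "tau r p" and ?W = "PiM ({..<n} \<times> {..<p}) (\<lambda>_. N01)"
  let ?E = "(\<theta> * real (card A) - h) * ln (real p)"
  let ?s = "1 / sqrt (real n)"
  have \<tau>0: "0 \<le> ?\<tau>" using r p by (simp add: tau_def)
  obtain t where t: "\<And>A'. 0 \<le> t A' \<and> t A' \<le> 1"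
    and le: "\<And>A'. A' \<in> Pow (block p j) - {A} \<Longrightarrow>
    - t A' * \<theta> * (real (card A') - real (card A)) * ln (real p)
      - (t A' - (t A')\<^sup>2) / 2 * (?\<tau>\<^sup>2 * quad \<rho> p (contrast A A') (contrast A A')) \<le> ?E"
    using exponent_choice[OF h \<theta> r p A] by blast
  define u where "u = (\<lambda>m. ?s * (\<Sum>k<p. off_block p j b k * L k m))"
  define v where "v = (\<lambda>A' m. (?\<tau> * ?s) * (\<Sum>k<p. contrast A A' k * L k m))"
  define U where "U = (\<Sum>m<p. (u m)\<^sup>2)"
  define V where "V = (\<lambda>A'. \<Sum>m<p. (v A' m)\<^sup>2)"
  let ?r = "\<lambda>A' W i. t A' * (\<Sum>m<p. u m * W (i, m)) * (\<Sum>m<p. v A' m * W (i, m))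
     - (t A' - (t A')\<^sup>2) / 2 * (\<Sum>m<p. v A' m * W (i, m))\<^sup>2"
  define K where "K = (\<lambda>A'. exp (- t A' * \<theta> * (real (card A') - real (card A)) * ln (real p)))"
  have s2: "?s * ?s = 1 / real n" by simp
  have Ueq: "U = quad \<rho> p (off_block p j b) (off_block p j b) / real n"
    unfolding U_def u_def power2_eq_square using linear_gram[OF gram, of ?s "off_block p j b" ?s "off_block p j b"] s2 by simp
  have Veq: "V A' = ?\<tau>\<^sup>2 * quad \<rho> p (contrast A A') (contrast A A') / real n" for A'
    unfolding V_def v_def power2_eq_square
    using linear_gram[OF gram, of "?\<tau> * ?s" "contrast A A'" "?\<tau> * ?s" "contrast A A'"] s2 by simp
  have orth: "(\<Sum>m<p. u m * v A' m) = 0" if "A' \<in> Pow (block p j)" for A'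
    unfolding u_def v_def
    using linear_gram[OF gram, of ?s "off_block p j b" "?\<tau> * ?s" "contrast A A'"] quad_off_block_contrast[OF A] that by simp
  have U0: "0 \<le> U" unfolding U_def by (intro sum_nonneg) simp
  have V0: "0 \<le> V A'" for A' unfolding V_def by (intro sum_nonneg) simp
  have "quad \<rho> p (off_block p j b) (off_block p j b) \<le> 2 * (\<Sum>k<p. (off_block p j b k)\<^sup>2)"
    by (rule quad_le[OF \<rho>])
  \<comment> \<open>Coefficients are 0 or \<tau>, so a square is \<tau> times the coefficient, and
    the sum of squares counts signals.\<close>
  also have "\<dots> \<le> 2 * (\<Sum>k<p. ?\<tau> * b k)"
    using b \<tau>0 by (intro mult_left_mono sum_mono) (fastforce simp: off_block_def power2_eq_square)+
  also have "\<dots> \<le> 2 * (?\<tau> * (?\<tau> * S))"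
    using S \<tau>0 by (intro mult_left_mono) (auto simp flip: sum_distrib_left intro: mult_left_mono)
  finally have nU: "real n * U \<le> 2 * ?\<tau>\<^sup>2 * S"
    using n by (simp add: Ueq power2_eq_square)
  have U1: "U \<le> 1"
    using nU c1 n by (metis mult.right_neutral mult_le_cancel_left_pos of_nat_0_less_iff order_trans)
  have nV: "real n * V A' \<le> 4 * ?\<tau>\<^sup>2" if "A' \<in> Pow (block p j)" for A'
    using quad_contrast_le[OF \<rho> A, of A'] that n mult_left_mono[of "quad \<rho> p (contrast A A') (contrast A A')" 4 "?\<tau>\<^sup>2"]
    by (simp add: Veq)
  have "err_prob n p (design L n p W) (block_map \<theta> r n p (design L n p W)) j b
     \<le> (\<Sum>A'\<in>Pow (block p j) - {A}. ennreal (K A') * ennreal (exp (\<Sum>i<n. ?r A' W i)))" for W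
  proof -
    have "err_prob n p (design L n p W) (block_map \<theta> r n p (design L n p W)) j b
     \<le> (\<Sum>A'\<in>Pow (block p j) - {A}. ennreal (exp (- t A' * \<theta> * (real (card A') - real (card A)) * ln (real p)
      + (\<Sum>i<n. t A' * (\<Sum>k<p. off_block p j b k * design L n p W (i, k)) * (?\<tau> * (\<Sum>k<p. contrast A A' k * design L n p W (i, k)))
         - (t A' - (t A')\<^sup>2) / 2 * (?\<tau> * (\<Sum>k<p. contrast A A' k * design L n p W (i, k)))\<^sup>2))))"
      using err_prob_block_map[OF j b A_def, of t n "design L n p W" \<theta>] t by blast
    also have "\<dots> = (\<Sum>A'\<in>Pow (block p j) - {A}. ennreal (K A' * exp (\<Sum>i<n. ?r A' W i)))"
    proof (intro sum.cong refl arg_cong[where f = ennreal])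
      fix A'
      have "(\<Sum>i<n. t A' * (\<Sum>k<p. off_block p j b k * design L n p W (i, k)) * (?\<tau> * (\<Sum>k<p. contrast A A' k * design L n p W (i, k)))
         - (t A' - (t A')\<^sup>2) / 2 * (?\<tau> * (\<Sum>k<p. contrast A A' k * design L n p W (i, k)))\<^sup>2) = (\<Sum>i<n. ?r A' W i)"
      proof (intro sum.cong refl)
        fix i assume "i \<in> {..<n}"
        then have i: "i < n" by simp
        have 1: "(\<Sum>k<p. off_block p j b k * design L n p W (i, k)) = (\<Sum>m<p. u m * W (i, m))"
          unfolding design_linear[OF i] u_def ..
        have 2: "?\<tau> * (\<Sum>k<p. contrast A A' k * design L n p W (i, k)) = (\<Sum>m<p. v A' m * W (i, m))"
          unfolding design_linear[OF i] v_def sum_distrib_left[of ?\<tau>] by (simp only: mult.assoc)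
        show "t A' * (\<Sum>k<p. off_block p j b k * design L n p W (i, k)) * (?\<tau> * (\<Sum>k<p. contrast A A' k * design L n p W (i, k)))
         - (t A' - (t A')\<^sup>2) / 2 * (?\<tau> * (\<Sum>k<p. contrast A A' k * design L n p W (i, k)))\<^sup>2 = ?r A' W i"
          unfolding 1 2 ..
      qed
      then show "exp (- t A' * \<theta> * (real (card A') - real (card A)) * ln (real p)
      + (\<Sum>i<n. t A' * (\<Sum>k<p. off_block p j b k * design L n p W (i, k)) * (?\<tau> * (\<Sum>k<p. contrast A A' k * design L n p W (i, k)))
         - (t A' - (t A')\<^sup>2) / 2 * (?\<tau> * (\<Sum>k<p. contrast A A' k * design L n p W (i, k)))\<^sup>2)) = K A' * exp (\<Sum>i<n. ?r A' W i)"
        unfolding K_def exp_add by (simp only:)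
    qed
    finally show ?thesis
      by (simp add: K_def ennreal_mult)
  qed
  then have "(\<integral>\<^sup>+W. err_prob n p (design L n p W) (block_map \<theta> r n p (design L n p W)) j b \<partial>?W)
     \<le> (\<integral>\<^sup>+W. (\<Sum>A'\<in>Pow (block p j) - {A}. ennreal (K A') * ennreal (exp (\<Sum>i<n. ?r A' W i))) \<partial>?W)"
    by (intro nn_integral_mono) simp
  also have "\<dots> = (\<Sum>A'\<in>Pow (block p j) - {A}. ennreal (K A') * (\<integral>\<^sup>+W. ennreal (exp (\<Sum>i<n. ?r A' W i)) \<partial>?W))"
    by (subst nn_integral_sum) (measurable, simp add: nn_integral_cmult)
  also have "\<dots> \<le> (\<Sum>A'\<in>Pow (block p j) - {A}. ennreal (exp 2 * exp ?E))"
  proof (rule sum_mono)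
    fix A' assume A': "A' \<in> Pow (block p j) - {A}"
    then have A'P: "A' \<in> Pow (block p j)" by simp
    let ?x = "1 + V A' * (2 * ((t A' - (t A')\<^sup>2) / 2) - (t A')\<^sup>2 * U)"
    have VU: "real n * V A' * U \<le> 2"
    proof -
      have "real n * (real n * V A' * U) = (real n * V A') * (real n * U)" by simp
      also have "\<dots> \<le> (4 * ?\<tau>\<^sup>2) * (2 * ?\<tau>\<^sup>2 * S)"
        using U0 by (intro mult_mono[OF nV[OF A'P] nU]) auto
      also have "\<dots> \<le> real n * 2" using c2 by simp
      finally show ?thesis using n by simp
    qed
    have V2: "(real n * V A')\<^sup>2 \<le> real n"
      using power_mono[OF nV[OF A'P], of 2] V0 c3 by simp
    have V3: "V A' \<le> 1/2"
    proof -
      have "real n * V A' \<le> real n * (1/2)" using nV[OF A'P] c4 by simp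
      then show ?thesis using n by (simp only: mult_le_cancel_left_pos of_nat_0_less_iff)
    qed
    note bound = mgf_power_bound[OF n V0 U0 U1 _ _ VU V2 V3, of "t A'"]
    have pos: "0 < ?x" using bound(1) t by blast
    have "(\<integral>\<^sup>+W. ennreal (exp (\<Sum>i<n. ?r A' W i)) \<partial>?W) = ennreal ((1 / sqrt ?x) ^ n)"
      by (rule gaussian_rows_mgf[OF orth[OF A'P] U_def _ pos]) (simp add: V_def)
    also have "\<dots> \<le> ennreal (exp (2 - (t A' - (t A')\<^sup>2) / 2 * (real n * V A')))"
      using bound(2) t by (intro ennreal_leI) blast
    finally have "ennreal (K A') * (\<integral>\<^sup>+W. ennreal (exp (\<Sum>i<n. ?r A' W i)) \<partial>?W)
       \<le> ennreal (K A') * ennreal (exp (2 - (t A' - (t A')\<^sup>2) / 2 * (real n * V A')))"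
      by (rule mult_left_mono) simp
    also have "\<dots> = ennreal (exp (2 + (- t A' * \<theta> * (real (card A') - real (card A)) * ln (real p) - (t A' - (t A')\<^sup>2) / 2 * (real n * V A'))))"
      unfolding K_def by (simp only: ennreal_mult[symmetric] exp_ge_zero exp_add[symmetric]) (simp add: algebra_simps)
    also have "\<dots> \<le> ennreal (exp (2 + ?E))"
    proof -
      have "real n * V A' = ?\<tau>\<^sup>2 * quad \<rho> p (contrast A A') (contrast A A')"
        using n by (simp add: Veq)
      then show ?thesis using le[OF A'] by (intro ennreal_leI) simp
    qed
    finally show "ennreal (K A') * (\<integral>\<^sup>+W. ennreal (exp (\<Sum>i<n. ?r A' W i)) \<partial>?W) \<le> ennreal (exp 2 * exp ?E)"
      by (simp add: exp_add)
  qed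
  also have "\<dots> \<le> ennreal (4 * exp 2 * exp ?E)"
    using card_competitors_le[of p j A]
    by (simp add: ennreal_of_nat_eq_real_of_nat mult_right_mono mult.assoc flip: ennreal_mult)
  finally show ?thesis unfolding A_def .
qed

text \<open>The reward \<open>p powr \<theta>\<close> for a signal exactly cancels its probability,
  so every coordinate in the block contributes a factor at most 2 and the block at most 4.\<close>

lemma block_support_mgf:
  assumes \<theta>: "0 \<le> \<theta>" and r: "0 < r" and p: "2 \<le> p" and j: "j < p" and c: "0 \<le> c"
  shows "(\<integral>\<^sup>+b. ennreal (c * exp ((\<theta> * real (card {k \<in> block p j. b k \<noteq> 0}) - h) * ln (real p)))
     \<partial>PiM {..<p} (\<lambda>_. beta_prior \<theta> r p)) \<le> ennreal (4 * c * real p powr (- h))"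
proof -
  let ?\<epsilon> = "real p powr (- \<theta>)"
  have p0: "0 < real p" using p by simp
  have \<tau>: "tau r p \<noteq> 0" using r p by (simp add: tau_def)
  \<comment> \<open>Distributes the exponential over the coordinates, so that the product structure
    of the prior applies.\<close>
  define g where "g = (\<lambda>k (x::real). if k \<in> block p j \<and> x \<noteq> 0 then ennreal (real p powr \<theta>) else 1 :: ennreal)"
  have mg: "g k \<in> borel_measurable borel" for k
    unfolding g_def by (cases "k \<in> block p j") auto
  have "ennreal (c * exp ((\<theta> * real (card {k \<in> block p j. b k \<noteq> 0}) - h) * ln (real p)))
     = ennreal (c * real p powr (- h)) * (\<Prod>k<p. g k (b k))" for b :: "nat \<Rightarrow> real"
  proof -
    have "(\<Prod>k<p. g k (b k)) = (\<Prod>k\<in>{k \<in> block p j. b k \<noteq> 0}. ennreal (real p powr \<theta>))"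
      unfolding g_def by (intro prod.mono_neutral_cong_right) (auto simp: block_def)
    also have "\<dots> = ennreal (real p powr (\<theta> * real (card {k \<in> block p j. b k \<noteq> 0})))"
      using p0 by (simp add: ennreal_power powr_powr[symmetric] powr_realpow)
    finally have "(\<Prod>k<p. g k (b k)) = ennreal (real p powr (\<theta> * real (card {k \<in> block p j. b k \<noteq> 0})))" .
    moreover have "exp ((\<theta> * real (card {k \<in> block p j. b k \<noteq> 0}) - h) * ln (real p))
      = real p powr (- h) * real p powr (\<theta> * real (card {k \<in> block p j. b k \<noteq> 0}))"
      using p0 by (simp add: powr_def left_diff_distrib flip: exp_add)
    ultimately show ?thesis
      using c by (simp flip: ennreal_mult add: mult.assoc)
  qed
  then have "(\<integral>\<^sup>+b. ennreal (c * exp ((\<theta> * real (card {k \<in> block p j. b k \<noteq> 0}) - h) * ln (real p)))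
     \<partial>PiM {..<p} (\<lambda>_. beta_prior \<theta> r p))
     = (\<integral>\<^sup>+b. ennreal (c * real p powr (- h)) * (\<Prod>k<p. g k (b k)) \<partial>PiM {..<p} (\<lambda>_. beta_prior \<theta> r p))"
    by simp
  also have "\<dots> = ennreal (c * real p powr (- h)) * (\<integral>\<^sup>+b. (\<Prod>k<p. g k (b k)) \<partial>PiM {..<p} (\<lambda>_. beta_prior \<theta> r p))"
  proof (rule nn_integral_cmult)
    have "(\<lambda>b. g k (b k)) \<in> borel_measurable (PiM {..<p} (\<lambda>_. beta_prior \<theta> r p))" if "k < p" for k
    proof -
      have "(\<lambda>b. b k) \<in> PiM {..<p} (\<lambda>_. beta_prior \<theta> r p) \<rightarrow>\<^sub>M borel"
        using measurable_component_singleton[of k "{..<p}" "\<lambda>_. beta_prior \<theta> r p"] that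
        unfolding measurable_cong_sets[OF refl sets_beta_prior] by simp
      from measurable_compose[OF this mg] show ?thesis .
    qed
    then show "(\<lambda>b. \<Prod>k<p. g k (b k)) \<in> borel_measurable (PiM {..<p} (\<lambda>_. beta_prior \<theta> r p))"
      by (intro borel_measurable_prod_ennreal) auto
  qed
  also have "(\<integral>\<^sup>+b. (\<Prod>k<p. g k (b k)) \<partial>PiM {..<p} (\<lambda>_. beta_prior \<theta> r p)) = (\<Prod>k<p. \<integral>\<^sup>+x. g k x \<partial>beta_prior \<theta> r p)"
    using mg by (intro betaP.product_nn_integral_prod) (auto simp: measurable_cong_sets[OF sets_beta_prior refl])
  also have "(\<Prod>k<p. \<integral>\<^sup>+x. g k x \<partial>beta_prior \<theta> r p) = (\<Prod>k\<in>block p j. 1 + ennreal (1 - ?\<epsilon>))"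
  proof (intro prod.mono_neutral_cong_right)
    have \<epsilon>: "0 \<le> ?\<epsilon>" "?\<epsilon> \<le> 1" by (rule powr_minus_in_unit[OF \<theta>])+
    have "ennreal ?\<epsilon> * ennreal (real p powr \<theta>) = 1"
      using p0 by (simp flip: ennreal_mult powr_add)
    then show "(\<integral>\<^sup>+x. g k x \<partial>beta_prior \<theta> r p) = 1 + ennreal (1 - ?\<epsilon>)" if "k \<in> block p j" for k
      unfolding nn_integral_beta_prior[OF mg \<theta>] using \<tau> that by (simp add: g_def)
    have "ennreal ?\<epsilon> + ennreal (1 - ?\<epsilon>) = 1"
      using \<epsilon> by (simp flip: ennreal_plus)
    then show "\<forall>k\<in>{..<p} - block p j. (\<integral>\<^sup>+x. g k x \<partial>beta_prior \<theta> r p) = 1"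
      unfolding nn_integral_beta_prior[OF mg \<theta>] by (simp add: g_def)
  qed (auto simp: block_def)
  also have "\<dots> \<le> 2 ^ card (block p j)"
  proof -
    have "1 + ennreal (1 - ?\<epsilon>) \<le> 1 + 1"
      using powr_minus_in_unit[OF \<theta>, of p] by (intro add_left_mono) simp
    then show ?thesis by (simp add: power_mono)
  qed
  also have "\<dots> \<le> (2 ^ 2 :: ennreal)"
    by (intro power_increasing card_block_le) simp
  finally have "(\<integral>\<^sup>+b. ennreal (c * exp ((\<theta> * real (card {k \<in> block p j. b k \<noteq> 0}) - h) * ln (real p)))
     \<partial>PiM {..<p} (\<lambda>_. beta_prior \<theta> r p)) \<le> ennreal (c * real p powr (- h)) * (2 ^ 2)"
    by (simp add: mult_left_mono)
  also have "\<dots> = ennreal (c * real p powr (- h)) * ennreal 4" by simp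
  also have "\<dots> = ennreal (4 * c * real p powr (- h))"
    using c by (subst ennreal_mult[symmetric]) (auto simp: mult_ac)
  finally show ?thesis .
qed

text \<open>Chernoff's bound for the number of signals with unit exponent: the exponential moment is
  \<open>(1 + \<epsilon> * (exp 1 - 1)) ^ p\<close> with
  \<open>\<epsilon> = p powr (- \<theta>)\<close>, and \<open>exp 1 - 1 \<le> 2\<close>.\<close>

lemma many_signals_prob:
  assumes \<theta>: "0 \<le> \<theta>" and r: "0 < r" and p: "2 \<le> p"
  shows "(\<integral>\<^sup>+b. (if tau r p * S < (\<Sum>k<p. b k) then 1 else 0) \<partial>PiM {..<p} (\<lambda>_. beta_prior \<theta> r p))
    \<le> ennreal (exp (2 * real p powr (1 - \<theta>) - S))"
proof -
  let ?\<epsilon> = "real p powr (- \<theta>)" and ?\<tau> = "tau r p"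
  have \<tau>: "0 < ?\<tau>" using r p by (simp add: tau_def)
  have \<epsilon>: "0 \<le> ?\<epsilon>" "?\<epsilon> \<le> 1" by (rule powr_minus_in_unit[OF \<theta>])+
  have "(\<integral>\<^sup>+b. (if ?\<tau> * S < (\<Sum>k<p. b k) then 1 else 0) \<partial>PiM {..<p} (\<lambda>_. beta_prior \<theta> r p))
     \<le> (\<integral>\<^sup>+b. ennreal (exp (- S)) * (\<Prod>k<p. ennreal (exp (b k / ?\<tau>))) \<partial>PiM {..<p} (\<lambda>_. beta_prior \<theta> r p))"
  proof (rule nn_integral_mono)
    fix b :: "nat \<Rightarrow> real"
    have "ennreal (exp (- S)) * (\<Prod>k<p. ennreal (exp (b k / ?\<tau>))) = ennreal (exp ((\<Sum>k<p. b k) / ?\<tau> - S))"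
    proof -
      have "(\<Prod>k<p. ennreal (exp (b k / ?\<tau>))) = ennreal (exp ((\<Sum>k<p. b k) / ?\<tau>))"
        by (simp add: prod_ennreal sum_divide_distrib exp_sum)
      then show ?thesis by (simp flip: ennreal_mult exp_add)
    qed
    moreover have "1 \<le> ennreal (exp ((\<Sum>k<p. b k) / ?\<tau> - S))" if "?\<tau> * S < (\<Sum>k<p. b k)"
    proof -
      have "0 \<le> (\<Sum>k<p. b k) / ?\<tau> - S" using that \<tau> by (simp add: field_simps)
      then show ?thesis by simp
    qed
    ultimately show "(if ?\<tau> * S < (\<Sum>k<p. b k) then 1 else 0) \<le> ennreal (exp (- S)) * (\<Prod>k<p. ennreal (exp (b k / ?\<tau>)))"
      by simp
  qed
  also have "\<dots> = ennreal (exp (- S)) * (\<integral>\<^sup>+b. (\<Prod>k<p. ennreal (exp (b k / ?\<tau>))) \<partial>PiM {..<p} (\<lambda>_. beta_prior \<theta> r p))"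
    by (rule nn_integral_cmult) measurable
  also have "(\<integral>\<^sup>+b. (\<Prod>k<p. ennreal (exp (b k / ?\<tau>))) \<partial>PiM {..<p} (\<lambda>_. beta_prior \<theta> r p))
     = (\<Prod>k<p. \<integral>\<^sup>+x. ennreal (exp (x / ?\<tau>)) \<partial>beta_prior \<theta> r p)"
    by (intro betaP.product_nn_integral_prod) auto
  also have "(\<integral>\<^sup>+x. ennreal (exp (x / ?\<tau>)) \<partial>beta_prior \<theta> r p) = ennreal (1 + ?\<epsilon> * (exp 1 - 1))"
    using \<tau> \<epsilon> \<theta> by (subst nn_integral_beta_prior) (auto simp: algebra_simps simp flip: ennreal_mult ennreal_plus)
  also have "(\<Prod>k<p. ennreal (1 + ?\<epsilon> * (exp 1 - 1))) = ennreal ((1 + ?\<epsilon> * (exp 1 - 1)) ^ p)"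
    unfolding prod_constant card_lessThan using \<epsilon> by (intro ennreal_power) (simp add: add_nonneg_nonneg)
  also have "ennreal (exp (- S)) * ennreal ((1 + ?\<epsilon> * (exp 1 - 1)) ^ p) \<le> ennreal (exp (- S)) * ennreal (exp (2 * real p powr (1 - \<theta>)))"
  proof (intro mult_left_mono ennreal_leI)
    have "1 + ?\<epsilon> * (exp 1 - 1) \<le> 1 + ?\<epsilon> * 2"
      using \<epsilon> exp_le by (intro add_left_mono mult_left_mono) auto
    also have "\<dots> \<le> exp (?\<epsilon> * 2)" by (rule exp_ge_add_one_self)
    finally have "(1 + ?\<epsilon> * (exp 1 - 1)) ^ p \<le> exp (?\<epsilon> * 2) ^ p"
      using \<epsilon> by (intro power_mono) auto
    also have "\<dots> = exp (2 * (real p * ?\<epsilon>))"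
      by (simp add: mult_ac flip: exp_of_nat_mult)
    also have "real p * ?\<epsilon> = real p powr (1 - \<theta>)"
      using p by (simp add: powr_diff powr_minus field_simps)
    finally show "(1 + ?\<epsilon> * (exp 1 - 1)) ^ p \<le> exp (2 * real p powr (1 - \<theta>))" .
  qed simp
  also have "\<dots> = ennreal (exp (2 * real p powr (1 - \<theta>) - S))"
    by (simp add: exp_diff exp_minus field_simps flip: ennreal_mult)
  finally show ?thesis .
qed

section \<open>Rate of the minimax risk\<close>

lemma ennreal_of_nat_mult_real: "0 \<le> x \<Longrightarrow> of_nat m * ennreal x = ennreal (real m * x)"
  by (simp add: ennreal_mult ennreal_of_nat_eq_real_of_nat)

lemma is_Lp_of_bounds:
  assumes upper: "\<forall>\<^sub>F p in sequentially. H p \<le> C * real p powr (1 - h)"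
    and lower: "\<And>\<epsilon>. 0 < \<epsilon> \<Longrightarrow> \<exists>c>0. \<forall>\<^sub>F p in sequentially. c * real p powr (1 - h - \<epsilon>) \<le> H p"
  shows "is_Lp (\<lambda>p. H p / real p powr (1 - h))"
  unfolding is_Lp_def
proof (intro allI impI conjI)
  fix \<epsilon> :: real assume \<epsilon>: "0 < \<epsilon>"
  obtain c where c: "0 < c" and ev: "\<forall>\<^sub>F p in sequentially. c * real p powr (1 - h - \<epsilon> / 2) \<le> H p"
    \<comment> \<open>Half of the allowance is spent on the lower bound; the other half remains as a
      diverging power.\<close>
    using lower[of "\<epsilon> / 2"] \<epsilon> by auto
  show "filterlim (\<lambda>p. H p / real p powr (1 - h) * real p powr \<epsilon>) at_top sequentially"
  proof (rule filterlim_at_top_mono)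
    show "filterlim (\<lambda>p. c * real p powr (\<epsilon> / 2)) at_top sequentially"
      using \<epsilon> c by real_asymp
    show "\<forall>\<^sub>F p in sequentially. c * real p powr (\<epsilon> / 2) \<le> H p / real p powr (1 - h) * real p powr \<epsilon>"
      using ev eventually_gt_at_top[of 0]
    proof eventually_elim
      case (elim p)
      have "c * real p powr (\<epsilon> / 2) = c * real p powr (1 - h - \<epsilon> / 2) / real p powr (1 - h) * real p powr \<epsilon>"
      proof -
        have "real p powr (1 - h - \<epsilon> / 2) / real p powr (1 - h) * real p powr \<epsilon> = real p powr (\<epsilon> / 2)"
          unfolding powr_diff[symmetric] powr_add[symmetric] by simp
        then show ?thesis by (metis mult.assoc times_divide_eq_right)
      qed
      also have "\<dots> \<le> H p / real p powr (1 - h) * real p powr \<epsilon>"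
        using elim by (intro mult_right_mono divide_right_mono) auto
      finally show ?case .
    qed
  qed
  show "(\<lambda>p. H p / real p powr (1 - h) * real p powr (- \<epsilon>)) \<longlonglongrightarrow> 0"
  proof (rule tendsto_sandwich)
    show "\<forall>\<^sub>F p in sequentially. 0 \<le> H p / real p powr (1 - h) * real p powr (- \<epsilon>)"
      using ev
    proof eventually_elim
      case (elim p)
      have "0 \<le> c * real p powr (1 - h - \<epsilon> / 2)" using c by simp
      with elim have "0 \<le> H p" by linarith
      then show ?case by simp
    qed
    show "\<forall>\<^sub>F p in sequentially. H p / real p powr (1 - h) * real p powr (- \<epsilon>) \<le> C * real p powr (- \<epsilon>)"
      using upper eventually_gt_at_top[of 0]
    proof eventually_elim
      case (elim p)
      then have "H p / real p powr (1 - h) \<le> C" by (simp add: field_simps)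
      then show ?case by (intro mult_right_mono) auto
    qed
    show "(\<lambda>p. C * real p powr (- \<epsilon>)) \<longlonglongrightarrow> 0" using \<epsilon> by real_asymp
  qed simp
qed

section \<open>Upper bounds for the minimax risk\<close>

lemma Hstar_det_le:
  assumes f: "f \<in> vec_space n \<rightarrow>\<^sub>M vec_space p"
  shows "Hstar_det \<theta> r X n p \<le> integral\<^sup>L (det_model \<theta> r n p) (\<lambda>(b, z). hamming p (f (response n p (\<lambda>(i, k). X i k) b z)) b)"
  unfolding Hstar_det_def using f
  by (intro cINF_lower bdd_belowI2[where m = 0]) (auto intro!: Bochner_Integration.integral_nonneg simp: hamming_nonneg case_prod_beta)

lemma Hstar_rand_le:
  assumes f: "f \<in> mat_space n p \<Otimes>\<^sub>M vec_space n \<rightarrow>\<^sub>M vec_space p"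
  shows "Hstar_rand \<theta> r L n p \<le> integral\<^sup>L (rand_model \<theta> r n p)
          (\<lambda>(W, b, z). let X = design L n p W in hamming p (f (X, response n p X b z)) b)"
  unfolding Hstar_rand_def using f
  by (intro cINF_lower bdd_belowI2[where m = 0]) (auto intro!: Bochner_Integration.integral_nonneg simp: hamming_nonneg Let_def case_prod_beta)

lemma const_in_vec_space: "(\<lambda>_. (\<lambda>_\<in>{..<p}. 0)) \<in> M \<rightarrow>\<^sub>M vec_space p"
  by (intro measurable_const) (auto simp: vec_space_def space_PiM)

lemma Hstar_det_upper:
  assumes h: "exponent_bound \<theta> r \<rho> h" and \<theta>: "0 \<le> \<theta>" and r: "0 < r" and p: "2 \<le> p"
    and gram: "\<And>j k. j < p \<Longrightarrow> k < p \<Longrightarrow> (\<Sum>i<n. X i j * X i k) = Sigma_mat \<rho> p j k"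
  shows "Hstar_det \<theta> r X n p \<le> 16 * real p powr (1 - h)"
proof -
  let ?X = "\<lambda>(i, k). X i k" and ?B = "PiM {..<p} (\<lambda>_. beta_prior \<theta> r p)"
  let ?f = "block_map \<theta> r n p ?X"
  \<comment> \<open>Measurability is available only for extensional designs; the truncated design
    gives the same scores on subsets of blocks.\<close>
  define X' where "X' = restrict ?X ({..<n} \<times> {..<p})"
  have "X' \<in> space (mat_space n p)"
    by (simp add: X'_def mat_space_def space_PiM)
  then have "(\<lambda>y. block_map \<theta> r n p X' y) \<in> vec_space n \<rightarrow>\<^sub>M vec_space p"
    by (intro measurable_block_map measurable_const) auto
  moreover have "block_map \<theta> r n p X' = ?f"
  proof -
    have "(\<Sum>k\<in>A. X' (i, k)) = (\<Sum>k\<in>A. ?X (i, k))" if "A \<in> Pow (block p j)" "i < n" for A i j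
      using that by (intro sum.cong) (auto simp: X'_def block_def)
    then have "score \<theta> r n p X' y A = score \<theta> r n p ?X y A" if "A \<in> Pow (block p j)" for A y j
      using that unfolding score_def by (intro arg_cong2[where f = "(-)"] arg_cong2[where f = "(/)"] sum.cong refl) auto
    note score = this
    show ?thesis
    proof (intro ext)
      fix y j
      show "block_map \<theta> r n p X' y j = ?f y j"
        unfolding block_map_def restrict_apply
        by (intro if_cong bex_cong ball_cong conj_cong imp_cong refl) (simp only: score[of _ j])
    qed
  qed
  ultimately have f: "?f \<in> vec_space n \<rightarrow>\<^sub>M vec_space p" by simp
  have "ennreal (integral\<^sup>L (det_model \<theta> r n p) (\<lambda>(b, z). hamming p (?f (response n p ?X b z)) b))
     = (\<Sum>j<p. \<integral>\<^sup>+b. err_prob n p ?X ?f j b \<partial>?B)"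
    by (rule det_risk_eq[OF f])
  also have "\<dots> \<le> (\<Sum>j<p. ennreal (16 * real p powr (- h)))"
  proof (rule sum_mono)
    fix j assume "j \<in> {..<p}"
    then have j: "j < p" by simp
    have "(\<integral>\<^sup>+b. err_prob n p ?X ?f j b \<partial>?B)
      \<le> (\<integral>\<^sup>+b. ennreal (4 * exp ((\<theta> * real (card {k \<in> block p j. b k \<noteq> 0}) - h) * ln (real p))) \<partial>?B)"
    proof (rule nn_integral_mono_AE)
      show "AE b in ?B. err_prob n p ?X ?f j b \<le> ennreal (4 * exp ((\<theta> * real (card {k \<in> block p j. b k \<noteq> 0}) - h) * ln (real p)))"
        using AE_beta_prior
      proof (rule AE_mp, intro AE_I2 impI)
        fix b assume "\<forall>k<p. b k = 0 \<or> b k = tau r p"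
        then show "err_prob n p ?X ?f j b \<le> ennreal (4 * exp ((\<theta> * real (card {k \<in> block p j. b k \<noteq> 0}) - h) * ln (real p)))"
          using p r by (intro det_err_prob_upper[OF h \<theta> _ _ gram j]) auto
      qed
    qed
    \<comment> \<open>One factor 4 counts the competitors, the other comes from averaging over the
      support in the block.\<close>
    also have "\<dots> \<le> ennreal (4 * 4 * real p powr (- h))"
      by (rule block_support_mgf[OF \<theta> r p j]) simp
    finally show "(\<integral>\<^sup>+b. err_prob n p ?X ?f j b \<partial>?B) \<le> ennreal (16 * real p powr (- h))" by simp
  qed
  also have "\<dots> = ennreal (16 * real p powr (1 - h))"
  proof -
    have "real p * (16 * real p powr (- h)) = 16 * real p powr (1 - h)"
      using p by (simp add: powr_diff powr_minus field_simps)
    then show ?thesis by (simp add: ennreal_of_nat_mult_real)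
  qed
  finally show ?thesis
    using Hstar_det_le[OF f, of \<theta> r X] by (simp add: ennreal_le_iff)
qed

lemma Hstar_rand_upper:
  assumes h: "exponent_bound \<theta> r \<rho> h" and \<theta>: "0 \<le> \<theta>" and r: "0 < r" and p: "2 \<le> p" and \<rho>: "\<bar>\<rho>\<bar> \<le> 1"
    and gram: "\<And>j k. j < p \<Longrightarrow> k < p \<Longrightarrow> (\<Sum>m<p. L j m * L k m) = Sigma_mat \<rho> p j k"
    and n: "0 < n"
    and c1: "2 * (tau r p)\<^sup>2 * S \<le> real n" and c2: "4 * (tau r p)\<^sup>2 * (2 * (tau r p)\<^sup>2 * S) \<le> 2 * real n"
    and c3: "(4 * (tau r p)\<^sup>2)\<^sup>2 \<le> real n" and c4: "8 * (tau r p)\<^sup>2 \<le> real n"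
    and c5: "exp (2 * real p powr (1 - \<theta>) - S) \<le> real p powr (- h)"
  shows "Hstar_rand \<theta> r L n p \<le> (16 * exp 2 + 1) * real p powr (1 - h)"
proof -
  let ?W = "PiM ({..<n} \<times> {..<p}) (\<lambda>_. N01)" and ?B = "PiM {..<p} (\<lambda>_. beta_prior \<theta> r p)"
  let ?f = "\<lambda>(X, y). block_map \<theta> r n p X y"
  interpret W: prob_space ?W by (rule prob_space_PiM_N01)
  interpret B: prob_space ?B by (rule prob_space_PiM_beta)
  interpret BW: pair_sigma_finite ?B ?W
    by (intro pair_sigma_finite.intro B.sigma_finite_measure_axioms W.sigma_finite_measure_axioms)
  have f: "?f \<in> mat_space n p \<Otimes>\<^sub>M vec_space n \<rightarrow>\<^sub>M vec_space p"
    unfolding case_prod_beta' by (intro measurable_block_map) auto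
  let ?e = "\<lambda>j W b. err_prob n p (design L n p W) (block_map \<theta> r n p (design L n p W)) j b"
  have "ennreal (integral\<^sup>L (rand_model \<theta> r n p)
          (\<lambda>(W, b, z). let X = design L n p W in hamming p (?f (X, response n p X b z)) b))
    = (\<Sum>j<p. \<integral>\<^sup>+W. \<integral>\<^sup>+b. ?e j W b \<partial>?B \<partial>?W)"
    using rand_risk_eq(1)[OF f, of \<theta> r L] by (simp only: case_prod_conv)
  also have "\<dots> \<le> (\<Sum>j<p. ennreal ((16 * exp 2 + 1) * real p powr (- h)))"
  proof (rule sum_mono)
    fix j assume "j \<in> {..<p}"
    then have j: "j < p" by simp
    \<comment> \<open>With more than \<open>S\<close> signals the interference is not controlled,
      and the error probability is bounded by 1; \<open>c5\<close> makes this event at most as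
      likely as \<open>p powr (- h)\<close>.\<close>
    let ?bad = "\<lambda>b. if tau r p * S < (\<Sum>k<p. b k) then 1 else 0 :: ennreal"
    let ?bd = "\<lambda>b. ennreal (4 * exp 2 * exp ((\<theta> * real (card {k \<in> block p j. b k \<noteq> (0::real)}) - h) * ln (real p)))"
    have m: "(\<lambda>(W, b). ?e j W b) \<in> borel_measurable (?W \<Otimes>\<^sub>M ?B)"
      using rand_risk_eq(2)[OF f j, of L \<theta> r] by (simp only: case_prod_conv)
    have "(\<integral>\<^sup>+W. \<integral>\<^sup>+b. ?e j W b \<partial>?B \<partial>?W) = (\<integral>\<^sup>+b. \<integral>\<^sup>+W. ?e j W b \<partial>?W \<partial>?B)"
    proof -
      have "(\<lambda>(b, W). ?e j W b) \<in> borel_measurable (?B \<Otimes>\<^sub>M ?W)"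
        using measurable_pair_swap[OF m] by (simp add: case_prod_beta')
      then show ?thesis by (rule BW.Fubini')
    qed
    also have "\<dots> \<le> (\<integral>\<^sup>+b. ?bad b + ?bd b \<partial>?B)"
    proof (rule nn_integral_mono_AE)
      show "AE b in ?B. (\<integral>\<^sup>+W. ?e j W b \<partial>?W) \<le> ?bad b + ?bd b"
        using AE_beta_prior
      proof (rule AE_mp, intro AE_I2 impI)
        fix b assume b: "\<forall>k<p. b k = 0 \<or> b k = tau r p"
        show "(\<integral>\<^sup>+W. ?e j W b \<partial>?W) \<le> ?bad b + ?bd b"
        proof (cases "tau r p * S < (\<Sum>k<p. b k)")
          case True
          have "(\<integral>\<^sup>+W. ?e j W b \<partial>?W) \<le> (\<integral>\<^sup>+W. 1 \<partial>?W)"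
            by (intro nn_integral_mono err_prob_le_1)
          also have "\<dots> \<le> ?bad b + ?bd b" using True by (simp add: W.emeasure_space_1)
          finally show ?thesis .
        next
          case False
          have "(\<integral>\<^sup>+W. ?e j W b \<partial>?W) \<le> ?bd b"
            using b r p False
            by (intro rand_err_prob_upper[OF h \<theta> _ _ \<rho> gram j _ n _ c1 c2 c3 c4]) auto
          with False show ?thesis by simp
        qed
      qed
    qed
    also have "\<dots> = (\<integral>\<^sup>+b. ?bad b \<partial>?B) + (\<integral>\<^sup>+b. ?bd b \<partial>?B)"
    proof (rule nn_integral_add)
      have "Measurable.pred ?B (\<lambda>b. b k \<noteq> 0)" if "k \<in> block p j" for k
        using that by (intro pred_nonzero) (auto simp: block_def intro!: measurable_component_singleton
            simp flip: measurable_cong_sets[OF refl sets_beta_prior[of \<theta> r p]])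
      then have "(\<lambda>b. \<Sum>k\<in>block p j. if b k \<noteq> 0 then 1 else 0 :: real) \<in> borel_measurable ?B"
        by (intro borel_measurable_sum measurable_If) (auto simp: pred_def)
      moreover have "(\<lambda>b. \<Sum>k\<in>block p j. if b k \<noteq> 0 then 1 else 0 :: real) = (\<lambda>b. real (card {k \<in> block p j. b k \<noteq> (0::real)}))"
        by (intro ext) (simp add: sum.If_cases Int_def)
      ultimately have [measurable]: "(\<lambda>b. real (card {k \<in> block p j. b k \<noteq> (0::real)})) \<in> borel_measurable ?B"
        by simp
      show "?bd \<in> borel_measurable ?B" by measurable
      show "?bad \<in> borel_measurable ?B" by measurable
    qed
    also have "\<dots> \<le> ennreal (exp (2 * real p powr (1 - \<theta>) - S)) + ennreal (4 * (4 * exp 2) * real p powr (- h))"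
      by (intro add_mono many_signals_prob[OF \<theta> r p] block_support_mgf[OF \<theta> r p j]) simp
    also have "\<dots> \<le> ennreal (real p powr (- h)) + ennreal (4 * (4 * exp 2) * real p powr (- h))"
      using c5 by (intro add_right_mono ennreal_leI)
    also have "\<dots> = ennreal ((16 * exp 2 + 1) * real p powr (- h))"
      by (subst ennreal_plus[symmetric]) (auto simp: algebra_simps)
    finally show "(\<integral>\<^sup>+W. \<integral>\<^sup>+b. ?e j W b \<partial>?B \<partial>?W) \<le> ennreal ((16 * exp 2 + 1) * real p powr (- h))" .
  qed
  also have "\<dots> = ennreal ((16 * exp 2 + 1) * real p powr (1 - h))"
  proof -
    have "real p * ((16 * exp 2 + 1) * real p powr (- h)) = (16 * exp 2 + 1) * real p powr (1 - h)"
      using p by (simp add: powr_diff powr_minus field_simps)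
    then show ?thesis by (simp add: ennreal_of_nat_mult_real add_nonneg_nonneg)
  qed
  finally have "integral\<^sup>L (rand_model \<theta> r n p)
          (\<lambda>(W, b, z). let X = design L n p W in hamming p (?f (X, response n p X b z)) b)
    \<le> (16 * exp 2 + 1) * real p powr (1 - h)"
    by (subst (asm) ennreal_le_iff) (auto intro!: add_nonneg_nonneg)
  with Hstar_rand_le[OF f, of \<theta> r L] show ?thesis by linarith
qed

section \<open>Lower bounds for the minimax risk\<close>

lemma quad_two_point:
  assumes "Suc (2 * c) < p"
  shows "quad \<rho> p (\<lambda>k. if k = 2 * c then 1 else if k = Suc (2 * c) then a else 0)
      (\<lambda>k. if k = 2 * c then 1 else if k = Suc (2 * c) then a else 0) = 1 + 2 * \<rho> * a + a\<^sup>2"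
  using assms by (subst quad_block[where c = c]) (auto simp: block_def split: if_splits)

lemma sum_two_point:
  assumes "Suc j < p"
  shows "(\<Sum>k<p. (if k = j then 1 else if k = Suc j then a else 0) * x k) = x j + a * (x (Suc j) :: real)"
proof -
  have "(\<Sum>k<p. (if k = j then 1 else if k = Suc j then a else 0) * x k)
     = (\<Sum>k\<in>{j, Suc j}. (if k = j then 1 else if k = Suc j then a else 0) * x k)"
    using assms by (intro sum.mono_neutral_right) auto
  then show ?thesis by simp
qed

text \<open>In units of \<open>\<tau>\<^sup>2\<close>, the squared distance of the hypotheses of \<open>err_prob_lower\<close>.\<close>

definition pair_dist :: "real \<Rightarrow> bool \<Rightarrow> bool \<Rightarrow> real" where
  "pair_dist \<rho> s s' = 1 + 2 * \<rho> * (of_bool s' - of_bool s) + (of_bool s' - of_bool s)\<^sup>2"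

lemma pair_dist_bounds:
  assumes "-1 < \<rho>" "\<rho> < 1"
  shows "0 < pair_dist \<rho> s s'" "pair_dist \<rho> s s' \<le> 4"
  using assms by (auto simp: pair_dist_def)

text \<open>At squared distance \<open>\<tau>\<^sup>2 * pair_dist \<rho> s s'\<close>, prior weight
  times Gaussian factor is \<open>p\<close> to minus each of the two left sides, up to subpolynomial
  factors. The summand 1 accounts for the signal at coordinate \<open>j\<close> in the second
  hypothesis.\<close>

definition exponent_attained :: "real \<Rightarrow> real \<Rightarrow> real \<Rightarrow> real \<Rightarrow> bool \<Rightarrow> bool \<Rightarrow> real \<Rightarrow> bool" where
  "exponent_attained \<theta> r \<rho> h s s' t \<longleftrightarrow> 0 \<le> t \<and> t \<le> 1 \<and>
     \<theta> * of_bool s + t\<^sup>2 * (r * pair_dist \<rho> s s') \<le> h \<and>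
     \<theta> * (1 + of_bool s') + (1 - t)\<^sup>2 * (r * pair_dist \<rho> s s') \<le> h"

text \<open>\<open>h\<close> is the least of three saddle values. Being below all three gives the
  bound, and the pair realising the minimum attains it. Strict inequalities for \<rho> keep the
  squared distances positive.\<close>

lemma optimal_exponent_exists:
  assumes "0 < \<theta>" "0 < r" "-1 < \<rho>" "\<rho> < 1"
  obtains h s s' t where "exponent_bound \<theta> r \<rho> h" "exponent_attained \<theta> r \<rho> h s s' t"
proof -
  define E where "E = (\<lambda>a a' D t. (1 - t) * a + t * a' + t * (1 - t) * (D::real))"
  have saddle: "\<exists>t. 0 \<le> t \<and> t \<le> 1 \<and> a + t\<^sup>2 * D \<le> E a a' D t \<and> a' + (1 - t)\<^sup>2 * D \<le> E a a' D t"
    if "a \<le> a'" "0 < D" for a a' D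
    unfolding E_def using that by (rule chernoff_saddle_point)
  have "0 < r * (2 + 2 * \<rho>)" "0 < r * (2 - 2 * \<rho>)"
    using assms by auto
  then obtain t1 t2 t3
    where t1: "0 \<le> t1" "t1 \<le> 1" "0 + t1\<^sup>2 * r \<le> E 0 \<theta> r t1" "\<theta> + (1 - t1)\<^sup>2 * r \<le> E 0 \<theta> r t1"
      and t2: "0 \<le> t2" "t2 \<le> 1" "0 + t2\<^sup>2 * (r * (2 + 2 * \<rho>)) \<le> E 0 (2 * \<theta>) (r * (2 + 2 * \<rho>)) t2"
        "2 * \<theta> + (1 - t2)\<^sup>2 * (r * (2 + 2 * \<rho>)) \<le> E 0 (2 * \<theta>) (r * (2 + 2 * \<rho>)) t2"
      and t3: "0 \<le> t3" "t3 \<le> 1" "\<theta> + t3\<^sup>2 * (r * (2 - 2 * \<rho>)) \<le> E \<theta> \<theta> (r * (2 - 2 * \<rho>)) t3"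
        "\<theta> + (1 - t3)\<^sup>2 * (r * (2 - 2 * \<rho>)) \<le> E \<theta> \<theta> (r * (2 - 2 * \<rho>)) t3"
    using saddle[of 0 \<theta> r] saddle[of 0 "2 * \<theta>" "r * (2 + 2 * \<rho>)"] saddle[of \<theta> \<theta> "r * (2 - 2 * \<rho>)"] assms
    by auto
  define h1 where "h1 = E 0 \<theta> r t1"
  define h2 where "h2 = E 0 (2 * \<theta>) (r * (2 + 2 * \<rho>)) t2"
  define h3 where "h3 = E \<theta> \<theta> (r * (2 - 2 * \<rho>)) t3"
  define h where "h = min h1 (min h2 h3)"
  have bound: "exponent_bound \<theta> r \<rho> h"
    unfolding exponent_bound_def
  proof (intro conjI)
    have hs: "h \<le> h1" "h \<le> h2" "h \<le> h3" by (auto simp: h_def)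
    show "\<exists>t. 0 \<le> t \<and> t \<le> 1 \<and> h \<le> t * \<theta> + t * (1 - t) * r"
      "\<exists>t. 0 \<le> t \<and> t \<le> 1 \<and> h \<le> t * (2 * \<theta>) + t * (1 - t) * (r * (2 + 2 * \<rho>))"
      "\<exists>t. 0 \<le> t \<and> t \<le> 1 \<and> h \<le> \<theta> + t * (1 - t) * (r * (2 - 2 * \<rho>))"
      subgoal by (intro exI[of _ t1]) (use t1 hs(1) in \<open>simp add: h1_def E_def\<close>)
      subgoal by (intro exI[of _ t2]) (use t2 hs(2) in \<open>simp add: h2_def E_def\<close>)
      subgoal by (intro exI[of _ t3]) (use t3 hs(3) in \<open>simp add: h3_def E_def algebra_simps\<close>)
      done
  qed
  have "h = h1 \<or> h = h2 \<or> h = h3" by (simp add: h_def min_def)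
  then consider "h = h1" | "h = h2" | "h = h3" by blast
  then show ?thesis
  proof cases
    case 1
    \<comment> \<open>In the three cases the supports compared are {} and {j}, then {} and {j, j+1},
      then {j+1} and {j}.\<close>
    then have "exponent_attained \<theta> r \<rho> h False False t1"
      using t1 by (simp add: exponent_attained_def pair_dist_def h1_def)
    with bound show ?thesis by (rule that)
  next
    case 2
    then have "exponent_attained \<theta> r \<rho> h False True t2"
      using t2 by (simp add: exponent_attained_def pair_dist_def h2_def)
    with bound show ?thesis by (rule that)
  next
    case 3
    then have "exponent_attained \<theta> r \<rho> h True False t3"
      using t3 by (simp add: exponent_attained_def pair_dist_def h3_def)
    with bound show ?thesis by (rule that)
  qed
qed

text \<open>A relative excess \<delta> of the squared distance costs at most
  \<open>4 * \<delta> * r\<close> in the exponent because \<open>pair_dist\<close> is at most 4. The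
  constant 3/16 is the 3/4 of the testing bound times two factors 1/2, for the prior weight at
  \<open>j + 1\<close> and for \<open>1 - \<epsilon>\<close>.\<close>

lemma err_prob_lower_powr:
  fixes X :: "nat \<times> nat \<Rightarrow> real"
  assumes att: "exponent_attained \<theta> r \<rho> h s s' t" and \<rho>: "-1 < \<rho>" "\<rho> < 1"
    and \<theta>: "0 \<le> \<theta>" and r: "0 < r" and p: "2 \<le> p" and half: "real p powr (- \<theta>) \<le> 1 / 2"
    and f: "f \<in> vec_space n \<rightarrow>\<^sub>M vec_space p" and j: "Suc j < p" and \<delta>: "0 \<le> \<delta>" "\<delta> \<le> 1"
    and D: "(\<Sum>i<n. (tau r p * (X (i, j) + (of_bool s' - of_bool s) * X (i, Suc j)))\<^sup>2)
      \<le> (1 + \<delta>) * ((tau r p)\<^sup>2 * pair_dist \<rho> s s')"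
  shows "ennreal (3/16 * exp (- 6 * tau r p) * real p powr (- h - 4 * \<delta> * r))
    \<le> (\<integral>\<^sup>+b. err_prob n p X f j b \<partial>PiM {..<p} (\<lambda>_. beta_prior \<theta> r p))"
proof -
  define D where "D = (\<Sum>i<n. (tau r p * (X (i, j) + (of_bool s' - of_bool s) * X (i, Suc j)))\<^sup>2)"
  define Q where "Q = pair_dist \<rho> s s'"
  define \<epsilon> where "\<epsilon> = real p powr (- \<theta>)"
  define m where "m = 1/4 * exp (- 6 * tau r p) * real p powr (- h - 4 * \<delta> * r)"
  have Q: "0 < Q" "Q \<le> 4" using pair_dist_bounds[OF \<rho>] by (auto simp: Q_def)
  have t: "0 \<le> t" "t \<le> 1" and att1: "\<theta> * of_bool s + t\<^sup>2 * (r * Q) \<le> h"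
    and att2: "\<theta> * (1 + of_bool s') + (1 - t)\<^sup>2 * (r * Q) \<le> h"
    using att by (auto simp: exponent_attained_def Q_def)
  have p0: "0 < real p" "1 < real p" using p by auto
  have ln: "0 < ln (real p)" using p0 by simp
  have \<tau>: "0 < tau r p" using r p by (simp add: tau_def)
  have \<tau>2: "(tau r p)\<^sup>2 = 2 * r * ln (real p)" using r p by (intro tau_squared) auto
  have D0: "0 \<le> D" unfolding D_def by (intro sum_nonneg) simp
  have DQ: "D \<le> (1 + \<delta>) * ((tau r p)\<^sup>2 * Q)" using D by (simp add: D_def Q_def)
  \<comment> \<open>The distance satisfies \<open>D \<le> 8 * \<tau>\<^sup>2\<close>; rounding 8 up
    to the square 9 yields the factor \<open>exp (- 6 * tau r p)\<close>.\<close>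
  have "sqrt D \<le> 3 * tau r p"
  proof -
    have "(1 + \<delta>) * ((tau r p)\<^sup>2 * Q) \<le> 2 * ((tau r p)\<^sup>2 * 4)"
      using Q \<delta> by (intro mult_mono) auto
    with DQ have "D \<le> 8 * (tau r p)\<^sup>2" by simp
    also have "\<dots> \<le> (3 * tau r p)\<^sup>2" by (simp add: power_mult_distrib)
    finally show ?thesis using \<tau> by (intro real_le_lsqrt) auto
  qed
  then have sq: "- 6 * tau r p \<le> - 2 * sqrt D" by simp
  have key: "exp (- 6 * tau r p) * real p powr (- h - 4 * \<delta> * r)
      \<le> real p powr (- a) * exp (- 2 * sqrt D - u\<^sup>2 * D / 2)"
    if u: "0 \<le> u" "u \<le> 1" and au: "a + u\<^sup>2 * (r * Q) \<le> h" for a u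
  proof -
    have u2: "0 \<le> u\<^sup>2" "u\<^sup>2 \<le> 1" using u by (auto simp: power_le_one)
    have "u\<^sup>2 * D / 2 \<le> u\<^sup>2 * ((1 + \<delta>) * ((tau r p)\<^sup>2 * Q)) / 2"
      using DQ u2 by (intro divide_right_mono mult_left_mono) auto
    also have "\<dots> = (u\<^sup>2 * (r * Q) + u\<^sup>2 * \<delta> * r * Q) * ln (real p)"
      unfolding \<tau>2 by (simp add: algebra_simps)
    also have "\<dots> \<le> ((h - a) + 4 * \<delta> * r) * ln (real p)"
    proof (intro mult_right_mono add_mono)
      have "u\<^sup>2 * \<delta> * r * Q \<le> 1 * \<delta> * r * 4"
        using u2 \<delta> r Q by (intro mult_mono) auto
      then show "u\<^sup>2 * \<delta> * r * Q \<le> 4 * \<delta> * r" by simp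
    qed (use au ln in auto)
    finally have "- 6 * tau r p + (- h - 4 * \<delta> * r) * ln (real p)
      \<le> - a * ln (real p) + (- 2 * sqrt D - u\<^sup>2 * D / 2)"
      using sq by (simp add: algebra_simps)
    then show ?thesis
      using p0 by (simp add: powr_def flip: exp_add)
  qed
  have w: "real p powr (- (\<theta> * of_bool s)) / 2 \<le> (if s then \<epsilon> else 1 - \<epsilon>)" for s
    using half p0 by (auto simp: \<epsilon>_def)
  have \<epsilon>: "0 \<le> \<epsilon>" "\<epsilon> \<le> 1 / 2" using half by (auto simp: \<epsilon>_def)
  have "ennreal (3/4 * m) \<le> (\<integral>\<^sup>+b. err_prob n p X f j b \<partial>PiM {..<p} (\<lambda>_. beta_prior \<theta> r p))"
  proof (rule err_prob_lower[OF f j \<theta> _ t \<epsilon>_def D_def])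
    show "tau r p \<noteq> 0" using \<tau> by simp
    show "0 \<le> m" by (simp add: m_def)
    have "m = (1/4) * (exp (- 6 * tau r p) * real p powr (- h - 4 * \<delta> * r))" by (simp add: m_def)
    also have "\<dots> \<le> (1/4) * (real p powr (- (\<theta> * of_bool s)) * exp (- 2 * sqrt D - t\<^sup>2 * D / 2))"
      by (intro mult_left_mono key t att1) auto
    also have "\<dots> = real p powr (- (\<theta> * of_bool s)) / 2 * (1/2) * exp (- 2 * sqrt D - t\<^sup>2 * D / 2)"
      by simp
    also have "\<dots> \<le> (if s then \<epsilon> else 1 - \<epsilon>) * (1 - \<epsilon>) * exp (- 2 * sqrt D - t\<^sup>2 * D / 2)"
      using \<epsilon> w by (intro mult_mono mult_nonneg_nonneg) auto
    finally show "m \<le> (if s then \<epsilon> else 1 - \<epsilon>) * (1 - \<epsilon>) * exp (- 2 * sqrt D - t\<^sup>2 * D / 2)" .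
    have "m \<le> (1/2) * (exp (- 6 * tau r p) * real p powr (- h - 4 * \<delta> * r))" by (simp add: m_def)
    also have "\<dots> \<le> (1/2) * (real p powr (- (\<theta> * (1 + of_bool s'))) * exp (- 2 * sqrt D - (1 - t)\<^sup>2 * D / 2))"
      using t by (intro mult_left_mono key att2) auto
    also have "\<dots> = real p powr (- (\<theta> * of_bool s')) / 2 * \<epsilon> * exp (- 2 * sqrt D - (1 - t)\<^sup>2 * D / 2)"
    proof -
      have "real p powr (- (\<theta> * (1 + of_bool s'))) = real p powr (- (\<theta> * of_bool s')) * \<epsilon>"
        unfolding \<epsilon>_def powr_add[symmetric] by (simp add: algebra_simps)
      then show ?thesis by simp
    qed
    also have "\<dots> \<le> (if s' then \<epsilon> else 1 - \<epsilon>) * \<epsilon> * exp (- 2 * sqrt D - (1 - t)\<^sup>2 * D / 2)"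
      using \<epsilon> w by (intro mult_mono mult_nonneg_nonneg) auto
    finally show "m \<le> (if s' then \<epsilon> else 1 - \<epsilon>) * \<epsilon> * exp (- 2 * sqrt D - (1 - t)\<^sup>2 * D / 2)" .
  qed
  then show ?thesis by (simp add: m_def mult.assoc)
qed

text \<open>The two-point bound is used at the first coordinate of each complete block. There are
  \<open>p div 2\<close> of these, at least \<open>p / 4\<close> once
  \<open>p \<ge> 2\<close>.\<close>

lemma sum_even_coordinates_ge:
  fixes g :: "nat \<Rightarrow> ennreal"
  assumes p: "2 \<le> p" and v: "0 \<le> v" and g: "\<And>c. Suc (2 * c) < p \<Longrightarrow> ennreal v \<le> g (2 * c)"
  shows "ennreal (real p / 4 * v) \<le> (\<Sum>j<p. g j)"
proof -
  have "real p \<le> 4 * real (p div 2)" using p by linarith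
  then have "real p / 4 * v \<le> real (p div 2) * v" using v by (intro mult_right_mono) auto
  then have "ennreal (real p / 4 * v) \<le> ennreal (real (p div 2) * v)" by (rule ennreal_leI)
  also have "\<dots> = (\<Sum>c<p div 2. ennreal v)" using v by (simp add: ennreal_of_nat_mult_real)
  also have "\<dots> \<le> (\<Sum>c<p div 2. g (2 * c))" by (intro sum_mono g) auto
  also have "\<dots> = (\<Sum>j\<in>(\<lambda>c. 2 * c) ` {..<p div 2}. g j)" by (simp add: sum.reindex inj_on_def)
  also have "\<dots> \<le> (\<Sum>j<p. g j)" by (intro sum_mono2) auto
  finally show ?thesis .
qed

lemma Hstar_det_lower:
  assumes att: "exponent_attained \<theta> r \<rho> h s s' t" and \<rho>: "-1 < \<rho>" "\<rho> < 1"
    and \<theta>: "0 \<le> \<theta>" and r: "0 < r" and p: "2 \<le> p" and half: "real p powr (- \<theta>) \<le> 1 / 2"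
    and gram: "\<And>j k. j < p \<Longrightarrow> k < p \<Longrightarrow> (\<Sum>i<n. X i j * X i k) = Sigma_mat \<rho> p j k"
  shows "real p / 4 * (3/16 * exp (- 6 * tau r p) * real p powr (- h)) \<le> Hstar_det \<theta> r X n p"
  unfolding Hstar_det_def
proof (rule cINF_greatest)
  show "vec_space n \<rightarrow>\<^sub>M vec_space p \<noteq> {}" using const_in_vec_space by blast
  fix f assume f: "f \<in> vec_space n \<rightarrow>\<^sub>M vec_space p"
  let ?X = "\<lambda>(i, k). X i k"
  let ?R = "integral\<^sup>L (det_model \<theta> r n p) (\<lambda>(b, z). hamming p (f (response n p ?X b z)) b)"
  have "ennreal (real p / 4 * (3/16 * exp (- 6 * tau r p) * real p powr (- h)))
     \<le> (\<Sum>j<p. \<integral>\<^sup>+b. err_prob n p ?X f j b \<partial>PiM {..<p} (\<lambda>_. beta_prior \<theta> r p))"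
  proof (rule sum_even_coordinates_ge[OF p])
    fix c assume c: "Suc (2 * c) < p"
    define a :: real where "a = of_bool s' - of_bool s"
    define y where "y = (\<lambda>k. if k = 2 * c then 1 else if k = Suc (2 * c) then a else 0)"
    have "(\<Sum>i<n. (tau r p * (X i (2 * c) + a * X i (Suc (2 * c))))\<^sup>2)
      = (\<Sum>i<n. (tau r p)\<^sup>2 * ((\<Sum>k<p. y k * X i k) * (\<Sum>k<p. y k * X i k)))"
      unfolding y_def sum_two_point[OF c] by (intro sum.cong refl) (simp add: power2_eq_square mult_ac)
    also have "\<dots> = (tau r p)\<^sup>2 * quad \<rho> p y y"
      unfolding sum_distrib_left[symmetric] by (simp only: gram_quad[OF gram])
    also have "quad \<rho> p y y = pair_dist \<rho> s s'"
      unfolding y_def quad_two_point[OF c] by (simp add: pair_dist_def a_def)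
    \<comment> \<open>The Gram identity gives the distance exactly, hence \<delta> = 0.\<close>
    finally have "ennreal (3/16 * exp (- 6 * tau r p) * real p powr (- h - 4 * 0 * r))
      \<le> (\<integral>\<^sup>+b. err_prob n p ?X f (2 * c) b \<partial>PiM {..<p} (\<lambda>_. beta_prior \<theta> r p))"
      by (intro err_prob_lower_powr[OF att \<rho> \<theta> r p half f c]) (simp_all add: a_def)
    then show "ennreal (3/16 * exp (- 6 * tau r p) * real p powr (- h))
      \<le> (\<integral>\<^sup>+b. err_prob n p ?X f (2 * c) b \<partial>PiM {..<p} (\<lambda>_. beta_prior \<theta> r p))"
      by simp
  qed simp
  also have "\<dots> = ennreal ?R"
    by (rule det_risk_eq[OF f, symmetric])
  finally have "ennreal (real p / 4 * (3/16 * exp (- 6 * tau r p) * real p powr (- h))) \<le> ennreal ?R" .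
  moreover have "0 \<le> ?R"
    by (intro Bochner_Integration.integral_nonneg) (auto simp: hamming_nonneg)
  ultimately show "real p / 4 * (3/16 * exp (- 6 * tau r p) * real p powr (- h)) \<le> ?R"
    by (simp only: ennreal_le_iff)
qed

text \<open>The squared distance averages to its deterministic value \<open>T\<close>, so Markov's
  inequality keeps it below \<open>(1 + \<delta>) * T\<close> with probability at least
  \<open>\<delta> / (1 + \<delta>)\<close>, which is at least \<open>\<delta> / 2\<close>. On this
  event the two-point bound applies to the realised design.\<close>

lemma Hstar_rand_lower:
  assumes att: "exponent_attained \<theta> r \<rho> h s s' t" and \<rho>: "-1 < \<rho>" "\<rho> < 1"
    and \<theta>: "0 \<le> \<theta>" and r: "0 < r" and p: "2 \<le> p" and half: "real p powr (- \<theta>) \<le> 1 / 2"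
    and gram: "\<And>j k. j < p \<Longrightarrow> k < p \<Longrightarrow> (\<Sum>m<p. L j m * L k m) = Sigma_mat \<rho> p j k"
    and n: "0 < n" and \<delta>: "0 < \<delta>" "\<delta> \<le> 1"
  shows "real p / 4 * (\<delta> / 2 * (3/16 * exp (- 6 * tau r p) * real p powr (- h - 4 * \<delta> * r))) \<le> Hstar_rand \<theta> r L n p"
  unfolding Hstar_rand_def
proof (rule cINF_greatest)
  show "mat_space n p \<Otimes>\<^sub>M vec_space n \<rightarrow>\<^sub>M vec_space p \<noteq> {}" using const_in_vec_space by blast
  fix f assume f: "f \<in> mat_space n p \<Otimes>\<^sub>M vec_space n \<rightarrow>\<^sub>M vec_space p"
  let ?R = "integral\<^sup>L (rand_model \<theta> r n p) (\<lambda>(W, b, z). let X = design L n p W in hamming p (f (X, response n p X b z)) b)"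
  let ?W = "PiM ({..<n} \<times> {..<p}) (\<lambda>_. N01)" and ?B = "PiM {..<p} (\<lambda>_. beta_prior \<theta> r p)"
  let ?v = "3/16 * exp (- 6 * tau r p) * real p powr (- h - 4 * \<delta> * r)"
  interpret W: prob_space ?W by (rule prob_space_PiM_N01)
  have "ennreal (real p / 4 * (\<delta> / 2 * ?v))
     \<le> (\<Sum>j<p. \<integral>\<^sup>+W. \<integral>\<^sup>+b. err_prob n p (design L n p W) (\<lambda>y. f (design L n p W, y)) j b \<partial>?B \<partial>?W)"
  proof (rule sum_even_coordinates_ge[OF p])
    fix c assume c: "Suc (2 * c) < p"
    define a :: real where "a = of_bool s' - of_bool s"
    define y where "y = (\<lambda>k. if k = 2 * c then 1 else if k = Suc (2 * c) then a else 0)"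
    define T where "T = (tau r p)\<^sup>2 * pair_dist \<rho> s s'"
    define v where "v = (\<lambda>m. (tau r p * (1 / sqrt (real n))) * (\<Sum>k<p. y k * L k m))"
    define D where "D = (\<lambda>W. \<Sum>i<n. (\<Sum>m<p. v m * W (i, m))\<^sup>2)"
    have T: "0 < T" using pair_dist_bounds[OF \<rho>] r p by (simp add: T_def tau_def)
    have D_design: "(\<Sum>i<n. (tau r p * (design L n p W (i, 2 * c) + (of_bool s' - of_bool s) * design L n p W (i, Suc (2 * c))))\<^sup>2) = D W" for W
      unfolding D_def
    proof (intro sum.cong refl arg_cong[where f = "\<lambda>x. x\<^sup>2"])
      fix i assume "i \<in> {..<n}"
      then have i: "i < n" by simp
      have "tau r p * (design L n p W (i, 2 * c) + (of_bool s' - of_bool s) * design L n p W (i, Suc (2 * c)))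
        = tau r p * (\<Sum>k<p. y k * design L n p W (i, k))"
        unfolding y_def sum_two_point[OF c] a_def ..
      also have "\<dots> = (\<Sum>m<p. v m * W (i, m))"
        unfolding design_linear[OF i] v_def sum_distrib_left[of "tau r p"] by (simp only: mult.assoc)
      finally show "tau r p * (design L n p W (i, 2 * c) + (of_bool s' - of_bool s) * design L n p W (i, Suc (2 * c)))
        = (\<Sum>m<p. v m * W (i, m))" .
    qed
    \<comment> \<open>A functional of one row is written over all matrix entries, so that
      \<open>gaussian_second_moment\<close> applies.\<close>
    have row: "(\<Sum>q\<in>{..<n} \<times> {..<p}. (if fst q = i then x (snd q) else 0) * w q) = (\<Sum>m<p. x m * w (i, m))"
      if "i < n" for i x and w :: "nat \<times> nat \<Rightarrow> real"
    proof -
      have "(\<Sum>q\<in>{..<n} \<times> {..<p}. (if fst q = i then x (snd q) else 0) * w q)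
        = (\<Sum>q\<in>Pair i ` {..<p}. (if fst q = i then x (snd q) else 0) * w q)"
        using that by (intro sum.mono_neutral_right) auto
      then show ?thesis by (simp add: sum.reindex inj_on_def)
    qed
    have v2: "(\<Sum>m<p. (v m)\<^sup>2) = T / real n"
    proof -
      have "(\<Sum>m<p. (v m)\<^sup>2) = (tau r p * (1 / sqrt (real n))) * (tau r p * (1 / sqrt (real n))) * quad \<rho> p y y"
        unfolding v_def power2_eq_square by (rule linear_gram[OF gram])
      also have "quad \<rho> p y y = pair_dist \<rho> s s'"
        unfolding y_def quad_two_point[OF c] by (simp add: pair_dist_def a_def)
      finally show ?thesis by (simp add: T_def power2_eq_square)
    qed
    have mrow: "(\<lambda>W. \<Sum>m<p. v m * W (i, m)) \<in> borel_measurable ?W" if "i < n" for i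
      using that by (intro borel_measurable_sum borel_measurable_times borel_measurable_const measurable_component_N01) auto
    have mD[measurable]: "D \<in> borel_measurable ?W"
      unfolding D_def by (intro borel_measurable_sum borel_measurable_power mrow) auto
    have row_moment: "(\<integral>\<^sup>+W. ennreal ((\<Sum>m<p. v m * W (i, m))\<^sup>2) \<partial>?W) = ennreal (T / real n)" if i: "i < n" for i
    proof -
      have "(\<integral>\<^sup>+W. ennreal ((\<Sum>q\<in>{..<n} \<times> {..<p}. (if fst q = i then v (snd q) else 0) * W q)\<^sup>2) \<partial>?W)
        = ennreal (\<Sum>q\<in>{..<n} \<times> {..<p}. (if fst q = i then v (snd q) else 0)\<^sup>2)"
        by (rule gaussian_second_moment) simp
      also have "(\<Sum>q\<in>{..<n} \<times> {..<p}. (if fst q = i then v (snd q) else 0)\<^sup>2)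
        = (\<Sum>q\<in>{..<n} \<times> {..<p}. (if fst q = i then v (snd q) else 0) * v (snd q))"
        by (intro sum.cong refl) (simp add: power2_eq_square)
      also have "\<dots> = T / real n"
        unfolding row[OF i, of v "\<lambda>q. v (snd q)"] using v2 by (simp add: power2_eq_square)
      finally show ?thesis unfolding row[OF i] .
    qed
    have "(\<integral>\<^sup>+W. ennreal (D W) \<partial>?W) = (\<integral>\<^sup>+W. (\<Sum>i<n. ennreal ((\<Sum>m<p. v m * W (i, m))\<^sup>2)) \<partial>?W)"
      unfolding D_def by (simp add: sum_ennreal)
    also have "\<dots> = (\<Sum>i<n. \<integral>\<^sup>+W. ennreal ((\<Sum>m<p. v m * W (i, m))\<^sup>2) \<partial>?W)"
      by (intro nn_integral_sum measurable_compose[OF _ measurable_ennreal] borel_measurable_power mrow) auto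
    also have "\<dots> = (\<Sum>i<n. ennreal (T / real n))"
      by (intro sum.cong refl row_moment) simp
    also have "\<dots> = ennreal T"
      using n T by (simp add: ennreal_of_nat_mult_real)
    finally have ED: "(\<integral>\<^sup>+W. ennreal (D W) \<partial>?W) = ennreal T" .
    let ?P = "\<integral>\<^sup>+W. (if D W \<le> (1 + \<delta>) * T then 1 else 0) \<partial>?W"
    have P: "ennreal (\<delta> / 2) \<le> ?P"
    proof -
      have "1 = (\<integral>\<^sup>+W. 1 \<partial>?W)" by (simp add: W.emeasure_space_1)
      also have "\<dots> \<le> (\<integral>\<^sup>+W. (if D W \<le> (1 + \<delta>) * T then 1 else 0) + ennreal (1 / ((1 + \<delta>) * T)) * ennreal (D W) \<partial>?W)"
      proof (rule nn_integral_mono)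
        fix W
        show "1 \<le> (if D W \<le> (1 + \<delta>) * T then 1 else 0) + ennreal (1 / ((1 + \<delta>) * T)) * ennreal (D W)"
        proof (cases "D W \<le> (1 + \<delta>) * T")
          case False
          moreover have "0 < (1 + \<delta>) * T" using \<delta> T by simp
          ultimately have "1 \<le> 1 / ((1 + \<delta>) * T) * D W" "0 \<le> D W" by (auto simp: field_simps)
          then show ?thesis using False \<delta> T by (simp flip: ennreal_mult)
        qed simp
      qed
      also have "\<dots> = ?P + ennreal (1 / ((1 + \<delta>) * T)) * ennreal T"
        by (subst nn_integral_add) (auto simp: nn_integral_cmult ED)
      also have "ennreal (1 / ((1 + \<delta>) * T)) * ennreal T = ennreal (1 / (1 + \<delta>))"
        using \<delta> T by (simp flip: ennreal_mult)
      finally have "1 \<le> ?P + ennreal (1 / (1 + \<delta>))" .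
      moreover have "?P \<noteq> \<top>"
      proof -
        have "?P \<le> (\<integral>\<^sup>+W. 1 \<partial>?W)" by (intro nn_integral_mono) auto
        then show ?thesis by (auto simp: W.emeasure_space_1 top_unique)
      qed
      ultimately have "ennreal (1 - 1 / (1 + \<delta>)) \<le> ?P"
        using \<delta> by (cases ?P) (auto simp flip: ennreal_plus ennreal_1 simp del: ennreal_1)
      moreover have "\<delta> / 2 \<le> 1 - 1 / (1 + \<delta>)"
      proof -
        have "1 - 1 / (1 + \<delta>) = \<delta> / (1 + \<delta>)" using \<delta> by (simp add: field_simps)
        moreover have "\<delta> / 2 \<le> \<delta> / (1 + \<delta>)" using \<delta> by (intro divide_left_mono) auto
        ultimately show ?thesis by simp
      qed
      ultimately show ?thesis by (meson ennreal_leI order_trans)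
    qed
    have "ennreal (\<delta> / 2 * ?v) = ennreal ?v * ennreal (\<delta> / 2)"
      using \<delta> by (subst ennreal_mult[symmetric]) (auto simp: mult_ac)
    also have "\<dots> \<le> ennreal ?v * ?P"
      using P by (intro mult_left_mono) auto
    also have "\<dots> = (\<integral>\<^sup>+W. ennreal ?v * (if D W \<le> (1 + \<delta>) * T then 1 else 0) \<partial>?W)"
      by (intro nn_integral_cmult[symmetric]) measurable
    also have "\<dots> \<le> (\<integral>\<^sup>+W. \<integral>\<^sup>+b. err_prob n p (design L n p W) (\<lambda>y. f (design L n p W, y)) (2 * c) b \<partial>?B \<partial>?W)"
    proof (rule nn_integral_mono)
      fix W
      have "design L n p W \<in> space (mat_space n p)"
        by (auto simp: design_def mat_space_def space_PiM)
      then have fW: "(\<lambda>y. f (design L n p W, y)) \<in> vec_space n \<rightarrow>\<^sub>M vec_space p"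
        by (intro measurable_compose[OF _ f] measurable_Pair measurable_const) auto
      show "ennreal ?v * (if D W \<le> (1 + \<delta>) * T then 1 else 0)
        \<le> (\<integral>\<^sup>+b. err_prob n p (design L n p W) (\<lambda>y. f (design L n p W, y)) (2 * c) b \<partial>?B)"
      proof (cases "D W \<le> (1 + \<delta>) * T")
        case True
        then have "ennreal ?v \<le> (\<integral>\<^sup>+b. err_prob n p (design L n p W) (\<lambda>y. f (design L n p W, y)) (2 * c) b \<partial>?B)"
          using \<delta> unfolding D_design[symmetric] T_def
          by (intro err_prob_lower_powr[OF att \<rho> \<theta> r p half fW c]) auto
        with True show ?thesis by simp
      qed simp
    qed
    finally show "ennreal (\<delta> / 2 * ?v)
      \<le> (\<integral>\<^sup>+W. \<integral>\<^sup>+b. err_prob n p (design L n p W) (\<lambda>y. f (design L n p W, y)) (2 * c) b \<partial>?B \<partial>?W)" .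
  qed (use \<delta> in simp)
  also have "\<dots> = ennreal ?R"
    by (rule rand_risk_eq(1)[OF f, symmetric])
  finally have "ennreal (real p / 4 * (\<delta> / 2 * ?v)) \<le> ennreal ?R" .
  moreover have "0 \<le> ?R"
    by (intro Bochner_Integration.integral_nonneg) (auto simp: hamming_nonneg Let_def)
  ultimately show "real p / 4 * (\<delta> / 2 * ?v) \<le> ?R"
    by (simp only: ennreal_le_iff)
qed

text \<open>Since \<open>tau\<close> grows like the square root of \<open>ln p\<close>, the factor
  \<open>exp (- 6 * tau r p)\<close> eventually exceeds \<open>p powr (- \<epsilon> / 2)\<close>;
  the other half of \<epsilon> pays for \<open>d\<close>.\<close>

lemma powr_lower_of_tau:
  assumes H: "\<forall>\<^sub>F p in sequentially. c * (real p * exp (- 6 * tau r p) * real p powr (- h - d)) \<le> H p"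
    and c: "0 < c" and r: "0 < r" and d: "d \<le> \<epsilon> / 2" and \<epsilon>: "0 < \<epsilon>"
  shows "\<exists>c>0. \<forall>\<^sub>F p in sequentially. c * real p powr (1 - h - \<epsilon>) \<le> H p"
proof (intro exI conjI)
  have "\<forall>\<^sub>F p in sequentially. 6 * sqrt (2 * r * ln (real p)) \<le> \<epsilon> / 2 * ln (real p)"
    using r \<epsilon> by real_asymp
  then show "\<forall>\<^sub>F p in sequentially. c * real p powr (1 - h - \<epsilon>) \<le> H p"
    using H eventually_ge_at_top[of 2]
  proof eventually_elim
    case (elim p)
    have p: "1 \<le> real p" using elim by simp
    have "real p powr (- (\<epsilon> / 2)) \<le> exp (- 6 * tau r p)"
      using elim p by (simp add: tau_def powr_def)
    moreover have "real p powr (- h - \<epsilon> / 2) \<le> real p powr (- h - d)"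
      using p d by (intro powr_mono) auto
    ultimately have "real p powr (- (\<epsilon> / 2)) * real p powr (- h - \<epsilon> / 2) \<le> exp (- 6 * tau r p) * real p powr (- h - d)"
      by (intro mult_mono) auto
    then have "c * (real p * (real p powr (- (\<epsilon> / 2)) * real p powr (- h - \<epsilon> / 2)))
      \<le> c * (real p * (exp (- 6 * tau r p) * real p powr (- h - d)))"
      using c by (intro mult_left_mono) auto
    moreover have "real p * (real p powr (- (\<epsilon> / 2)) * real p powr (- h - \<epsilon> / 2)) = real p powr (1 - h - \<epsilon>)"
    proof -
      have "real p powr (- (\<epsilon> / 2)) * real p powr (- h - \<epsilon> / 2) = real p powr (- h - \<epsilon>)"
        unfolding powr_add[symmetric] by (simp add: algebra_simps)
      moreover have "real p * real p powr (- h - \<epsilon>) = real p powr (1 - h - \<epsilon>)"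
        using p powr_mult_base[of "real p" "- h - \<epsilon>"] by (simp add: algebra_simps)
      ultimately show ?thesis by simp
    qed
    ultimately show ?case using elim(2) by (simp add: mult.assoc)
  qed
qed (rule c)

theorem theorem3p6:
  fixes \<theta> r \<rho> :: real
  assumes "0 < \<theta>" "\<theta> < 1" "0 < r" "-1 < \<rho>" "\<rho> < 1"
  shows "\<exists>h :: real.
    (\<forall>\<omega> :: real. \<forall>L :: nat \<Rightarrow> nat \<Rightarrow> nat \<Rightarrow> real.
       \<omega> > 1 - \<theta>
       \<longrightarrow> (\<forall>p j k. j < p \<longrightarrow> k < p \<longrightarrow> (\<Sum>m<p. L p j m * L p k m) = Sigma_mat \<rho> p j k)
       \<longrightarrow> is_Lp (\<lambda>p. Hstar_rand \<theta> r (L p) (nat \<lceil>real p powr \<omega>\<rceil>) p / real p powr (1 - h)))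
  \<and> (\<forall>n :: nat \<Rightarrow> nat. \<forall>X :: nat \<Rightarrow> nat \<Rightarrow> nat \<Rightarrow> real.
       (\<forall>p j k. j < p \<longrightarrow> k < p \<longrightarrow> (\<Sum>i<n p. X p i j * X p i k) = Sigma_mat \<rho> p j k)
       \<longrightarrow> is_Lp (\<lambda>p. Hstar_det \<theta> r (X p) (n p) p / real p powr (1 - h)))"
proof -
  \<comment> \<open>\<open>h\<close> is fixed from \<theta>, r and \<rho> before \<omega> and the
    designs are introduced.\<close>
  obtain h s s' t where bound: "exponent_bound \<theta> r \<rho> h" and att: "exponent_attained \<theta> r \<rho> h s s' t"
    using optimal_exponent_exists[of \<theta> r \<rho>] assms by blast
  have half: "\<forall>\<^sub>F p in sequentially. real p powr (- \<theta>) \<le> 1 / 2"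
    using assms(1) by real_asymp
  have \<theta>: "0 \<le> \<theta>" and \<rho>: "\<bar>\<rho>\<bar> \<le> 1" using assms by auto
  show ?thesis
  proof (rule exI[of _ h], intro conjI allI impI)
    fix \<omega> :: real and L :: "nat \<Rightarrow> nat \<Rightarrow> nat \<Rightarrow> real"
    assume \<omega>: "\<omega> > 1 - \<theta>"
      and gram: "\<forall>p j k. j < p \<longrightarrow> k < p \<longrightarrow> (\<Sum>m<p. L p j m * L p k m) = Sigma_mat \<rho> p j k"
    define n where "n = (\<lambda>p. nat \<lceil>real p powr \<omega>\<rceil>)"
    \<comment> \<open>Half of the gap between \<omega> and 1 - \<theta>. One half lets the threshold
      \<open>S\<close> exceed the mean number of signals \<open>p powr (1 - \<theta>)\<close> by a
      power of \<open>p\<close>; the other leaves \<open>p powr e * S \<le> n p\<close>.\<close>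
    define e where "e = (\<omega> - (1 - \<theta>)) / 2"
    have e: "0 < e" "0 < \<omega>" and \<omega>e: "\<omega> = (1 - \<theta> + e) + e"
      using \<omega> assms by (auto simp: e_def field_simps)
    have n_ge: "real p powr \<omega> \<le> real (n p)" for p
      unfolding n_def by linarith
    have n_pos: "0 < n p" if "2 \<le> p" for p
    proof -
      have "0 < real p powr \<omega>" using that by simp
      with n_ge[of p] have "0 < real (n p)" by linarith
      then show ?thesis by simp
    qed
    have "is_Lp (\<lambda>p. Hstar_rand \<theta> r (L p) (n p) p / real p powr (1 - h))"
    proof (rule is_Lp_of_bounds)
      \<comment> \<open>With \<open>\<tau>\<^sup>2 = 2 * r * ln p\<close>, these yield in order the
        conditions \<open>c2\<close>, \<open>c1\<close>, \<open>c3\<close>, \<open>c4\<close> and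
        \<open>c5\<close> of \<open>Hstar_rand_upper\<close>.\<close>
      have "\<forall>\<^sub>F p in sequentially. 16 * r\<^sup>2 * (ln (real p))\<^sup>2 \<le> real p powr e"
        "\<forall>\<^sub>F p in sequentially. 4 * r * ln (real p) \<le> real p powr e"
        "\<forall>\<^sub>F p in sequentially. 64 * r\<^sup>2 * (ln (real p))\<^sup>2 \<le> real p powr \<omega>"
        "\<forall>\<^sub>F p in sequentially. 16 * r * ln (real p) \<le> real p powr \<omega>"
        "\<forall>\<^sub>F p in sequentially. 2 + \<bar>h\<bar> * ln (real p) \<le> real p powr e"
        using e by real_asymp+
      then show "\<forall>\<^sub>F p in sequentially. Hstar_rand \<theta> r (L p) (n p) p \<le> (16 * exp 2 + 1) * real p powr (1 - h)"
        using eventually_ge_at_top[of 2]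
      proof eventually_elim
        case (elim p)
        define S where "S = real p powr (1 - \<theta> + e)"
        have p: "2 \<le> p" "1 \<le> real p" using elim by auto
        have \<tau>2: "(tau r p)\<^sup>2 = 2 * r * ln (real p)" using assms p by (intro tau_squared) auto
        have S0: "0 \<le> S" by (simp add: S_def)
        have nS: "real p powr e * S \<le> real (n p)"
          using n_ge[of p] unfolding S_def powr_add[symmetric] \<omega>e by (simp add: add.commute)
        show ?case
        proof (rule Hstar_rand_upper[OF bound \<theta> assms(3) p(1) \<rho> _ n_pos[OF p(1)], where S = S])
          show "2 * (tau r p)\<^sup>2 * S \<le> real (n p)"
            using mult_right_mono[OF elim(2) S0] nS by (simp add: \<tau>2)
          have eq: "4 * (tau r p)\<^sup>2 * (2 * (tau r p)\<^sup>2 * S) = 2 * (16 * r\<^sup>2 * (ln (real p))\<^sup>2 * S)"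
            unfolding \<tau>2 by (simp add: power2_eq_square)
          show "4 * (tau r p)\<^sup>2 * (2 * (tau r p)\<^sup>2 * S) \<le> 2 * real (n p)"
            unfolding eq using mult_right_mono[OF elim(1) S0] nS by linarith
          have "(4 * (tau r p)\<^sup>2)\<^sup>2 = 64 * r\<^sup>2 * (ln (real p))\<^sup>2"
            by (simp add: \<tau>2 power_mult_distrib)
          then show "(4 * (tau r p)\<^sup>2)\<^sup>2 \<le> real (n p)"
            using elim(3) n_ge[of p] by simp
          show "8 * (tau r p)\<^sup>2 \<le> real (n p)"
            using elim(4) n_ge[of p] by (simp add: \<tau>2)
          show "exp (2 * real p powr (1 - \<theta>) - S) \<le> real p powr (- h)"
          proof -
            have ln: "0 \<le> ln (real p)" using p by simp
            \<comment> \<open>The absolute value avoids a discussion of the sign of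
              \<open>h\<close>. Multiplication by a power that is at least 1 lets a single growth
              condition cover both terms to be dominated by \<open>S\<close>.\<close>
            have "1 \<le> real p powr (1 - \<theta>)" using p assms by (intro ge_one_powr_ge_zero) auto
            then have "\<bar>h\<bar> * ln (real p) \<le> real p powr (1 - \<theta>) * (\<bar>h\<bar> * ln (real p))"
              using ln mult_right_mono[of 1 "real p powr (1 - \<theta>)" "\<bar>h\<bar> * ln (real p)"] by simp
            moreover have "h * ln (real p) \<le> \<bar>h\<bar> * ln (real p)"
              using ln by (intro mult_right_mono) auto
            moreover have "real p powr (1 - \<theta>) * (2 + \<bar>h\<bar> * ln (real p)) \<le> S"
              unfolding S_def powr_add using elim(5) by (intro mult_left_mono) auto
            ultimately have "2 * real p powr (1 - \<theta>) - S \<le> - h * ln (real p)"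
              by (simp add: algebra_simps)
            then show ?thesis using p by (simp add: powr_def)
          qed
        qed (use gram in blast)
      qed
    next
      fix \<epsilon> :: real assume \<epsilon>: "0 < \<epsilon>"
      \<comment> \<open>Keeps the loss \<open>4 * \<delta> * r\<close> within
        \<open>\<epsilon> / 2\<close>. As \<delta> does not vary with \<open>p\<close>, the
        probability \<open>\<delta> / 2\<close> affects only the constant.\<close>
      define \<delta> where "\<delta> = min 1 (\<epsilon> / (8 * r))"
      have \<delta>: "0 < \<delta>" "\<delta> \<le> 1" and \<delta>\<epsilon>: "4 * \<delta> * r \<le> \<epsilon> / 2"
        using \<epsilon> assms by (auto simp: \<delta>_def min_def field_simps)
      show "\<exists>c>0. \<forall>\<^sub>F p in sequentially. c * real p powr (1 - h - \<epsilon>) \<le> Hstar_rand \<theta> r (L p) (n p) p"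
      proof (rule powr_lower_of_tau[where c = "3 * \<delta> / 128" and d = "4 * \<delta> * r", OF _ _ assms(3) \<delta>\<epsilon> \<epsilon>])
        show "\<forall>\<^sub>F p in sequentially. 3 * \<delta> / 128 * (real p * exp (- 6 * tau r p) * real p powr (- h - 4 * \<delta> * r))
            \<le> Hstar_rand \<theta> r (L p) (n p) p"
          using half eventually_ge_at_top[of 2]
        proof eventually_elim
          case (elim p)
          have "real p / 4 * (\<delta> / 2 * (3/16 * exp (- 6 * tau r p) * real p powr (- h - 4 * \<delta> * r)))
            \<le> Hstar_rand \<theta> r (L p) (n p) p"
            using gram by (intro Hstar_rand_lower[OF att assms(4,5) \<theta> assms(3) elim(2,1) _ n_pos[OF elim(2)] \<delta>]) blast
          then show ?case by (simp add: mult_ac)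
        qed
      qed (use \<delta> in simp)
    qed
    then show "is_Lp (\<lambda>p. Hstar_rand \<theta> r (L p) (nat \<lceil>real p powr \<omega>\<rceil>) p / real p powr (1 - h))"
      by (simp add: n_def)
  next
    fix n :: "nat \<Rightarrow> nat" and X :: "nat \<Rightarrow> nat \<Rightarrow> nat \<Rightarrow> real"
    assume gram: "\<forall>p j k. j < p \<longrightarrow> k < p \<longrightarrow> (\<Sum>i<n p. X p i j * X p i k) = Sigma_mat \<rho> p j k"
    show "is_Lp (\<lambda>p. Hstar_det \<theta> r (X p) (n p) p / real p powr (1 - h))"
    proof (rule is_Lp_of_bounds)
      show "\<forall>\<^sub>F p in sequentially. Hstar_det \<theta> r (X p) (n p) p \<le> 16 * real p powr (1 - h)"
        using eventually_ge_at_top[of 2]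
      proof eventually_elim
        case (elim p)
        show ?case using gram by (intro Hstar_det_upper[OF bound \<theta> assms(3) elim]) blast
      qed
    next
      fix \<epsilon> :: real assume \<epsilon>: "0 < \<epsilon>"
      show "\<exists>c>0. \<forall>\<^sub>F p in sequentially. c * real p powr (1 - h - \<epsilon>) \<le> Hstar_det \<theta> r (X p) (n p) p"
      proof (rule powr_lower_of_tau[where c = "3 / 64" and d = 0, OF _ _ assms(3) _ \<epsilon>])
        show "\<forall>\<^sub>F p in sequentially. 3 / 64 * (real p * exp (- 6 * tau r p) * real p powr (- h - 0))
            \<le> Hstar_det \<theta> r (X p) (n p) p"
          using half eventually_ge_at_top[of 2]
        proof eventually_elim
          case (elim p)
          have "real p / 4 * (3/16 * exp (- 6 * tau r p) * real p powr (- h)) \<le> Hstar_det \<theta> r (X p) (n p) p"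
            using gram by (intro Hstar_det_lower[OF att assms(4,5) \<theta> assms(3) elim(2,1)]) blast
          then show ?case by (simp add: mult_ac)
        qed
      qed (use \<epsilon> in simp_all)
    qed
  qed
qed

end
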